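(* Let $r\ge2$ be an integer. A function $q\in S_r^0(T^{\rm ps})$ is uniquely determined by the following degrees of freedom: (a) $q(z_i),\ \nabla q(z_i)$, $1\le i\le3$ ($9$ DOFs); (b) $q(z_{3+i}),\ \partial_tq(z_{3+i})$, $1\le i\le3$, if $r\ge3$ ($6$ DOFs); (c) $\int_e\partial_nq\,p$ for all $p\in\mathcal P_{r-3}(e)$, $e\in\mathcal E^b(T^{\rm ps})$ ($6(r-2)$ DOFs); (d) $\int_eq\,p$ for all $p\in\mathcal P_{r-4}(e)$, $e\in\mathcal E^b(T^{\rm ps})$ ($6(r-3)$ DOFs if $r\ge 3$, none if $r=2$); (e) $\int_T\operatorname{rot}q\cdot\operatorname{rot}p$ for all $p\in\mathring S_r^0(T^{\rm ps})$ ($3(r-2)(r-3)$ DOFs).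
   Context: Let $T\subset\mathbb R^2$ be a (closed, nondegenerate) triangle with vertices $z_1,z_2,z_3$, labelled counter-clockwise, and let $z_0$ be a point in the interior of $T$. Let $e_i=[z_{i+1},z_{i+2}]$ (indices $1,2,3$ modulo $3$) be the edge opposite $z_i$, with outward unit normal $n_i$ and unit tangent $t_i$, and let $z_{3+i}$ be a point in the relative interior of $e_i$, $i=1,2,3$. The Powell--Sabin split $T^{\rm ps}=\{T_1,\dots,T_6\}$ is the triangulation of $T$ obtained by connecting $z_0$ to each of $z_1,\dots,z_6$. $\mathcal E^b(T^{\rm ps})$ is the set of the six boundary edges of $T^{\rm ps}$ (each $e_i$ is divided in two by $z_{3+i}$). $\partial_t,\partial_n$ denote tangential and normal derivatives along the boundary edges of $T$ (with $t=t_i$, $n=n_i$ on $e_i$). For scalar $q$, $\operatorname{rot}q=(\partial q/\partial x_2,-\partial q/\partial x_1)^\top$. $\mathcal P_k(S)$ is the space of polynomials of degree $\le k$ on $S$, with $\mathcal P_k(S)=\{0\}$ for $k<0$; $\mathcal P_k(T^{\rm ps})=\{q\in L^2(T): q|_S\in\mathcal P_k(S)\ \forall S\in T^{\rm ps}\}$; $S_k^0(T^{\rm ps})=\{v\in\mathcal P_k(T^{\rm ps})\cap C(T):\operatorname{rot}v\in[C(T)]^2\}$; $\mathring S_k^0(T^{\rm ps})=\{v\in S_k^0(T^{\rm ps}): v=0,\ \operatorname{rot}v=0\text{ on }\partial T\}$. "Uniquely determined by the degrees of freedom" means that the degrees of freedom are unisolvent: their number equals the dimension of the space (here $\dim S_r^0(T^{\rm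 ps})=3r^2-3r+3$), and the only function in the space at which all of them vanish is $0$. *)

theory Defs
  imports "HOL-Analysis.Analysis" "HOL-Library.Function_Algebras"
begin

text \<open>
  Functions on a subset of the plane are represented by their extension by zero to
  the whole plane, so that a function space on \<open>S\<close> is a linear subspace of
  \<open>real^2 \<Rightarrow> real\<close> and two functions agreeing on \<open>S\<close> are equal. Dimension is the
  library's \<open>dim\<close> for the pointwise vector space structure; it is \<open>0\<close> on
  infinite-dimensional subspaces.
\<close>

definition fun_scale :: "real \<Rightarrow> (real^2 \<Rightarrow> real) \<Rightarrow> real^2 \<Rightarrow> real" where
  "fun_scale c f = (\<lambda>x. c * f x)"

lemma vector_space_fun_scale: "vector_space fun_scale"
  by unfold_locales (auto simp: fun_scale_def fun_eq_iff algebra_simps)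

definition fun_dim :: "(real^2 \<Rightarrow> real) set \<Rightarrow> nat" where
  "fun_dim = vector_space.dim fun_scale"

text \<open>\<open>P\<^sub>k(S)\<close>; for \<open>k < 0\<close> the sum is empty and the space is \<open>{0}\<close>.\<close>

definition poly_space :: "int \<Rightarrow> (real^2) set \<Rightarrow> (real^2 \<Rightarrow> real) set" where
  "poly_space k S = {p. (\<forall>x. x \<notin> S \<longrightarrow> p x = 0) \<and>
     (\<exists>c :: nat \<Rightarrow> nat \<Rightarrow> real. \<forall>x\<in>S.
        p x = (\<Sum>(i, j)\<in>{(i, j). int i + int j \<le> k}. c i j * (x $ 1) ^ i * (x $ 2) ^ j))}"

text \<open>
  Derivatives are taken relative to the closed triangle \<open>T\<close>, so that they make sense
  up to the boundary; they are unique because \<open>T\<close> is convex with nonempty interior.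
\<close>

definition grad_on :: "(real^2) set \<Rightarrow> (real^2 \<Rightarrow> real) \<Rightarrow> real^2 \<Rightarrow> real^2" where
  "grad_on T q x = (\<chi> i. frechet_derivative q (at x within T) (axis i 1))"

definition rot_on :: "(real^2) set \<Rightarrow> (real^2 \<Rightarrow> real) \<Rightarrow> real^2 \<Rightarrow> real^2" where
  "rot_on T q x = vector [grad_on T q x $ 2, - (grad_on T q x $ 1)]"

text \<open>
  A Powell-Sabin configuration is a map \<open>z\<close> of which only \<open>z 0, \<dots>, z 6\<close> matter;
  \<open>nxt3\<close> reduces the indices \<open>1, \<dots>, 5\<close> to \<open>1, 2, 3\<close> modulo \<open>3\<close>.
\<close>

definition nxt3 :: "nat \<Rightarrow> nat" where
  "nxt3 i = (if i \<le> 3 then i else i - 3)"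

definition ps_T :: "(nat \<Rightarrow> real^2) \<Rightarrow> (real^2) set" where
  "ps_T z = convex hull {z 1, z 2, z 3}"

definition cross2 :: "real^2 \<Rightarrow> real^2 \<Rightarrow> real" where
  "cross2 u v = u $ 1 * v $ 2 - u $ 2 * v $ 1"

text \<open>
  The third condition says that \<open>z 1, z 2, z 3\<close> are the vertices of a nondegenerate
  triangle in counter-clockwise order.
\<close>

definition ps_points :: "(nat \<Rightarrow> real^2) \<Rightarrow> bool" where
  "ps_points z \<longleftrightarrow>
     z 0 \<in> interior (ps_T z) \<and>
     (\<forall>i\<in>{1..3}. z (3 + i) \<in> open_segment (z (nxt3 (i + 1))) (z (nxt3 (i + 2)))) \<and>
     cross2 (z 2 - z 1) (z 3 - z 1) > 0"

definition edge_normals :: "(nat \<Rightarrow> real^2) \<Rightarrow> (nat \<Rightarrow> real^2) \<Rightarrow> bool" where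
  "edge_normals z n \<longleftrightarrow> (\<forall>i\<in>{1..3}. norm (n i) = 1 \<and>
     n i \<bullet> (z (nxt3 (i + 2)) - z (nxt3 (i + 1))) = 0 \<and>
     n i \<bullet> (z i - z (nxt3 (i + 1))) < 0)"

text \<open>The orientation of the unit tangents is left arbitrary.\<close>

definition edge_tangents :: "(nat \<Rightarrow> real^2) \<Rightarrow> (nat \<Rightarrow> real^2) \<Rightarrow> bool" where
  "edge_tangents z t \<longleftrightarrow> (\<forall>i\<in>{1..3}. norm (t i) = 1 \<and>
     (\<exists>c. t i = c *\<^sub>R (z (nxt3 (i + 2)) - z (nxt3 (i + 1)))))"

text \<open>
  The two boundary edges of the split contained in the edge of \<open>T\<close> opposite \<open>z i\<close>,
  as pairs of endpoints; the six triangles join these edges, \<open>i = 1, 2, 3\<close>, to \<open>z 0\<close>.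
\<close>

definition half_edges :: "(nat \<Rightarrow> real^2) \<Rightarrow> nat \<Rightarrow> ((real^2) \<times> (real^2)) set" where
  "half_edges z i = {(z (nxt3 (i + 1)), z (3 + i)), (z (3 + i), z (nxt3 (i + 2)))}"

definition ps_triangles :: "(nat \<Rightarrow> real^2) \<Rightarrow> (real^2) set set" where
  "ps_triangles z = (\<Union>i\<in>{1..3}. (\<lambda>(a, b). convex hull {z 0, a, b}) ` half_edges z i)"

text \<open>
  Representatives of the classes in \<open>P\<^sub>k(T\<^sup>p\<^sup>s) \<subseteq> L\<^sup>2(T)\<close>: values on the
  triangle boundaries, a null set, are unrestricted here and get fixed only once
  continuity on \<open>T\<close> is imposed.
\<close>

definition ps_poly :: "int \<Rightarrow> (nat \<Rightarrow> real^2) \<Rightarrow> (real^2 \<Rightarrow> real) set" where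
  "ps_poly k z = {q. (\<forall>x. x \<notin> ps_T z \<longrightarrow> q x = 0) \<and>
     (\<forall>S\<in>ps_triangles z. \<exists>p\<in>poly_space k S. \<forall>x\<in>interior S. q x = p x)}"

definition ps_S :: "int \<Rightarrow> (nat \<Rightarrow> real^2) \<Rightarrow> (real^2 \<Rightarrow> real) set" where
  "ps_S k z = {v \<in> ps_poly k z. continuous_on (ps_T z) v \<and>
     (\<forall>x\<in>ps_T z. v differentiable (at x within ps_T z)) \<and>
     continuous_on (ps_T z) (rot_on (ps_T z) v)}"

definition ps_S0 :: "int \<Rightarrow> (nat \<Rightarrow> real^2) \<Rightarrow> (real^2 \<Rightarrow> real) set" where
  "ps_S0 k z = {v \<in> ps_S k z. \<forall>x\<in>frontier (ps_T z). v x = 0 \<and> rot_on (ps_T z) v x = 0}"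

text \<open>Integration with respect to arc length over the segment from \<open>a\<close> to \<open>b\<close>.\<close>

definition edge_integral :: "real^2 \<Rightarrow> real^2 \<Rightarrow> (real^2 \<Rightarrow> real) \<Rightarrow> real" where
  "edge_integral a b f = dist a b * integral {0..1} (\<lambda>s. f (linepath a b s))"

text \<open>
  Number of degrees of freedom: a value counts 1, a gradient 2, a tangential derivative 1,
  and moments against all members of a test space count the dimension of that space.
\<close>

definition ndof_a :: nat where
  "ndof_a = (\<Sum>i\<in>{1..3::nat}. 1 + CARD(2))"

definition ndof_b :: "nat \<Rightarrow> nat" where
  "ndof_b r = (if r \<ge> 3 then (\<Sum>i\<in>{1..3::nat}. 1 + 1) else 0)"

definition ndof_c :: "(nat \<Rightarrow> real^2) \<Rightarrow> nat \<Rightarrow> nat" where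
  "ndof_c z r = (\<Sum>i\<in>{1..3}. \<Sum>(a, b)\<in>half_edges z i.
      fun_dim (poly_space (int r - 3) (closed_segment a b)))"

definition ndof_d :: "(nat \<Rightarrow> real^2) \<Rightarrow> nat \<Rightarrow> nat" where
  "ndof_d z r = (\<Sum>i\<in>{1..3}. \<Sum>(a, b)\<in>half_edges z i.
      fun_dim (poly_space (int r - 4) (closed_segment a b)))"

definition ndof_e :: "(nat \<Rightarrow> real^2) \<Rightarrow> nat \<Rightarrow> nat" where
  "ndof_e z r = fun_dim (ps_S0 (int r) z)"

definition dof_a_zero :: "(nat \<Rightarrow> real^2) \<Rightarrow> (real^2 \<Rightarrow> real) \<Rightarrow> bool" where
  "dof_a_zero z q \<longleftrightarrow> (\<forall>i\<in>{1..3}. q (z i) = 0 \<and> grad_on (ps_T z) q (z i) = 0)"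

definition dof_b_zero ::
  "(nat \<Rightarrow> real^2) \<Rightarrow> (nat \<Rightarrow> real^2) \<Rightarrow> nat \<Rightarrow> (real^2 \<Rightarrow> real) \<Rightarrow> bool" where
  "dof_b_zero z t r q \<longleftrightarrow> (r \<ge> 3 \<longrightarrow> (\<forall>i\<in>{1..3}. q (z (3 + i)) = 0 \<and>
      grad_on (ps_T z) q (z (3 + i)) \<bullet> t i = 0))"

definition dof_c_zero ::
  "(nat \<Rightarrow> real^2) \<Rightarrow> (nat \<Rightarrow> real^2) \<Rightarrow> nat \<Rightarrow> (real^2 \<Rightarrow> real) \<Rightarrow> bool" where
  "dof_c_zero z n r q \<longleftrightarrow> (\<forall>i\<in>{1..3}. \<forall>(a, b)\<in>half_edges z i.
     \<forall>p\<in>poly_space (int r - 3) (closed_segment a b).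
       edge_integral a b (\<lambda>x. (grad_on (ps_T z) q x \<bullet> n i) * p x) = 0)"

definition dof_d_zero :: "(nat \<Rightarrow> real^2) \<Rightarrow> nat \<Rightarrow> (real^2 \<Rightarrow> real) \<Rightarrow> bool" where
  "dof_d_zero z r q \<longleftrightarrow> (\<forall>i\<in>{1..3}. \<forall>(a, b)\<in>half_edges z i.
     \<forall>p\<in>poly_space (int r - 4) (closed_segment a b).
       edge_integral a b (\<lambda>x. q x * p x) = 0)"

definition dof_e_zero :: "(nat \<Rightarrow> real^2) \<Rightarrow> nat \<Rightarrow> (real^2 \<Rightarrow> real) \<Rightarrow> bool" where
  "dof_e_zero z r q \<longleftrightarrow> (\<forall>p\<in>ps_S0 (int r) z.
     integral (ps_T z) (\<lambda>x. rot_on (ps_T z) q x \<bullet> rot_on (ps_T z) p x) = 0)"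

end

theory Submission
  imports Defs
begin

text \<open>
  Suppose that the degrees of freedom (a)--(d) of a spline \<open>q\<close> vanish. Along an edge of the triangle
  \<open>q\<close> is zero; as it is \<open>C\<^sup>1\<close> inside, its normal derivative is then a \<open>C\<^sup>1\<close> piecewise polynomial
  \<open>g\<close> on the two halves of the edge, orthogonal to \<open>g''\<close>, so \<open>\<integral> (g')\<^sup>2 = 0\<close> and \<open>q\<close> lies in the
  subspace \<open>S0\<^sub>r\<close> of splines vanishing to first order on the boundary. There (e) with \<open>p = q\<close> gives \<open>q = 0\<close>.

  The same argument bounds the dimension of \<open>S\<^sub>r\<close> by that of \<open>S0\<^sub>r\<close> plus the number of functionals
  (a)--(d). Let \<open>h\<^sub>d\<close> be the homogeneous components of \<open>q \<in> S0\<^sub>r\<close> about \<open>z 0\<close>. On the boundary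
  \<open>\<Sum> h\<^sub>d = \<Sum> d h\<^sub>d = 0\<close>, which determines the two components of highest degree, and at a vertex the
  radial second derivative of \<open>q\<close> vanishes too. Hence \<open>q \<mapsto> \<Sum> (r - d) (r - 1 - d) h\<^sub>d\<close> maps \<open>S0\<^sub>r\<close>
  injectively into the splines in \<open>S\<^sub>r\<^sub>-\<^sub>2\<close> that vanish at the three vertices, and induction in steps of
  two bounds both dimensions from above. The bound for \<open>S\<^sub>r\<close> from below counts smoothness conditions,
  and that for \<open>S0\<^sub>r\<close> follows from it.
\<close>

text \<open>All interior edges of the split lie on rays from \<open>z 0\<close>. On such a ray the
  component of degree d grows like s^d, so C^1 matching holds degree by degree and survives any
  reweighting of the components by degree. The weights (r - d) (r - 1 - d) come from a second-order
  differential operator, so the value at a vertex involves only radial derivatives up to order two.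

  The boundary argument is tight: on one side of the triangle g consists of two polynomials of
  degree r - 1, that is 2r coefficients, against two zeros at the ends, continuity of g and of g' at
  the split point, and 2(r - 2) moments. Continuity of g' is the condition that is not visible among
  the degrees of freedom; it holds because the difference of the two adjacent pieces vanishes to
  first order along the interior edge at the split point.

  The estimates close up exactly: 3(r - 2)(r - 3) + 12r - 15 = 3r^2 - 3r + 3 = 3(r + 1)(r + 2) -
  (12r + 3). The left side is the recursive upper bound, the right side the number of coefficients
  minus the number of smoothness conditions, so the dimensions are settled by counting
  alone.\<close>

section \<open>Dimension bounds in vector spaces\<close>

text \<open>A separate locale keeps the names apart from those of \<open>real_vector\<close>.\<close>

locale scalar_space = vector_space scale
  for scale :: "'a::field \<Rightarrow> 'b::ab_group_add \<Rightarrow> 'b"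
begin

text \<open>Since \<open>dim\<close> is 0 on infinite-dimensional spaces, an inequality for
  \<open>dim\<close> alone would carry no upper bound. A finite spanning set records finite
  dimension as well.\<close>

definition dim_upto :: "'b set \<Rightarrow> nat \<Rightarrow> bool" where
  "dim_upto U n \<longleftrightarrow> (\<exists>B. finite B \<and> card B \<le> n \<and> U \<subseteq> local.span B)"

text \<open>Derivatives and integrals are total functions in the logic but are additive only on
  well-behaved arguments, hence linearity relative to \<open>U\<close>.\<close>

definition linear_fun_on :: "'b set \<Rightarrow> ('b \<Rightarrow> 'a) \<Rightarrow> bool" where
  "linear_fun_on U f \<longleftrightarrow> (\<forall>x\<in>U. \<forall>y\<in>U. f (x + y) = f x + f y) \<and> (\<forall>c. \<forall>x\<in>U. f (scale c x) = c * f x)"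

lemma dim_upto_imp_dim_le: "dim_upto U n \<Longrightarrow> local.dim U \<le> n"
  unfolding dim_upto_def by (elim exE conjE) (rule order_trans[OF local.dim_le_card])

lemma dim_upto_mono: "dim_upto U n \<Longrightarrow> V \<subseteq> U \<Longrightarrow> n \<le> m \<Longrightarrow> dim_upto V m"
  unfolding dim_upto_def by (elim exE conjE) (intro exI conjI, auto)

lemma dim_upto_card_le:
  assumes "dim_upto U n" "B \<subseteq> U" "local.independent B"
  shows "finite B \<and> card B \<le> n"
proof -
  obtain C where "finite C" "card C \<le> n" "U \<subseteq> local.span C"
    using assms(1) by (auto simp: dim_upto_def)
  moreover have "finite B \<and> card B \<le> card C"
    using independent_span_bound[of C B] assms \<open>U \<subseteq> local.span C\<close> \<open>finite C\<close> by blast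
  ultimately show ?thesis by linarith
qed

text \<open>A maximal independent subset must be finite, for otherwise it would contain a finite
  independent set with n + 1 elements.\<close>

lemma dim_uptoI:
  assumes "\<And>B. finite B \<Longrightarrow> B \<subseteq> U \<Longrightarrow> local.independent B \<Longrightarrow> card B \<le> n"
  shows "dim_upto U n"
proof -
  obtain M where M: "M \<subseteq> U" "local.independent M" "U \<subseteq> local.span M"
    using maximal_independent_subset[of U] by blast
  have "finite M"
  proof (rule ccontr)
    assume "infinite M"
    then obtain F where F: "finite F" "card F = Suc n" "F \<subseteq> M"
      using infinite_arbitrarily_large by blast
    then have "local.independent F" using M(2) independent_mono by blast
    then show False using assms[of F] F M(1) by auto
  qed
  then show ?thesis using M(3) assms[OF _ M(1,2)] unfolding dim_upto_def
    by (intro exI[of _ M]) simp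
qed

lemma dim_upto_dim:
  assumes "dim_upto U n"
  shows "dim_upto U (local.dim U)"
proof -
  obtain B where "B \<subseteq> U" "local.independent B" "U \<subseteq> local.span B" "card B = local.dim U"
    using basis_exists by blast
  then show ?thesis using dim_upto_card_le[OF assms, of B] unfolding dim_upto_def
    by (intro exI[of _ B]) simp
qed

lemma dim_upto_zero: "U \<subseteq> {0} \<Longrightarrow> dim_upto U 0"
  unfolding dim_upto_def by (intro exI[of _ "{}"]) auto

lemma linear_fun_on_subset: "linear_fun_on U f \<Longrightarrow> V \<subseteq> U \<Longrightarrow> linear_fun_on V f"
  unfolding linear_fun_on_def by blast

lemma linear_fun_on_0:
  assumes "local.subspace U" "linear_fun_on U f"
  shows "f 0 = 0"
proof -
  have "f (scale 0 0) = 0 * f 0" using assms subspace_0 unfolding linear_fun_on_def by blast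
  then show ?thesis by simp
qed

lemma subspace_kernel_on:
  assumes "local.subspace U" "linear_fun_on U f"
  shows "local.subspace {x \<in> U. f x = 0}"
  using assms linear_fun_on_0[OF assms]
  by (auto simp: subspace_def linear_fun_on_def)

text \<open>Every element of \<open>U\<close> differs from a kernel element by a multiple of one
  fixed u with f u \<noteq> 0, so one more spanning vector suffices; if there is no such u, the
  kernel is all of \<open>U\<close>.\<close>

lemma dim_upto_kernel_Suc:
  assumes U: "local.subspace U" and f: "linear_fun_on U f"
    and "dim_upto {x \<in> U. f x = 0} n"
  shows "dim_upto U (Suc n)"
proof -
  obtain B where B: "finite B" "card B \<le> n" "{x \<in> U. f x = 0} \<subseteq> local.span B"
    using assms(3) by (auto simp: dim_upto_def)
  show ?thesis
  proof (cases "\<exists>u\<in>U. f u \<noteq> 0")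
    case False
    then have "U \<subseteq> local.span B" using B by auto
    then show ?thesis using B by (auto simp: dim_upto_def intro!: exI[of _ B])
  next
    case True
    then obtain u where u: "u \<in> U" "f u \<noteq> 0" by blast
    have "x \<in> local.span (insert u B)" if x: "x \<in> U" for x
    proof -
      define c where "c = - (f x / f u)"
      let ?y = "x + scale c u"
      have "scale c u \<in> U" using u U by (simp add: subspace_scale)
      then have "?y \<in> U" "f ?y = f x + c * f u"
        using x u U f by (auto simp: subspace_add linear_fun_on_def)
      moreover have "f x + c * f u = 0" using u by (simp add: c_def)
      ultimately have "?y \<in> local.span B" using B(3) by auto
      then have "?y \<in> local.span (insert u B)" using span_mono[of B "insert u B"] by blast
      moreover have "scale c u \<in> local.span (insert u B)" by (simp add: span_base span_scale)
      ultimately have "?y - scale c u \<in> local.span (insert u B)" by (rule span_diff)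
      then show ?thesis by simp
    qed
    moreover have "card (insert u B) \<le> Suc n" using B by (simp add: card_insert_if)
    ultimately show ?thesis using B(1) unfolding dim_upto_def
      by (intro exI[of _ "insert u B"]) auto
  qed
qed

text \<open>The number of functionals bounds the codimension of the common kernel, whether or not
  they are linearly dependent.\<close>

lemma dim_upto_kernel_family:
  assumes "finite I" "local.subspace U" "\<And>i. i \<in> I \<Longrightarrow> linear_fun_on U (f i)"
    and "dim_upto {x \<in> U. \<forall>i\<in>I. f i x = 0} n"
  shows "dim_upto U (n + card I)"
  using assms
proof (induction I arbitrary: U rule: finite_induct)
  case empty
  then show ?case by simp
next
  case (insert i I)
  let ?V = "{x \<in> U. f i x = 0}"
  have V: "local.subspace ?V" using insert.prems by (intro subspace_kernel_on) auto
  have "dim_upto ?V (n + card I)"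
  proof (rule insert.IH[OF V])
    show "linear_fun_on ?V (f j)" if "j \<in> I" for j
      using insert.prems(2)[of j] that by (auto intro: linear_fun_on_subset)
    have "{x \<in> ?V. \<forall>i\<in>I. f i x = 0} = {x \<in> U. \<forall>i\<in>insert i I. f i x = 0}" by auto
    then show "dim_upto {x \<in> ?V. \<forall>i\<in>I. f i x = 0} n" using insert.prems by simp
  qed
  then have "dim_upto U (Suc (n + card I))"
    using insert.prems by (intro dim_upto_kernel_Suc[of U "f i"]) auto
  then show ?case using insert.hyps by simp
qed

text \<open>The witness u lies outside the span of any subset of the kernel, so it enlarges every
  independent subset of the kernel by one.\<close>

lemma dim_upto_proper_kernel:
  assumes U: "local.subspace U" and f: "linear_fun_on U f" and u: "u \<in> U" "f u \<noteq> 0"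
    and "dim_upto U (Suc n)"
  shows "dim_upto {x \<in> U. f x = 0} n"
proof (rule dim_uptoI)
  fix B assume B: "finite B" "B \<subseteq> {x \<in> U. f x = 0}" "local.independent B"
  have "local.span B \<subseteq> {x \<in> U. f x = 0}"
    using B(2) subspace_kernel_on[OF U f] by (rule span_minimal)
  then have nu: "u \<notin> local.span B" using u by auto
  then have "local.independent (insert u B)" using B(3) independent_insertI by blast
  then have "card (insert u B) \<le> Suc n"
    using dim_upto_card_le[OF assms(5), of "insert u B"] B u by auto
  moreover have "u \<notin> B" using nu span_base by blast
  ultimately show "card B \<le> n" using B(1) by simp
qed

text \<open>Independence is stated for an indexed family, so that indices are counted. It includes
  injectivity of \<open>e\<close>: a repeated vector would give a relation with coefficients 1 and
  -1.\<close>

lemma card_le_dim_upto: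
  assumes "dim_upto U n" "finite I" "e ` I \<subseteq> U"
    and zero: "\<And>c. (\<Sum>i\<in>I. scale (c i) (e i)) = 0 \<Longrightarrow> \<forall>i\<in>I. c i = 0"
  shows "card I \<le> n"
proof -
  have inj: "inj_on e I"
  proof (rule inj_onI, rule ccontr)
    fix i j assume ij: "i \<in> I" "j \<in> I" "e i = e j" "i \<noteq> j"
    let ?c = "\<lambda>k. if k = i then 1 else if k = j then -1 else (0::'a)"
    have "(\<Sum>k\<in>I. scale (?c k) (e k)) = (\<Sum>k\<in>{i,j}. scale (?c k) (e k))"
      using ij assms(2) by (intro sum.mono_neutral_right) auto
    also have "\<dots> = 0" using ij by simp
    finally have "\<forall>k\<in>I. ?c k = 0" using zero[of ?c] by blast
    then show False using ij(1) by auto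
  qed
  have "local.independent (e ` I)"
    unfolding dependent_finite[OF finite_imageI[OF assms(2)]]
  proof safe
    fix u v assume v: "v \<in> I" "u (e v) \<noteq> 0" and s: "(\<Sum>v\<in>e ` I. scale (u v) v) = 0"
    have "(\<Sum>i\<in>I. scale (u (e i)) (e i)) = 0" using s inj by (simp add: sum.reindex)
    then show False using zero[of "u \<circ> e"] v by auto
  qed
  then have "card (e ` I) \<le> n" using dim_upto_card_le[OF assms(1) assms(3)] by blast
  then show ?thesis using inj by (simp add: card_image)
qed

end

locale scalar_space_pair = vs1: scalar_space s1 + vs2: scalar_space s2
  for s1 :: "'a::field \<Rightarrow> 'b::ab_group_add \<Rightarrow> 'b"
  and s2 :: "'a::field \<Rightarrow> 'c::ab_group_add \<Rightarrow> 'c"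
begin

text \<open>\<open>T\<close> is required to be linear on \<open>U\<close> only, because the lowering
  map is defined by choice and is controlled just on splines.\<close>

lemma dim_upto_injective:
  assumes U: "vs1.subspace U"
    and add: "\<And>x y. x \<in> U \<Longrightarrow> y \<in> U \<Longrightarrow> T (x + y) = T x + T y"
    and scale: "\<And>c x. x \<in> U \<Longrightarrow> T (s1 c x) = s2 c (T x)"
    and inj: "\<And>x. x \<in> U \<Longrightarrow> T x = 0 \<Longrightarrow> x = 0"
    and W: "T ` U \<subseteq> W" "vs2.dim_upto W n"
  shows "vs1.dim_upto U n"
proof (rule vs1.dim_uptoI)
  fix B assume B: "finite B" "B \<subseteq> U" "vs1.independent B"
  have T0: "T 0 = 0"
    using scale[of 0 0] U vs1.subspace_0 by simp
  have T: "T (\<Sum>b\<in>A. s1 (c b) b) = (\<Sum>b\<in>A. s2 (c b) (T b))" if "A \<subseteq> B" for A c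
    using finite_subset[OF that B(1)] that
  proof (induction A rule: finite_induct)
    case empty
    then show ?case by (simp add: T0)
  next
    case (insert a A)
    have "(\<Sum>b\<in>A. s1 (c b) b) \<in> U" "s1 (c a) a \<in> U" "a \<in> U"
      using insert.prems B(2) U by (auto intro!: vs1.subspace_sum vs1.subspace_scale)
    then show ?case using insert by (simp add: add scale)
  qed
  show "card B \<le> n"
  proof (rule vs2.card_le_dim_upto[OF W(2) B(1)])
    show "T ` B \<subseteq> W" using B(2) W(1) by auto
    fix c assume "(\<Sum>b\<in>B. s2 (c b) (T b)) = 0"
    then have "T (\<Sum>b\<in>B. s1 (c b) b) = 0" using T[of B c] by simp
    moreover have "(\<Sum>b\<in>B. s1 (c b) b) \<in> U"
      using B(2) U by (auto intro!: vs1.subspace_sum vs1.subspace_scale)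
    ultimately have "(\<Sum>b\<in>B. s1 (c b) b) = 0" using inj by blast
    then show "\<forall>b\<in>B. c b = 0" using B(1,3) vs1.dependent_finite by blast
  qed
qed

end

section \<open>Polynomial functions\<close>

text \<open>Generated by linear forms rather than monomials: no coordinates enter, and inductions
  only have to treat a product with one linear factor. The zero function is homogeneous of every
  degree.\<close>

inductive hompoly :: "nat \<Rightarrow> ('a::real_inner \<Rightarrow> real) \<Rightarrow> bool" where
  hompoly_const: "hompoly 0 (\<lambda>x. c)"
| hompoly_add: "hompoly d f \<Longrightarrow> hompoly d g \<Longrightarrow> hompoly d (\<lambda>x. f x + g x)"
| hompoly_mult: "hompoly d f \<Longrightarrow> hompoly (Suc d) (\<lambda>x. (v \<bullet> x) * f x)"

inductive polyfun :: "nat \<Rightarrow> ('a::real_inner \<Rightarrow> real) \<Rightarrow> bool" where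
  polyfun_const: "polyfun r (\<lambda>x. c)"
| polyfun_add: "polyfun r f \<Longrightarrow> polyfun r g \<Longrightarrow> polyfun r (\<lambda>x. f x + g x)"
| polyfun_mult: "polyfun r f \<Longrightarrow> polyfun (Suc r) (\<lambda>x. (v \<bullet> x) * f x)"

lemma hompoly_zero: "hompoly d (\<lambda>x. 0)"
proof (induction d)
  case (Suc d)
  then show ?case using hompoly_mult[of d "\<lambda>x. 0" 0] by simp
qed (rule hompoly_const)

lemma hompoly_polyfun: "hompoly d f \<Longrightarrow> polyfun d f"
  by (induction rule: hompoly.induct) (auto intro: polyfun.intros)

lemma hompoly_scaleR: "hompoly d f \<Longrightarrow> f (s *\<^sub>R x) = s ^ d * f x"
  by (induction rule: hompoly.induct) (auto simp: algebra_simps)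

lemma polyfun_Suc: "polyfun r f \<Longrightarrow> polyfun (Suc r) f"
  by (induction rule: polyfun.induct) (auto intro: polyfun.intros)

lemma polyfun_mono: "polyfun r f \<Longrightarrow> r \<le> s \<Longrightarrow> polyfun s f"
  by (rule dec_induct[of r s]) (auto intro: polyfun_Suc)

lemma polyfun_cmult: "polyfun r f \<Longrightarrow> polyfun r (\<lambda>x. c * f x)"
proof (induction rule: polyfun.induct)
  case (polyfun_mult r f v)
  then show ?case using polyfun.polyfun_mult[OF polyfun_mult.IH, of v] by (simp add: mult.left_commute)
qed (auto simp: distrib_left intro: polyfun.intros)

lemma polyfun_diff: "polyfun r f \<Longrightarrow> polyfun r g \<Longrightarrow> polyfun r (\<lambda>x. f x - g x)"
  using polyfun_add[of r f "\<lambda>x. (-1) * g x"] polyfun_cmult[of r g "-1"] by simp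

lemma polyfun_sum: "(\<And>i. i \<in> I \<Longrightarrow> polyfun r (f i)) \<Longrightarrow> polyfun r (\<lambda>x. \<Sum>i\<in>I. f i x)"
  by (induction I rule: infinite_finite_induct) (auto intro: polyfun.intros)

lemma hompoly_cmult: "hompoly d f \<Longrightarrow> hompoly d (\<lambda>x. c * f x)"
proof (induction rule: hompoly.induct)
  case (hompoly_mult r f v)
  then show ?case using hompoly.hompoly_mult[OF hompoly_mult.IH, of v] by (simp add: mult.left_commute)
qed (auto simp: distrib_left intro: hompoly.intros)

lemma hompoly_sum: "(\<And>i. i \<in> I \<Longrightarrow> hompoly r (f i)) \<Longrightarrow> hompoly r (\<lambda>x. \<Sum>i\<in>I. f i x)"
  by (induction I rule: infinite_finite_induct) (auto intro: hompoly.intros hompoly_zero)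

lemma polyfun_affine_mult:
  assumes "polyfun r f"
  shows "polyfun (Suc r) (\<lambda>x. (c + v \<bullet> x) * f x)"
  using polyfun_add[OF polyfun_Suc[OF polyfun_cmult[OF assms, of c]] polyfun_mult[OF assms, of v]]
  by (simp add: distrib_right)

lemma polyfun_affine_power: "polyfun k (\<lambda>x. (c + v \<bullet> x) ^ k)"
  by (induction k) (auto intro: polyfun_const polyfun_affine_mult)

lemma polyfun_affine: "polyfun (Suc k) (\<lambda>x. c + v \<bullet> x)"
  using polyfun_mono[OF polyfun_affine_power[of 1 c v], of "Suc k"] by simp

lemma polyfun_translate: "polyfun r f \<Longrightarrow> polyfun r (\<lambda>x. f (x + a))"
proof (induction rule: polyfun.induct)
  case (polyfun_mult r f v)
  then show ?case using polyfun_affine_mult[OF polyfun_mult.IH, of "v \<bullet> a" v]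
    by (simp add: inner_add_right add.commute)
qed (auto intro: polyfun.intros)

lemma polyfun_hompoly_sum:
  assumes "polyfun r f"
  shows "\<exists>h. (\<forall>d. hompoly d (h d)) \<and> f = (\<lambda>x. \<Sum>d\<le>r. h d x)"
  using assms
proof (induction rule: polyfun.induct)
  case (polyfun_const r c)
  have "(\<Sum>d\<le>r. if d = 0 then c else 0) = c" by (simp add: sum.delta)
  then show ?case
    by (intro exI[of _ "\<lambda>d x. if d = 0 then c else 0"]) (auto intro: hompoly_const hompoly_zero)
next
  case (polyfun_add r f g)
  then obtain h k where "\<forall>d. hompoly d (h d)" "f = (\<lambda>x. \<Sum>d\<le>r. h d x)"
    "\<forall>d. hompoly d (k d)" "g = (\<lambda>x. \<Sum>d\<le>r. k d x)" by blast
  then show ?case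
    by (intro exI[of _ "\<lambda>d x. h d x + k d x"]) (auto simp: sum.distrib intro: hompoly_add)
next
  case (polyfun_mult r f v)
  then obtain h where h: "\<forall>d. hompoly d (h d)" "f = (\<lambda>x. \<Sum>d\<le>r. h d x)" by blast
  define k where "k d = (case d of 0 \<Rightarrow> (\<lambda>x. 0) | Suc e \<Rightarrow> (\<lambda>x. (v \<bullet> x) * h e x))" for d
  have "hompoly d (k d)" for d
    using h(1) by (cases d) (auto simp: k_def intro: hompoly_zero hompoly_mult)
  moreover have "(v \<bullet> x) * f x = (\<Sum>d\<le>Suc r. k d x)" for x
    unfolding sum.atMost_Suc_shift h(2) by (simp add: k_def sum_distrib_left)
  ultimately show ?case by (intro exI[of _ k]) auto
qed

lemma polyfun_hompoly_sum_centered: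
  assumes "polyfun r f"
  shows "\<exists>h. (\<forall>d. hompoly d (h d)) \<and> f = (\<lambda>x. \<Sum>d\<le>r. h d (x - a))"
proof -
  obtain h where h: "\<forall>d. hompoly d (h d)" "(\<lambda>x. f (x + a)) = (\<lambda>x. \<Sum>d\<le>r. h d x)"
    using polyfun_hompoly_sum[OF polyfun_translate[OF assms, of a]] by blast
  have "f x = (\<Sum>d\<le>r. h d (x - a))" for x
    using fun_cong[OF h(2), of "x - a"] by simp
  then show ?thesis using h(1) by (intro exI[of _ h]) auto
qed

lemma hompoly_sum_centered_polyfun:
  assumes "\<And>d. d \<le> r \<Longrightarrow> hompoly d (h d)"
  shows "polyfun r (\<lambda>x. \<Sum>d\<le>r. h d (x - a))"
proof (rule polyfun_sum)
  fix d assume "d \<in> {..r}"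
  then show "polyfun r (\<lambda>x. h d (x - a))"
    using polyfun_mono[OF polyfun_translate[OF hompoly_polyfun[OF assms], of d "-a"], of r] by simp
qed

text \<open>The derivative is taken in the whole space, as the polynomial pieces are defined there;
  \<open>pieces\<close> relates it to the derivative relative to the triangle.\<close>

definition dderiv :: "'a::real_inner \<Rightarrow> ('a \<Rightarrow> real) \<Rightarrow> 'a \<Rightarrow> real" where
  "dderiv v f x = frechet_derivative f (at x) v"

lemma dderiv_eq: "(f has_derivative f') (at x) \<Longrightarrow> dderiv v f x = f' v"
  unfolding dderiv_def using frechet_derivative_at by metis

lemma polyfun_differentiable: "polyfun r f \<Longrightarrow> f differentiable (at x)"
proof (induction rule: polyfun.induct)
  case (polyfun_mult r f v)
  have "(\<lambda>x. v \<bullet> x) differentiable (at x)"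
    by (rule bounded_linear_imp_differentiable) (rule bounded_linear_inner_right)
  then show ?case using polyfun_mult.IH by simp
qed auto

lemma polyfun_has_derivative:
  "polyfun r f \<Longrightarrow> (f has_derivative (\<lambda>v. dderiv v f x)) (at x)"
  using polyfun_differentiable[of r f x] unfolding dderiv_def
  by (simp add: frechet_derivative_works)

lemma polyfun_continuous_on: "polyfun r f \<Longrightarrow> continuous_on S f"
  by (meson continuous_at_imp_continuous_on differentiable_imp_continuous_within polyfun_differentiable)

lemma dderiv_const [simp]: "dderiv v (\<lambda>x. c) = (\<lambda>x. 0)"
  by (rule ext, rule dderiv_eq) (rule has_derivative_const)

lemma dderiv_add:
  "polyfun r f \<Longrightarrow> polyfun s g \<Longrightarrow> dderiv v (\<lambda>x. f x + g x) = (\<lambda>x. dderiv v f x + dderiv v g x)"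
  by (rule ext, rule dderiv_eq) (intro has_derivative_add polyfun_has_derivative)

lemma dderiv_diff:
  "polyfun r f \<Longrightarrow> polyfun s g \<Longrightarrow> dderiv v (\<lambda>x. f x - g x) = (\<lambda>x. dderiv v f x - dderiv v g x)"
  by (rule ext, rule dderiv_eq) (intro has_derivative_diff polyfun_has_derivative)

lemma dderiv_cmult:
  "polyfun r f \<Longrightarrow> dderiv v (\<lambda>x. c * f x) = (\<lambda>x. c * dderiv v f x)"
  by (rule ext, rule dderiv_eq) (intro has_derivative_mult_right polyfun_has_derivative)

lemma dderiv_sum:
  assumes "\<And>i. i \<in> I \<Longrightarrow> polyfun r (f i)"
  shows "dderiv v (\<lambda>x. \<Sum>i\<in>I. f i x) = (\<lambda>x. \<Sum>i\<in>I. dderiv v (f i) x)"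
  by (rule ext, rule dderiv_eq) (intro has_derivative_sum polyfun_has_derivative[OF assms])

lemma dderiv_mult:
  assumes "polyfun r f"
  shows "dderiv v (\<lambda>x. (u \<bullet> x) * f x) = (\<lambda>x. (u \<bullet> v) * f x + (u \<bullet> x) * dderiv v f x)"
proof
  fix x
  have "((\<lambda>x. (u \<bullet> x) * f x) has_derivative (\<lambda>v. (u \<bullet> x) * dderiv v f x + (u \<bullet> v) * f x)) (at x)"
    by (intro has_derivative_mult polyfun_has_derivative[OF assms] has_derivative_inner_right
      has_derivative_ident)
  from dderiv_eq[OF this, of v]
  show "dderiv v (\<lambda>x. (u \<bullet> x) * f x) x = (u \<bullet> v) * f x + (u \<bullet> x) * dderiv v f x"
    by simp
qed

lemma dderiv_translate:
  assumes "polyfun r f"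
  shows "dderiv v (\<lambda>x. f (x + a)) x = dderiv v f (x + a)"
proof -
  have "((\<lambda>x. x + a) has_derivative (\<lambda>v. v)) (at x)"
    by (auto intro!: derivative_eq_intros)
  from has_derivative_compose[OF this polyfun_has_derivative[OF assms]]
  show ?thesis by (rule dderiv_eq)
qed

lemma dderiv_linear:
  assumes "polyfun r f"
  shows "dderiv (a *\<^sub>R v + b *\<^sub>R w) f x = a * dderiv v f x + b * dderiv w f x"
proof -
  have "linear (\<lambda>v. dderiv v f x)"
    using polyfun_has_derivative[OF assms] has_derivative_linear by blast
  from linear_add[OF this, of "a *\<^sub>R v" "b *\<^sub>R w"] linear_scale[OF this, of a v] linear_scale[OF this, of b w]
  show ?thesis by simp
qed

lemma polyfun_0_const: "polyfun r f \<Longrightarrow> r = 0 \<Longrightarrow> \<exists>c. f = (\<lambda>x. c)"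
  by (induction rule: polyfun.induct) auto

lemma polyfun_dderiv: "polyfun r f \<Longrightarrow> polyfun (r - 1) (dderiv v f)"
proof (induction rule: polyfun.induct)
  case (polyfun_const r c)
  then show ?case by (simp add: polyfun.polyfun_const)
next
  case (polyfun_add r f g)
  then show ?case by (simp add: dderiv_add[of r f r g] polyfun.polyfun_add)
next
  case (polyfun_mult r f u)
  have "polyfun r (\<lambda>x. (u \<bullet> x) * dderiv v f x)"
  proof (cases r)
    \<comment> \<open>Truncated subtraction bounds the degree of the derivative by 0 here, which
      would give degree 1 for the product; that the derivative is zero has to be used.\<close>
    case 0
    then have "dderiv v f = (\<lambda>x. 0)" using polyfun_0_const[OF polyfun_mult.hyps] by auto
    then show ?thesis by (simp add: polyfun_const)
  next
    case (Suc s)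
    then show ?thesis using polyfun.polyfun_mult[of s "dderiv v f" u] polyfun_mult.IH by simp
  qed
  then show ?case
    using polyfun_mult.hyps by (simp add: dderiv_mult[of r] polyfun_cmult polyfun_add)
qed

text \<open>Applying the product rule twice to a product with a linear form yields an expression
  that is symmetric in v and w once the factor satisfies the claim.\<close>

lemma dderiv_commute: "polyfun r f \<Longrightarrow> dderiv v (dderiv w f) = dderiv w (dderiv v f)"
proof (induction rule: polyfun.induct)
  case (polyfun_const r c)
  then show ?case by simp
next
  case (polyfun_add r f g)
  then show ?case
    by (simp add: dderiv_add[of r f r g]
        dderiv_add[OF polyfun_dderiv[OF polyfun_add.hyps(1)] polyfun_dderiv[OF polyfun_add.hyps(2)]])
next
  case (polyfun_mult r f u)
  note f = polyfun_mult.hyps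
  have "dderiv v (dderiv w (\<lambda>x. (u \<bullet> x) * f x)) =
     (\<lambda>x. (u \<bullet> w) * dderiv v f x + ((u \<bullet> v) * dderiv w f x + (u \<bullet> x) * dderiv v (dderiv w f) x))" for v w
    unfolding dderiv_mult[OF f]
    by (subst dderiv_add[OF polyfun_cmult[OF f] polyfun.polyfun_mult[OF polyfun_dderiv[OF f]]])
      (simp add: dderiv_mult[OF polyfun_dderiv[OF f]] dderiv_cmult[OF f])
  then show ?case using polyfun_mult.IH by (simp add: algebra_simps)
qed

lemma hompoly_euler: "hompoly d f \<Longrightarrow> dderiv x f x = real d * f x"
proof (induction rule: hompoly.induct)
  case (hompoly_const c)
  then show ?case by simp
next
  case (hompoly_add d f g)
  then show ?case by (simp add: dderiv_add[OF hompoly_polyfun hompoly_polyfun] distrib_left)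
next
  case (hompoly_mult d f v)
  then show ?case
    unfolding dderiv_mult[OF hompoly_polyfun[OF hompoly_mult.hyps]] by (simp add: algebra_simps)
qed

lemma hompoly_dderiv: "hompoly d f \<Longrightarrow> hompoly (d - 1) (dderiv v f)"
proof (induction rule: hompoly.induct)
  case (hompoly_const c)
  then show ?case by (simp add: hompoly.hompoly_const)
next
  case (hompoly_add d f g)
  then show ?case by (simp add: dderiv_add[OF hompoly_polyfun hompoly_polyfun] hompoly.hompoly_add)
next
  case (hompoly_mult d f u)
  have "hompoly d (\<lambda>x. (u \<bullet> x) * dderiv v f x)"
  proof (cases d)
    case 0
    then have "dderiv v f = (\<lambda>x. 0)"
      using polyfun_0_const[OF hompoly_polyfun[OF hompoly_mult.hyps]] by auto
    then show ?thesis by (simp add: hompoly_zero)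
  next
    case (Suc s)
    then show ?thesis using hompoly.hompoly_mult[of s "dderiv v f" u] hompoly_mult.IH by simp
  qed
  then show ?case
    using hompoly_mult.hyps by (simp add: dderiv_mult[OF hompoly_polyfun] hompoly_cmult hompoly_add)
qed

lemma dderiv_hompoly_sum_centered:
  assumes "\<And>d. d \<le> r \<Longrightarrow> hompoly d (h d)"
  shows "dderiv v (\<lambda>x. \<Sum>d\<le>r. h d (x - a)) x = (\<Sum>d\<le>r. dderiv v (h d) (x - a))"
proof -
  have p: "polyfun d (h d)" if "d \<le> r" for d using hompoly_polyfun assms that by blast
  have "polyfun r (\<lambda>x. h d (x - a))" if "d \<in> {..r}" for d
    using polyfun_mono[OF polyfun_translate[OF p, of d "-a"], of r] that by simp
  then have "dderiv v (\<lambda>x. \<Sum>d\<le>r. h d (x - a)) = (\<lambda>x. \<Sum>d\<le>r. dderiv v (\<lambda>x. h d (x - a)) x)"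
    by (rule dderiv_sum)
  then show ?thesis using dderiv_translate[OF p, of _ v "-a" x] by simp
qed

section \<open>Restriction to lines and uniqueness of derivatives\<close>

lemma polyfun_line:
  assumes "polyfun r f"
  shows "\<exists>p. degree p \<le> r \<and> (\<forall>s. poly p s = f (a + s *\<^sub>R v))"
  using assms
proof (induction rule: polyfun.induct)
  case (polyfun_const r c)
  then show ?case by (intro exI[of _ "[:c:]"]) auto
next
  case (polyfun_add r f g)
  then obtain p q where "degree p \<le> r" "\<forall>s. poly p s = f (a + s *\<^sub>R v)"
    "degree q \<le> r" "\<forall>s. poly q s = g (a + s *\<^sub>R v)" by blast
  then show ?case by (intro exI[of _ "p + q"]) (auto intro: degree_add_le)
next
  case (polyfun_mult r f u)
  then obtain p where p: "degree p \<le> r" "\<forall>s. poly p s = f (a + s *\<^sub>R v)" by blast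
  let ?l = "[:u \<bullet> a, u \<bullet> v:]"
  have "degree ?l \<le> 1" by simp
  then have "degree (?l * p) \<le> Suc r" using degree_mult_le[of ?l p] p(1) by linarith
  moreover have "poly (?l * p) s = (u \<bullet> (a + s *\<^sub>R v)) * f (a + s *\<^sub>R v)" for s
    using p(2) by (simp add: inner_add_right algebra_simps)
  ultimately show ?case by blast
qed

text \<open>The chain rule along a line; it turns statements about directional derivatives on
  segments into statements about univariate polynomials.\<close>

lemma poly_pderiv_line:
  assumes "polyfun r f" "\<And>s. poly p s = f (a + s *\<^sub>R v)"
  shows "poly (pderiv p) s = dderiv v f (a + s *\<^sub>R v)"
proof -
  have "((\<lambda>s. a + s *\<^sub>R v) has_derivative (\<lambda>h. h *\<^sub>R v)) (at s)"
    by (auto intro!: derivative_eq_intros)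
  from has_derivative_compose[OF this polyfun_has_derivative[OF assms(1)]]
  have "((\<lambda>s. f (a + s *\<^sub>R v)) has_derivative (\<lambda>h. dderiv (h *\<^sub>R v) f (a + s *\<^sub>R v))) (at s)" .
  moreover have "(\<lambda>h. dderiv (h *\<^sub>R v) f x) = (*) (dderiv v f x)" for x
    using dderiv_linear[OF assms(1), of _ v 0 0 x] by (intro ext) (simp add: mult.commute)
  ultimately have "((\<lambda>s. f (a + s *\<^sub>R v)) has_field_derivative dderiv v f (a + s *\<^sub>R v)) (at s)"
    by (simp only: has_field_derivative_def)
  moreover have "(\<lambda>s. f (a + s *\<^sub>R v)) = poly p" using assms(2) by auto
  ultimately have "(poly p has_field_derivative dderiv v f (a + s *\<^sub>R v)) (at s)" by simp
  then show ?thesis using DERIV_unique[OF poly_DERIV[of p s]] by blast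
qed

lemma poly_eq_0_on_unit_interval:
  fixes p :: "real poly"
  assumes "\<And>s. 0 \<le> s \<Longrightarrow> s \<le> 1 \<Longrightarrow> poly p s = 0"
  shows "p = 0"
proof (rule ccontr)
  assume "p \<noteq> 0"
  then have "finite {s. poly p s = 0}" by (rule poly_roots_finite)
  moreover have "{0..1} \<subseteq> {s. poly p s = 0}" using assms by auto
  ultimately have "finite {0..1::real}" by (rule finite_subset[rotated])
  then show False by (simp add: infinite_Icc)
qed

lemma polyfun_eq_0_if_interior:
  fixes f :: "'a::real_inner \<Rightarrow> real"
  assumes f: "polyfun r f" and "interior S \<noteq> {}" and z: "\<And>x. x \<in> S \<Longrightarrow> f x = 0"
  shows "f = (\<lambda>x. 0)"
proof
  fix y
  obtain x e where xe: "e > 0" "cball x e \<subseteq> S" using assms(2) mem_interior_cball by blast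
  \<comment> \<open>The scaling keeps the first unit of the parameter inside the ball; y itself is
    reached at parameter 1 / d. The summand 1 covers y = x.\<close>
  define d where "d = e / (1 + norm (y - x))"
  have n: "1 + norm (y - x) > 0" by (smt (verit) norm_ge_zero)
  have d: "d > 0" "d * norm (y - x) \<le> e"
    using xe(1) n by (auto simp: d_def field_simps)
  obtain p where p: "\<And>s. poly p s = f (x + s *\<^sub>R (d *\<^sub>R (y - x)))" using polyfun_line[OF f] by metis
  have "p = 0"
  proof (rule poly_eq_0_on_unit_interval)
    fix s :: real assume s: "0 \<le> s" "s \<le> 1"
    have "s * (d * norm (y - x)) \<le> 1 * (d * norm (y - x))"
      using s d(1) by (intro mult_right_mono) auto
    moreover have "norm (s *\<^sub>R (d *\<^sub>R (y - x))) = s * (d * norm (y - x))"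
      using s d by simp
    ultimately have "norm (s *\<^sub>R (d *\<^sub>R (y - x))) \<le> e"
      using d by linarith
    then have "x + s *\<^sub>R (d *\<^sub>R (y - x)) \<in> cball x e"
      by (simp only: mem_cball dist_norm) (simp add: norm_minus_commute)
    then show "poly p s = 0" using p z xe(2) by auto
  qed
  then show "f y = 0" using p[of "1 / d"] d by simp
qed

text \<open>In a convex set the derivative is determined along every segment from x, which fixes it
  on all vectors y - x with y in \<open>S\<close>. As \<open>S\<close> has interior points,
  differences of such vectors point in every direction.\<close>

lemma has_derivative_unique_within_convex:
  fixes f :: "'a::real_normed_vector \<Rightarrow> 'b::real_normed_vector"
  assumes S: "convex S" "interior S \<noteq> {}" "x \<in> S"
    and D: "(f has_derivative D) (at x within S)"
    and D': "(f has_derivative D') (at x within S)"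
  shows "D = D'"
proof -
  have on_S: "D (y - x) = D' (y - x)" if y: "y \<in> S" for y
  proof -
    have "(\<lambda>s. x + s *\<^sub>R (y - x)) ` {0..1} \<subseteq> S"
      using convexD_alt[OF S(1) S(3) y] by (auto simp: algebra_simps)
    moreover have "((\<lambda>s::real. x + s *\<^sub>R (y - x)) has_derivative (\<lambda>h. h *\<^sub>R (y - x))) (at 0 within {0..1})"
      by (auto intro!: derivative_eq_intros)
    ultimately have c: "((\<lambda>s::real. f (x + s *\<^sub>R (y - x))) has_vector_derivative F (y - x)) (at 0 within {0..1})"
      if "(f has_derivative F) (at x within S)" for F
    proof -
      assume im: "(\<lambda>s. x + s *\<^sub>R (y - x)) ` {0..1} \<subseteq> S"
        and l: "((\<lambda>s::real. x + s *\<^sub>R (y - x)) has_derivative (\<lambda>h. h *\<^sub>R (y - x))) (at 0 within {0..1})"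
      have "(f has_derivative F) (at (x + 0 *\<^sub>R (y - x)) within (\<lambda>s. x + s *\<^sub>R (y - x)) ` {0..1})"
        using has_derivative_subset[OF that im] by simp
      from has_derivative_in_compose[OF l this]
      have "((\<lambda>s. f (x + s *\<^sub>R (y - x))) has_derivative (\<lambda>h. F (h *\<^sub>R (y - x)))) (at 0 within {0..1})" .
      moreover have "F (h *\<^sub>R (y - x)) = h *\<^sub>R F (y - x)" for h
        using linear_scale[OF has_derivative_linear[OF that]] .
      ultimately show ?thesis by (simp add: has_vector_derivative_def)
    qed
    show ?thesis
      using vector_derivative_unique_within_closed_interval[of 0 1 0, OF _ _ c[OF D, folded box_real(2)] c[OF D', folded box_real(2)]] by simp
  qed
  obtain c e where e: "e > 0" "ball c e \<subseteq> S" using S(2) mem_interior by blast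
  show ?thesis
  proof
    fix v :: 'a
    \<comment> \<open>Chosen so that c and c + d v both lie in the ball: then d v is the difference
      of (c + d v) - x and c - x, where the two derivatives are known to agree.\<close>
    define d where "d = (e / 2) / (1 + norm v)"
    have n: "1 + norm v > 0" by (smt (verit) norm_ge_zero)
    have d0: "d > 0" unfolding d_def by (rule divide_pos_pos) (use n e(1) in simp_all)
    have "d * (1 + norm v) = e / 2"
      using nonzero_eq_divide_eq[OF less_imp_neq[OF n, symmetric], THEN iffD1, OF d_def] .
    then have "d * norm v < e" using d0 e(1) by (simp add: distrib_left)
    then have "norm (d *\<^sub>R v) < e" using d0 by simp
    note d = d0 this
    have "c \<in> S" "c + d *\<^sub>R v \<in> S" using e d by (auto simp: dist_norm)
    then have "D (c - x) = D' (c - x)" "D (c + d *\<^sub>R v - x) = D' (c + d *\<^sub>R v - x)"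
      using on_S by auto
    moreover have "c + d *\<^sub>R v - x = (c - x) + d *\<^sub>R v" by simp
    moreover note lin = has_derivative_linear[OF D] has_derivative_linear[OF D']
    ultimately have "d *\<^sub>R D v = d *\<^sub>R D' v"
      using linear_add[OF lin(1)] linear_add[OF lin(2)] linear_scale[OF lin(1)] linear_scale[OF lin(2)]
      by (metis add_left_cancel)
    then show "D v = D' v" using d(1) by simp
  qed
qed

section \<open>Coefficient form of polynomials in the plane\<close>

abbreviation monomial_sum :: "nat \<Rightarrow> (nat \<Rightarrow> nat \<Rightarrow> real) \<Rightarrow> real^2 \<Rightarrow> real" where
  "monomial_sum n c x \<equiv> \<Sum>(i, j)\<in>{(i, j). int i + int j \<le> int n}. c i j * (x $ 1) ^ i * (x $ 2) ^ j"

text \<open>The form of \<open>poly_space\<close>, for functions on the whole plane. Its equivalence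
  with \<open>polyfun\<close> gives access to the inductive description.\<close>

definition dpoly :: "nat \<Rightarrow> (real^2 \<Rightarrow> real) \<Rightarrow> bool" where
  "dpoly n f \<longleftrightarrow> (\<exists>c. \<forall>x. f x = monomial_sum n c x)"

lemma finite_degree_pairs: "finite {(i, j). int i + int j \<le> k}"
  by (rule finite_subset[of _ "{..nat k} \<times> {..nat k}"]) auto

lemma dpoly_add: "dpoly n f \<Longrightarrow> dpoly n g \<Longrightarrow> dpoly n (\<lambda>x. f x + g x)"
  unfolding dpoly_def
  apply (elim exE)
  subgoal for c d
    by (intro exI[of _ "\<lambda>i j. c i j + d i j"])
      (simp add: sum.distrib[symmetric] case_prod_unfold distrib_right)
  done

lemma dpoly_cmult: "dpoly n f \<Longrightarrow> dpoly n (\<lambda>x. a * f x)"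
  unfolding dpoly_def
  apply (elim exE)
  subgoal for c
    by (intro exI[of _ "\<lambda>i j. a * c i j"]) (simp add: sum_distrib_left case_prod_unfold mult.assoc)
  done

lemma dpoly_monomial:
  assumes "a + b \<le> n"
  shows "dpoly n (\<lambda>x. (x $ 1) ^ a * (x $ 2) ^ b)"
proof -
  have "(x $ 1) ^ a * (x $ 2) ^ b = (\<Sum>(i, j)\<in>{(i, j). int i + int j \<le> int n}.
      (if (i, j) = (a, b) then 1 else 0) * (x $ 1) ^ i * (x $ 2) ^ j)" for x :: "real^2"
  proof -
    have "(\<Sum>(i, j)\<in>{(i, j). int i + int j \<le> int n}.
        (if (i, j) = (a, b) then 1 else 0) * (x $ 1) ^ i * (x $ 2) ^ j) =
      (\<Sum>p\<in>{(i, j). int i + int j \<le> int n}. if p = (a, b) then (x $ 1) ^ a * (x $ 2) ^ b else 0)"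
      by (rule sum.cong) (auto split: if_splits)
    also have "\<dots> = (x $ 1) ^ a * (x $ 2) ^ b"
      using assms by (subst sum.delta[OF finite_degree_pairs]) auto
    finally show ?thesis by simp
  qed
  then show ?thesis unfolding dpoly_def
    by (intro exI[of _ "\<lambda>i j. if (i, j) = (a, b) then 1 else 0"]) blast
qed

lemma dpoly_sum: "(\<And>i. i \<in> I \<Longrightarrow> dpoly n (f i)) \<Longrightarrow> dpoly n (\<lambda>x. \<Sum>i\<in>I. f i x)"
proof (induction I rule: infinite_finite_induct)
  case (insert i I)
  then show ?case using dpoly_add[of n "f i"] by simp
qed (use dpoly_cmult[OF dpoly_monomial[of 0 0 n], of 0] in auto)

lemma polyfun_imp_dpoly: "polyfun n f \<Longrightarrow> dpoly n f"
proof (induction rule: polyfun.induct)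
  case (polyfun_const r c)
  then show ?case using dpoly_cmult[OF dpoly_monomial[of 0 0 r], of c] by simp
next
  case (polyfun_add r f g)
  then show ?case by (intro dpoly_add)
next
  case (polyfun_mult r f v)
  then obtain c where c: "\<And>x. f x = monomial_sum r c x"
    unfolding dpoly_def by blast
  \<comment> \<open>Multiplication by v \<bullet> x turns each monomial into two, with one of the
    exponents raised by 1.\<close>
  have "dpoly (Suc r) (\<lambda>x. \<Sum>p\<in>{(i, j). int i + int j \<le> int r}.
      (c (fst p) (snd p) * v $ 1) * ((x $ 1) ^ Suc (fst p) * (x $ 2) ^ snd p)
    + (c (fst p) (snd p) * v $ 2) * ((x $ 1) ^ fst p * (x $ 2) ^ Suc (snd p)))"
    by (intro dpoly_sum dpoly_add dpoly_cmult dpoly_monomial) auto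
  also have "(\<lambda>x. \<Sum>p\<in>{(i, j). int i + int j \<le> int r}.
      (c (fst p) (snd p) * v $ 1) * ((x $ 1) ^ Suc (fst p) * (x $ 2) ^ snd p)
    + (c (fst p) (snd p) * v $ 2) * ((x $ 1) ^ fst p * (x $ 2) ^ Suc (snd p))) = (\<lambda>x. (v \<bullet> x) * f x)"
    unfolding c sum_distrib_left
    by (intro ext sum.cong) (auto simp: inner_vec_def sum_2 algebra_simps)
  finally show ?case .
qed

lemma polyfun_monomial:
  fixes i j :: nat
  shows "polyfun (i + j) (\<lambda>x::real^2. (x $ 1) ^ i * (x $ 2) ^ j)"
proof (induction i)
  case 0
  show ?case using polyfun_affine_power[of j 0 "axis 2 1 :: real^2"] by (simp add: inner_axis' )
next
  case (Suc i)
  then show ?case using polyfun_mult[OF Suc, of "axis 1 1"] by (simp add: inner_axis' mult.assoc)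
qed

lemma hompoly_monomial:
  fixes i j :: nat
  shows "hompoly (i + j) (\<lambda>x::real^2. (x $ 1) ^ i * (x $ 2) ^ j)"
proof (induction i)
  case 0
  show ?case
  proof (induction j)
    case (Suc j)
    then show ?case using hompoly_mult[OF Suc, of "axis 2 1"] by (simp add: inner_axis' mult.assoc)
  qed (simp add: hompoly_const)
next
  case (Suc i)
  then show ?case using hompoly_mult[OF Suc, of "axis 1 1"] by (simp add: inner_axis' mult.assoc)
qed

lemma dpoly_imp_polyfun:
  assumes "dpoly n f"
  shows "polyfun n f"
proof -
  obtain c where c: "\<And>x. f x = monomial_sum n c x"
    using assms unfolding dpoly_def by blast
  have "polyfun n (\<lambda>x::real^2. \<Sum>p\<in>{(i, j). int i + int j \<le> int n}.
      c (fst p) (snd p) * ((x $ 1) ^ fst p * (x $ 2) ^ snd p))"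
    by (intro polyfun_sum polyfun_cmult, rule polyfun_mono[OF polyfun_monomial]) auto
  moreover have "(\<lambda>x::real^2. \<Sum>p\<in>{(i, j). int i + int j \<le> int n}.
      c (fst p) (snd p) * ((x $ 1) ^ fst p * (x $ 2) ^ snd p)) = f"
    unfolding c by (intro ext sum.cong) (auto simp: algebra_simps)
  ultimately show ?thesis by simp
qed

lemma dpoly_iff_polyfun: "dpoly n f \<longleftrightarrow> polyfun n f"
  using polyfun_imp_dpoly dpoly_imp_polyfun by blast

lemma mem_poly_space:
  "p \<in> poly_space (int n) S \<longleftrightarrow>
     (\<forall>x. x \<notin> S \<longrightarrow> p x = 0) \<and> (\<exists>f. polyfun n f \<and> (\<forall>x\<in>S. p x = f x))"
proof -
  have "(\<exists>c. \<forall>x\<in>S. p x = monomial_sum n c x)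
    \<longleftrightarrow> (\<exists>f. dpoly n f \<and> (\<forall>x\<in>S. p x = f x))" (is "(\<exists>c. ?L c) \<longleftrightarrow> ?R")
  proof
    assume "\<exists>c. ?L c"
    then obtain c where "?L c" by blast
    then show ?R unfolding dpoly_def
      by (intro exI[of _ "monomial_sum n c"]) auto
  next
    assume ?R
    then show "\<exists>c. ?L c" unfolding dpoly_def by force
  qed
  then show ?thesis
    unfolding poly_space_def mem_Collect_eq
    by (simp only: dpoly_iff_polyfun)
qed

lemma poly_space_neg: "k < 0 \<Longrightarrow> poly_space k S = {\<lambda>x. 0}"
proof -
  assume "k < 0"
  then have "{(i, j). int i + int j \<le> k} = {}" by auto
  then show ?thesis unfolding poly_space_def by (auto simp: fun_eq_iff) blast
qed

text \<open>\<open>grad_on\<close> evaluates a derivative obtained by choice on the two axes;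
  uniqueness within a convex set with interior points identifies that choice with
  \<open>D\<close>.\<close>

lemma inner_grad_on:
  assumes "convex T" "interior T \<noteq> {}" "x \<in> T" "(q has_derivative D) (at x within T)"
  shows "grad_on T q x \<bullet> v = D v"
proof -
  have "q differentiable (at x within T)" using assms(4) differentiable_def by blast
  then have "(q has_derivative frechet_derivative q (at x within T)) (at x within T)"
    by (simp add: frechet_derivative_works)
  then have F: "frechet_derivative q (at x within T) = D"
    using has_derivative_unique_within_convex[OF assms(1-3)] assms(4) by blast
  have lin: "linear D" using has_derivative_linear[OF assms(4)] .
  have "v = v $ 1 *\<^sub>R axis 1 1 + v $ 2 *\<^sub>R axis 2 1"
    by (simp add: vec_eq_iff forall_2 axis_def)
  then have "D v = v $ 1 * D (axis 1 1) + v $ 2 * D (axis 2 1)"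
    by (metis linear_add[OF lin] linear_scale[OF lin] real_scaleR_def)
  then show ?thesis by (simp add: grad_on_def F inner_vec_def sum_2)
qed

lemma rot_on_eq_0_iff: "rot_on T q x = 0 \<longleftrightarrow> grad_on T q x = 0"
  by (auto simp: rot_on_def vec_eq_iff forall_2 vector_2)

text \<open>\<open>rot\<close> is the gradient turned by a right angle, which preserves inner
  products.\<close>

lemma rot_on_inner: "rot_on T q x \<bullet> rot_on T p x = grad_on T q x \<bullet> grad_on T p x"
  by (simp add: rot_on_def inner_vec_def sum_2 vector_2)

section \<open>Geometry of the Powell-Sabin split\<close>

lemma vec2_eq_iff: "(x::real^2) = y \<longleftrightarrow> x $ 1 = y $ 1 \<and> x $ 2 = y $ 2"
  by (simp add: vec_eq_iff forall_2)

lemma cross2_not_collinear: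
  assumes "cross2 (b - a) (c - a) \<noteq> 0"
  shows "\<not> collinear {a, b, c}"
proof
  assume "collinear {a, b, c}"
  then obtain u where "\<forall>x\<in>{a, b, c}. \<forall>y\<in>{a, b, c}. \<exists>k. x - y = k *\<^sub>R u"
    unfolding collinear_def by blast
  then obtain k l where "b - a = k *\<^sub>R u" "c - a = l *\<^sub>R u" by blast
  then have "cross2 (b - a) (c - a) = 0" by (simp add: cross2_def)
  with assms show False by simp
qed

lemma cross2_linear [simp]:
  "cross2 (a *\<^sub>R u) v = a * cross2 u v" "cross2 u (a *\<^sub>R v) = a * cross2 u v"
  "cross2 (u + w) v = cross2 u v + cross2 w v" "cross2 u (v + w) = cross2 u v + cross2 u w"
  "cross2 (u - w) v = cross2 u v - cross2 w v" "cross2 u (v - w) = cross2 u v - cross2 u w"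
  "cross2 (- u) v = - cross2 u v" "cross2 u (- v) = - cross2 u v" "cross2 u u = 0"
  by (simp_all add: cross2_def algebra_simps)

lemma cross2_swap: "cross2 u v = - cross2 v u"
  by (simp add: cross2_def)

text \<open>Cramer's rule in the plane.\<close>

lemma cross2_basis:
  assumes "cross2 u v \<noteq> 0"
  shows "\<exists>a b. w = a *\<^sub>R u + b *\<^sub>R v"
proof (intro exI)
  have "cross2 u v *\<^sub>R w = cross2 w v *\<^sub>R u + cross2 u w *\<^sub>R v"
    unfolding vec2_eq_iff by (simp add: cross2_def algebra_simps)
  then have "(1 / cross2 u v) *\<^sub>R (cross2 u v *\<^sub>R w) = (1 / cross2 u v) *\<^sub>R (cross2 w v *\<^sub>R u + cross2 u w *\<^sub>R v)"
    by simp
  then show "w = (cross2 w v / cross2 u v) *\<^sub>R u + (cross2 u w / cross2 u v) *\<^sub>R v"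
    using assms by (simp add: scaleR_right_distrib)
qed

text \<open>Eliminating a leaves a relation between the two edge vectors at A; its cross products
  with these edges isolate b and c.\<close>

lemma affine_independent_coeffs:
  assumes "cross2 (B - A) (C - A) \<noteq> 0" "a *\<^sub>R A + b *\<^sub>R B + c *\<^sub>R C = 0" "a + b + c = 0"
  shows "a = 0 \<and> b = 0 \<and> c = 0"
proof -
  have a: "a = - b - c" using assms(3) by simp
  have e: "b *\<^sub>R (B - A) + c *\<^sub>R (C - A) = 0"
    using assms(2) unfolding a by (simp add: algebra_simps)
  have "cross2 (b *\<^sub>R (B - A) + c *\<^sub>R (C - A)) (C - A) = b * cross2 (B - A) (C - A)"
    "cross2 (B - A) (b *\<^sub>R (B - A) + c *\<^sub>R (C - A)) = c * cross2 (B - A) (C - A)"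
    by (simp_all add: cross2_def algebra_simps)
  then have "b * cross2 (B - A) (C - A) = 0" "c * cross2 (B - A) (C - A) = 0"
    unfolding e by (simp_all add: cross2_def)
  then show ?thesis using assms(1) a by auto
qed

text \<open>The affine function is the barycentric coordinate belonging to A: v is the edge vector
  from B to C turned by a right angle and divided by twice the signed area.\<close>

lemma affine_dual:
  assumes "cross2 (B - A) (C - A) \<noteq> 0"
  shows "\<exists>c v. c + v \<bullet> A = 1 \<and> c + v \<bullet> B = 0 \<and> c + v \<bullet> C = (0::real)"
proof -
  define D where "D = cross2 (B - A) (C - A)"
  define v :: "real^2" where "v = (1 / D) *\<^sub>R vector [B $ 2 - C $ 2, C $ 1 - B $ 1]"
  have D: "D \<noteq> 0" using assms by (simp add: D_def)
  have v: "v \<bullet> x = ((B $ 2 - C $ 2) * x $ 1 + (C $ 1 - B $ 1) * x $ 2) / D" for x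
    by (simp add: v_def inner_vec_def sum_2 vector_2 add_divide_distrib)
  have "v \<bullet> C = v \<bullet> B" unfolding v by (simp add: algebra_simps)
  moreover have "v \<bullet> A - v \<bullet> B = 1"
    using D unfolding v diff_divide_distrib[symmetric] by (simp add: D_def cross2_def algebra_simps)
  ultimately show ?thesis by (intro exI[of _ "- (v \<bullet> B)"] exI[of _ v]) simp
qed

lemma mem_triangle:
  "x \<in> convex hull {a, b, c} \<longleftrightarrow>
     (\<exists>u v w. 0 \<le> u \<and> 0 \<le> v \<and> 0 \<le> w \<and> u + v + w = 1 \<and> x = u *\<^sub>R a + v *\<^sub>R b + w *\<^sub>R c)"
  unfolding convex_hull_3 by blast

lemma triangle_eq_segmentI:
  assumes "0 \<le> u" "0 \<le> v" "u + v = 1" "x = u *\<^sub>R a + v *\<^sub>R b"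
  shows "x \<in> closed_segment a b"
  using assms unfolding in_segment by (intro exI[of _ v]) (auto simp: algebra_simps simp flip: scaleR_left_distrib)

text \<open>Two representations of x are compared in barycentric coordinates of A, B, C. The
  coordinate of A gives u \<le> u', that of C gives u \<ge> u', and equality removes A from the
  first representation.\<close>

lemma triangles_at_corner_inter:
  assumes cr: "cross2 (B - A) (C - A) \<noteq> 0"
    and p: "p = \<alpha> *\<^sub>R A + \<beta> *\<^sub>R B + \<gamma> *\<^sub>R C" "0 < \<alpha>" "0 < \<beta>" "0 < \<gamma>" "\<alpha> + \<beta> + \<gamma> = 1"
    and x: "x \<in> convex hull {p, A, B}" "x \<in> convex hull {p, B, C}"
  shows "x \<in> closed_segment p B"
proof -
  obtain u v w where 1: "0 \<le> u" "0 \<le> v" "0 \<le> w" "u + v + w = 1" "x = u *\<^sub>R p + v *\<^sub>R A + w *\<^sub>R B"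
    using x(1) unfolding mem_triangle by blast
  obtain u' v' w' where 2: "0 \<le> u'" "0 \<le> v'" "0 \<le> w'" "u' + v' + w' = 1" "x = u' *\<^sub>R p + v' *\<^sub>R B + w' *\<^sub>R C"
    using x(2) unfolding mem_triangle by blast
  have "((u - u') * \<alpha> + v) *\<^sub>R A + ((u - u') * \<beta> + w - v') *\<^sub>R B + ((u - u') * \<gamma> - w') *\<^sub>R C = 0"
    using 1(5) 2(5) unfolding p(1) by (simp add: algebra_simps)
  moreover have "((u - u') * \<alpha> + v) + ((u - u') * \<beta> + w - v') + ((u - u') * \<gamma> - w') =
      (u - u') * (\<alpha> + \<beta> + \<gamma>) + v + w - v' - w'"
    by (simp add: algebra_simps)
  then have "((u - u') * \<alpha> + v) + ((u - u') * \<beta> + w - v') + ((u - u') * \<gamma> - w') = 0"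
    using 1(4) 2(4) p(5) by simp
  ultimately have c: "(u - u') * \<alpha> + v = 0" "(u - u') * \<gamma> = w'"
    using affine_independent_coeffs[OF cr] by force+
  have "u - u' \<le> 0" using c(1) 1(2) p(2) by (smt (verit) mult_pos_pos)
  moreover have "u - u' \<ge> 0" using c(2) 2(3) p(4) by (smt (verit) mult_neg_pos)
  ultimately have "v = 0" using c(1) by simp
  then show ?thesis using 1 by (intro triangle_eq_segmentI[of u w]) auto
qed

text \<open>As before, now in barycentric coordinates of p, A, B: the coordinates of A and B force
  opposite signs on w - v'.\<close>

lemma triangles_on_edge_inter:
  assumes cr: "cross2 (A - p) (B - p) \<noteq> 0" and "M \<in> open_segment A B"
    and x: "x \<in> convex hull {p, A, M}" "x \<in> convex hull {p, M, B}"
  shows "x \<in> closed_segment p M"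
proof -
  obtain m where M: "M = (1 - m) *\<^sub>R A + m *\<^sub>R B" "0 < m" "m < 1"
    using assms(2) unfolding in_segment by blast
  obtain u v w where 1: "0 \<le> u" "0 \<le> v" "0 \<le> w" "u + v + w = 1" "x = u *\<^sub>R p + v *\<^sub>R A + w *\<^sub>R M"
    using x(1) unfolding mem_triangle by blast
  obtain u' v' w' where 2: "0 \<le> u'" "0 \<le> v'" "0 \<le> w'" "u' + v' + w' = 1" "x = u' *\<^sub>R p + v' *\<^sub>R M + w' *\<^sub>R B"
    using x(2) unfolding mem_triangle by blast
  have "(u - u') *\<^sub>R p + (v + (w - v') * (1 - m)) *\<^sub>R A + ((w - v') * m - w') *\<^sub>R B = 0"
    using 1(5) 2(5) unfolding M(1) by (simp add: algebra_simps)
  moreover have "(u - u') + (v + (w - v') * (1 - m)) + ((w - v') * m - w') = 0"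
    using 1(4) 2(4) by (simp add: algebra_simps)
  ultimately have c: "v + (w - v') * (1 - m) = 0" "(w - v') * m = w'"
    using affine_independent_coeffs[OF cr] by force+
  have "w - v' \<le> 0" using c(1) 1(2) M(3) by (smt (verit) mult_pos_pos)
  moreover have "w - v' \<ge> 0" using c(2) 2(3) M(2) by (smt (verit) mult_neg_pos)
  ultimately have "v = 0" using c(1) by simp
  then show ?thesis using 1 by (intro triangle_eq_segmentI[of u w]) auto
qed

text \<open>The coordinate of A vanishes on the ray towards B, while in the triangle it is a sum of
  two nonnegative terms, one of which is a positive multiple of the weight of M.\<close>

lemma triangle_inter_far_ray:
  assumes cr: "cross2 (A - p) (B - p) \<noteq> 0" and "M \<in> open_segment A B"
    and x: "x \<in> convex hull {p, A, M}" "x \<in> closed_segment p B"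
  shows "x = p"
proof -
  obtain m where M: "M = (1 - m) *\<^sub>R A + m *\<^sub>R B" "m < 1"
    using assms(2) unfolding in_segment by blast
  obtain u v w where 1: "0 \<le> u" "0 \<le> v" "0 \<le> w" "u + v + w = 1" "x = u *\<^sub>R p + v *\<^sub>R A + w *\<^sub>R M"
    using x(1) unfolding mem_triangle by blast
  obtain s where 2: "0 \<le> s" "x = (1 - s) *\<^sub>R p + s *\<^sub>R B"
    using x(2) unfolding in_segment by blast
  have "(u - (1 - s)) *\<^sub>R p + (v + w * (1 - m)) *\<^sub>R A + (w * m - s) *\<^sub>R B = 0"
    using 1(5) 2(2) unfolding M(1) by (simp add: algebra_simps)
  moreover have "(u - (1 - s)) + (v + w * (1 - m)) + (w * m - s) = 0"
    using 1(4) by (simp add: algebra_simps)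
  ultimately have c: "v + w * (1 - m) = 0" "w * m = s"
    using affine_independent_coeffs[OF cr] by force+
  have "w * (1 - m) \<ge> 0" using 1(3) M(2) by simp
  then have "w * (1 - m) = 0" using c(1) 1(2) by linarith
  then have "w = 0" using M(2) by simp
  then show ?thesis using c(2) 2(2) by simp
qed

section \<open>The six triangles and their intersections\<close>

locale powell_sabin =
  fixes z :: "nat \<Rightarrow> real^2"
  assumes points: "ps_points z"
begin

text \<open>The boundary points in counter-clockwise order, vertices at even and split points at odd
  positions. The first point is repeated at position 6, so that \<open>Suc j\<close> needs no
  reduction for j = 5.\<close>

definition node :: "nat \<Rightarrow> real^2" where
  "node j = z ([1, 6, 2, 4, 3, 5, 1] ! j)"

definition tri :: "nat \<Rightarrow> (real^2) set" where
  "tri j = convex hull {z 0, node j, node (Suc j)}"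

abbreviation edge :: "nat \<Rightarrow> (real^2) set" where
  "edge j \<equiv> closed_segment (node j) (node (Suc j))"

lemma node_simps [simp]:
  "node 0 = z 1" "node (Suc 0) = z 6" "node 2 = z 2" "node 3 = z 4" "node 4 = z 3" "node 5 = z 5" "node 6 = z 1"
  by (simp_all add: node_def)

lemma less_6_cases:
  "(j::nat) < 6 \<Longrightarrow> (j = 0 \<Longrightarrow> P) \<Longrightarrow> (j = 1 \<Longrightarrow> P) \<Longrightarrow> (j = 2 \<Longrightarrow> P) \<Longrightarrow> (j = 3 \<Longrightarrow> P) \<Longrightarrow> (j = 4 \<Longrightarrow> P) \<Longrightarrow> (j = 5 \<Longrightarrow> P) \<Longrightarrow> P"
  by linarith

lemma atLeastAtMost_1_3: "{1..3::nat} = {1, 2, 3}"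
  by auto

lemma half_edges_simps:
  "half_edges z 1 = {(node 2, node 3), (node 3, node 4)}"
  "half_edges z 2 = {(node 4, node 5), (node 5, node 6)}"
  "half_edges z 3 = {(node 0, node 1), (node 1, node 2)}"
  by (simp_all add: half_edges_def nxt3_def node_def eval_nat_numeral)

lemma tri_simps:
  "tri 0 = convex hull {z 0, z 1, z 6}" "tri 1 = convex hull {z 0, z 6, z 2}"
  "tri 2 = convex hull {z 0, z 2, z 4}" "tri 3 = convex hull {z 0, z 4, z 3}"
  "tri 4 = convex hull {z 0, z 3, z 5}" "tri 5 = convex hull {z 0, z 5, z 1}"
  by (simp_all add: tri_def node_def)

lemma ps_triangles_eq: "ps_triangles z = tri ` {..<6}"
proof -
  have "{..<6::nat} = {0, 1, 2, 3, 4, 5}" by auto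
  then have "tri ` {..<6} = {tri 0, tri 1, tri 2, tri 3, tri 4, tri 5}" by (simp only: image_insert image_empty)
  moreover have "(\<lambda>(a, b). convex hull {z 0, a, b}) ` half_edges z 1 = {tri 2, tri 3}"
    "(\<lambda>(a, b). convex hull {z 0, a, b}) ` half_edges z 2 = {tri 4, tri 5}"
    "(\<lambda>(a, b). convex hull {z 0, a, b}) ` half_edges z 3 = {tri 0, tri 1}"
    unfolding half_edges_simps tri_simps by simp_all
  moreover have "{a, b} \<union> ({c, d} \<union> {e, f}) = {e, f, a, b, c, d}" for a b c d e f :: "(real^2) set"
    by auto
  ultimately show ?thesis
    unfolding ps_triangles_def atLeastAtMost_1_3 by (simp only: UN_insert UN_empty Un_empty_right)
qed

lemma cross_T: "cross2 (z 2 - z 1) (z 3 - z 1) > 0"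
  and z0_interior: "z 0 \<in> interior (ps_T z)"
  using points unfolding ps_points_def by auto

lemma cross_T_rotated: "cross2 (z 3 - z 2) (z 1 - z 2) > 0" "cross2 (z 1 - z 3) (z 2 - z 3) > 0"
  using cross_T by (simp_all add: cross2_def algebra_simps)

lemma z0_barycentric:
  obtains \<alpha> \<beta> \<gamma> where "0 < \<alpha>" "0 < \<beta>" "0 < \<gamma>" "\<alpha> + \<beta> + \<gamma> = 1"
    "z 0 = \<alpha> *\<^sub>R z 1 + \<beta> *\<^sub>R z 2 + \<gamma> *\<^sub>R z 3"
proof -
  have "\<not> collinear {z 1, z 2, z 3}" using cross2_not_collinear cross_T by auto
  from interior_convex_hull_3_minimal[OF this] z0_interior that
  show ?thesis unfolding ps_T_def by auto
qed

lemma midpoints: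
  "z 4 \<in> open_segment (z 2) (z 3)" "z 5 \<in> open_segment (z 3) (z 1)" "z 6 \<in> open_segment (z 1) (z 2)"
  using points unfolding ps_points_def atLeastAtMost_1_3 by (auto simp: nxt3_def eval_nat_numeral)

lemmas midpoints_closed = midpoints[THEN open_closed_segment]

lemma macro_cross:
  "cross2 (z 1 - z 0) (z 2 - z 0) > 0" "cross2 (z 2 - z 0) (z 3 - z 0) > 0" "cross2 (z 3 - z 0) (z 1 - z 0) > 0"
proof -
  obtain \<alpha> \<beta> \<gamma> where p: "0 < \<alpha>" "0 < \<beta>" "0 < \<gamma>" "\<alpha> + \<beta> + \<gamma> = 1"
    "z 0 = \<alpha> *\<^sub>R z 1 + \<beta> *\<^sub>R z 2 + \<gamma> *\<^sub>R z 3" by (rule z0_barycentric)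
  have a: "\<alpha> = 1 - \<beta> - \<gamma>" using p(4) by simp
  have "cross2 (z 1 - z 0) (z 2 - z 0) = \<gamma> * cross2 (z 2 - z 1) (z 3 - z 1)"
    "cross2 (z 2 - z 0) (z 3 - z 0) = \<alpha> * cross2 (z 2 - z 1) (z 3 - z 1)"
    "cross2 (z 3 - z 0) (z 1 - z 0) = \<beta> * cross2 (z 2 - z 1) (z 3 - z 1)"
    unfolding p(5) a cross2_def by (simp_all add: algebra_simps)
  then show "cross2 (z 1 - z 0) (z 2 - z 0) > 0" "cross2 (z 2 - z 0) (z 3 - z 0) > 0"
    "cross2 (z 3 - z 0) (z 1 - z 0) > 0" using p cross_T by simp_all
qed

lemma cross_on_edge:
  assumes "M \<in> open_segment A B" "cross2 (A - p) (B - p) > 0"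
  shows "cross2 (A - p) (M - p) > 0" "cross2 (M - p) (B - p) > 0"
proof -
  obtain m where m: "M = (1 - m) *\<^sub>R A + m *\<^sub>R B" "0 < m" "m < 1"
    using assms(1) unfolding in_segment by blast
  have "cross2 (A - p) (M - p) = m * cross2 (A - p) (B - p)"
    "cross2 (M - p) (B - p) = (1 - m) * cross2 (A - p) (B - p)"
    unfolding m(1) cross2_def by (simp_all add: algebra_simps)
  then show "cross2 (A - p) (M - p) > 0" "cross2 (M - p) (B - p) > 0" using m assms(2) by simp_all
qed

lemma node_cross:
  assumes "j < 6"
  shows "cross2 (node j - z 0) (node (Suc j) - z 0) > 0"
  using assms cross_on_edge[OF midpoints(1) macro_cross(2)] cross_on_edge[OF midpoints(2) macro_cross(3)]
    cross_on_edge[OF midpoints(3) macro_cross(1)]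
  by (elim less_6_cases) (simp_all add: node_def del: cross2_linear)

lemma node_cross_neq: "j < 6 \<Longrightarrow> cross2 (node j - z 0) (node (Suc j) - z 0) \<noteq> 0"
  using node_cross by force

lemma node_neq: "j < 6 \<Longrightarrow> node j \<noteq> node (Suc j)"
  using node_cross[of j] by (auto simp del: cross2_linear simp: cross2_def)

lemma convex_T: "convex (ps_T z)" and closed_T: "closed (ps_T z)" and compact_T: "compact (ps_T z)"
  by (auto simp: ps_T_def compact_imp_closed finite_imp_compact_convex_hull)

lemma interior_T: "interior (ps_T z) \<noteq> {}"
  using z0_interior by auto

lemma convex_tri: "convex (tri j)" and closed_tri: "closed (tri j)" and compact_tri: "compact (tri j)"
  by (auto simp: tri_def compact_imp_closed finite_imp_compact_convex_hull)

lemma interior_tri: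
  assumes "j < 6"
  shows "interior (tri j) \<noteq> {}"
proof -
  have "\<not> collinear {z 0, node j, node (Suc j)}"
    using cross2_not_collinear node_cross_neq[OF assms] by blast
  from interior_convex_hull_3_minimal[OF this]
  have I: "interior (tri j) = {v. \<exists>a b c. 0 < a \<and> 0 < b \<and> 0 < c \<and> a + b + c = 1 \<and>
      a *\<^sub>R z 0 + b *\<^sub>R node j + c *\<^sub>R node (Suc j) = v}"
    unfolding tri_def by simp
  have "0 < (1/3::real)" "1/3 + 1/3 + 1/3 = (1::real)" by simp_all
  then have "(1/3) *\<^sub>R z 0 + (1/3) *\<^sub>R node j + (1/3) *\<^sub>R node (Suc j) \<in> interior (tri j)"
    unfolding I by blast
  then show ?thesis by blast
qed

lemma z0_tri: "z 0 \<in> tri j" and node_tri: "node j \<in> tri j" and node_Suc_tri: "node (Suc j) \<in> tri j"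
  unfolding tri_def by (auto intro: hull_inc)

lemma edge_subset_tri: "edge j \<subseteq> tri j"
  and left_ray_subset_tri: "closed_segment (z 0) (node j) \<subseteq> tri j"
  and right_ray_subset_tri: "closed_segment (z 0) (node (Suc j)) \<subseteq> tri j"
  by (rule closed_segment_subset[OF node_tri node_Suc_tri convex_tri]
      closed_segment_subset[OF z0_tri node_tri convex_tri]
      closed_segment_subset[OF z0_tri node_Suc_tri convex_tri])+

lemma z_in_T: "z 1 \<in> ps_T z" "z 2 \<in> ps_T z" "z 3 \<in> ps_T z" "z 0 \<in> ps_T z"
  using z0_interior interior_subset by (auto simp: ps_T_def intro: hull_inc)

lemma edges_split:
  "closed_segment (z 1) (z 6) \<union> closed_segment (z 6) (z 2) = closed_segment (z 1) (z 2)"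
  "closed_segment (z 2) (z 4) \<union> closed_segment (z 4) (z 3) = closed_segment (z 2) (z 3)"
  "closed_segment (z 3) (z 5) \<union> closed_segment (z 5) (z 1) = closed_segment (z 3) (z 1)"
  using midpoints_closed by (simp_all add: Un_closed_segment)

lemma lessThan_6: "{..<6::nat} = {0, 1, 2, 3, 4, 5}"
  by auto

lemma frontier_T: "frontier (ps_T z) = (\<Union>j<6. edge j)"
proof -
  have "frontier (ps_T z) = closed_segment (z 1) (z 2) \<union> closed_segment (z 2) (z 3) \<union> closed_segment (z 3) (z 1)"
    unfolding ps_T_def by (rule frontier_of_triangle) simp
  also have "\<dots> = (\<Union>j<6. edge j)"
    unfolding edges_split[symmetric] lessThan_6 by (simp add: node_def Un_assoc)
  finally show ?thesis .
qed

lemma triangle_as_cone: "convex hull {p, A, B} = (\<Union>x\<in>closed_segment A B. closed_segment p x)"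
  unfolding segment_convex_hull[of A B] by (subst convex_hull_insert_segments) (simp only: insert_not_empty if_False)

lemma triangle_split_edge:
  fixes A B M p :: "real^2"
  shows "M \<in> closed_segment A B \<Longrightarrow> convex hull {p, A, B} = convex hull {p, A, M} \<union> convex hull {p, M, B}"
  unfolding triangle_as_cone UN_Un[symmetric] by (drule Un_closed_segment) simp

text \<open>Replacing each vertex in turn by \<open>z 0\<close> covers the triangle by three large
  ones, and every one of these is cut in two by the split point on its outer side.\<close>

lemma T_split: "ps_T z = (\<Union>j<6. tri j)"
proof -
  note m = midpoints_closed
  have "z 0 \<in> convex hull {z 1, z 2, z 3}" using z_in_T by (simp add: ps_T_def)
  from convex_hull_exchange_Union[OF this]
  have "ps_T z = convex hull (insert (z 0) ({z 1, z 2, z 3} - {z 1})) \<union>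
      (convex hull (insert (z 0) ({z 1, z 2, z 3} - {z 2})) \<union> convex hull (insert (z 0) ({z 1, z 2, z 3} - {z 3})))"
    by (simp add: ps_T_def)
  moreover have "z 1 \<noteq> z 2" "z 2 \<noteq> z 3" "z 1 \<noteq> z 3"
    using cross_T by (auto simp: cross2_def)
  then have "{z 1, z 2, z 3} - {z 1} = {z 2, z 3}" "{z 1, z 2, z 3} - {z 2} = {z 3, z 1}"
    "{z 1, z 2, z 3} - {z 3} = {z 1, z 2}" by auto
  ultimately have "ps_T z = convex hull {z 0, z 2, z 3} \<union> (convex hull {z 0, z 3, z 1} \<union> convex hull {z 0, z 1, z 2})"
    by simp
  also have "\<dots> = (tri 2 \<union> tri 3) \<union> ((tri 4 \<union> tri 5) \<union> (tri 0 \<union> tri 1))"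
    by (simp only: triangle_split_edge[OF m(1)] triangle_split_edge[OF m(2)] triangle_split_edge[OF m(3)] tri_simps)
  also have "\<dots> = (\<Union>j<6. tri j)" unfolding lessThan_6 by auto
  finally show ?thesis .
qed

lemma tri_subset_T: "j < 6 \<Longrightarrow> tri j \<subseteq> ps_T z"
  unfolding T_split by auto

lemma tri_radial:
  assumes "x \<in> tri j"
  obtains e s where "e \<in> edge j" "0 \<le> s" "s \<le> 1" "x = z 0 + s *\<^sub>R (e - z 0)"
proof -
  obtain e where e: "e \<in> edge j" "x \<in> closed_segment (z 0) e"
    using assms unfolding tri_def triangle_as_cone by blast
  then obtain s where s: "0 \<le> s" "s \<le> 1" "x = (1 - s) *\<^sub>R z 0 + s *\<^sub>R e"
    unfolding in_segment by blast
  then have "x = z 0 + s *\<^sub>R (e - z 0)" by (simp add: algebra_simps)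
  with e(1) s(1,2) show ?thesis by (rule that)
qed

lemma macro_inter:
  "x \<in> tri 0 \<union> tri 1 \<Longrightarrow> x \<in> tri 2 \<union> tri 3 \<Longrightarrow> x \<in> closed_segment (z 0) (z 2)"
  "x \<in> tri 2 \<union> tri 3 \<Longrightarrow> x \<in> tri 4 \<union> tri 5 \<Longrightarrow> x \<in> closed_segment (z 0) (z 3)"
  "x \<in> tri 4 \<union> tri 5 \<Longrightarrow> x \<in> tri 0 \<union> tri 1 \<Longrightarrow> x \<in> closed_segment (z 0) (z 1)"
proof -
  from midpoints_closed[THEN triangle_split_edge, of "z 0"]
  have m: "tri 2 \<union> tri 3 = convex hull {z 0, z 2, z 3}" "tri 4 \<union> tri 5 = convex hull {z 0, z 3, z 1}"
    "tri 0 \<union> tri 1 = convex hull {z 0, z 1, z 2}"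
    unfolding tri_simps by auto
  obtain \<alpha> \<beta> \<gamma> where p: "0 < \<alpha>" "0 < \<beta>" "0 < \<gamma>" "\<alpha> + \<beta> + \<gamma> = 1"
    "z 0 = \<alpha> *\<^sub>R z 1 + \<beta> *\<^sub>R z 2 + \<gamma> *\<^sub>R z 3" by (rule z0_barycentric)
  have p': "z 0 = \<beta> *\<^sub>R z 2 + \<gamma> *\<^sub>R z 3 + \<alpha> *\<^sub>R z 1" "z 0 = \<gamma> *\<^sub>R z 3 + \<alpha> *\<^sub>R z 1 + \<beta> *\<^sub>R z 2"
    "\<beta> + \<gamma> + \<alpha> = 1" "\<gamma> + \<alpha> + \<beta> = 1"
    using p(4,5) by (simp_all add: add_ac)
  note c = cross_T[THEN less_imp_neq, symmetric] cross_T_rotated[THEN less_imp_neq, symmetric]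
  show "x \<in> tri 0 \<union> tri 1 \<Longrightarrow> x \<in> tri 2 \<union> tri 3 \<Longrightarrow> x \<in> closed_segment (z 0) (z 2)"
    unfolding m by (rule triangles_at_corner_inter[OF c(1) p(5) p(1-4)])
  show "x \<in> tri 2 \<union> tri 3 \<Longrightarrow> x \<in> tri 4 \<union> tri 5 \<Longrightarrow> x \<in> closed_segment (z 0) (z 3)"
    unfolding m by (rule triangles_at_corner_inter[OF c(2) p'(1) p(2,3,1) p'(3)])
  show "x \<in> tri 4 \<union> tri 5 \<Longrightarrow> x \<in> tri 0 \<union> tri 1 \<Longrightarrow> x \<in> closed_segment (z 0) (z 1)"
    unfolding m by (rule triangles_at_corner_inter[OF c(3) p'(2) p(3,1,2) p'(4)])
qed

lemma edge_inter:
  "x \<in> tri 0 \<Longrightarrow> x \<in> tri 1 \<Longrightarrow> x \<in> closed_segment (z 0) (z 6)"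
  "x \<in> tri 2 \<Longrightarrow> x \<in> tri 3 \<Longrightarrow> x \<in> closed_segment (z 0) (z 4)"
  "x \<in> tri 4 \<Longrightarrow> x \<in> tri 5 \<Longrightarrow> x \<in> closed_segment (z 0) (z 5)"
  unfolding tri_simps
  using triangles_on_edge_inter[OF macro_cross(1)[THEN less_imp_neq, symmetric] midpoints(3)]
    triangles_on_edge_inter[OF macro_cross(2)[THEN less_imp_neq, symmetric] midpoints(1)]
    triangles_on_edge_inter[OF macro_cross(3)[THEN less_imp_neq, symmetric] midpoints(2)] by blast+

text \<open>For triangles in different large triangles: their common points lie on the ray to the
  shared vertex. If one of the two triangles does not have that vertex as a node, only
  \<open>z 0\<close> remains.\<close>

lemma far_ray_inter:
  "x \<in> tri 0 \<Longrightarrow> x \<in> closed_segment (z 0) (z 2) \<Longrightarrow> x = z 0"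
  "x \<in> tri 1 \<Longrightarrow> x \<in> closed_segment (z 0) (z 1) \<Longrightarrow> x = z 0"
  "x \<in> tri 2 \<Longrightarrow> x \<in> closed_segment (z 0) (z 3) \<Longrightarrow> x = z 0"
  "x \<in> tri 3 \<Longrightarrow> x \<in> closed_segment (z 0) (z 2) \<Longrightarrow> x = z 0"
  "x \<in> tri 4 \<Longrightarrow> x \<in> closed_segment (z 0) (z 1) \<Longrightarrow> x = z 0"
  "x \<in> tri 5 \<Longrightarrow> x \<in> closed_segment (z 0) (z 3) \<Longrightarrow> x = z 0"
proof -
  note c = macro_cross[THEN less_imp_neq, symmetric]
  have d: "cross2 (z 2 - z 0) (z 1 - z 0) \<noteq> 0" "cross2 (z 3 - z 0) (z 2 - z 0) \<noteq> 0" "cross2 (z 1 - z 0) (z 3 - z 0) \<noteq> 0"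
    using c cross2_swap by (metis neg_equal_0_iff_equal)+
  have e: "convex hull {z 0, z 6, z 2} = convex hull {z 0, z 2, z 6}"
    "convex hull {z 0, z 4, z 3} = convex hull {z 0, z 3, z 4}"
    "convex hull {z 0, z 5, z 1} = convex hull {z 0, z 1, z 5}"
    by (simp_all add: insert_commute)
  have r: "z 4 \<in> open_segment (z 3) (z 2)" "z 5 \<in> open_segment (z 1) (z 3)" "z 6 \<in> open_segment (z 2) (z 1)"
    using midpoints by (simp_all add: open_segment_commute)
  show "x \<in> tri 0 \<Longrightarrow> x \<in> closed_segment (z 0) (z 2) \<Longrightarrow> x = z 0"
    "x \<in> tri 1 \<Longrightarrow> x \<in> closed_segment (z 0) (z 1) \<Longrightarrow> x = z 0"
    "x \<in> tri 2 \<Longrightarrow> x \<in> closed_segment (z 0) (z 3) \<Longrightarrow> x = z 0"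
    "x \<in> tri 3 \<Longrightarrow> x \<in> closed_segment (z 0) (z 2) \<Longrightarrow> x = z 0"
    "x \<in> tri 4 \<Longrightarrow> x \<in> closed_segment (z 0) (z 1) \<Longrightarrow> x = z 0"
    "x \<in> tri 5 \<Longrightarrow> x \<in> closed_segment (z 0) (z 3) \<Longrightarrow> x = z 0"
    unfolding tri_simps e
    by (rule triangle_inter_far_ray[OF c(1) midpoints(3)] triangle_inter_far_ray[OF d(1) r(3)]
      triangle_inter_far_ray[OF c(2) midpoints(1)] triangle_inter_far_ray[OF d(2) r(1)]
      triangle_inter_far_ray[OF c(3) midpoints(2)] triangle_inter_far_ray[OF d(3) r(2)], assumption+)+
qed

lemma tri_inter_aux:
  assumes "j < 6" "k < 6" "j < k" "x \<in> tri j" "x \<in> tri k"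
  shows "x = z 0 \<or> (k = Suc j \<and> x \<in> closed_segment (z 0) (node k)) \<or> (j = 0 \<and> k = 5 \<and> x \<in> closed_segment (z 0) (node 0))"
proof -
  have "(j, k) \<in> {(0,1),(0,2),(0,3),(0,4),(0,5),(1,2),(1,3),(1,4),(1,5),(2,3),(2,4),(2,5),(3,4),(3,5),(4,5)}"
    using assms(1-3) by (elim less_6_cases) simp_all
  then show ?thesis
    using assms(4,5) macro_inter[of x] edge_inter[of x] far_ray_inter[of x]
    by (elim insertE emptyE) (auto simp: node_def)
qed

lemma tri_inter:
  assumes "j < 6" "k < 6" "j \<noteq> k" "x \<in> tri j" "x \<in> tri k"
  shows "x = z 0 \<or> (k = Suc j mod 6 \<and> x \<in> closed_segment (z 0) (node k))
    \<or> (j = Suc k mod 6 \<and> x \<in> closed_segment (z 0) (node j))"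
proof (cases "j < k")
  case True
  then show ?thesis using tri_inter_aux[OF assms(1,2) True assms(4,5)] assms(1,2) by auto
next
  case False
  then show ?thesis using tri_inter_aux[OF assms(2,1) _ assms(5,4)] assms(1-3) by auto
qed

end

section \<open>Splines and their polynomial pieces\<close>

lemma has_derivative_within_Un:
  assumes "(f has_derivative D) (at x within A)" "(f has_derivative D) (at x within B)"
  shows "(f has_derivative D) (at x within (A \<union> B))"
  using assms unfolding has_derivative_at_within by (simp add: at_within_union filterlim_sup)

lemma has_derivative_within_UN:
  assumes "finite I" "bounded_linear D" "\<And>i. i \<in> I \<Longrightarrow> (f has_derivative D) (at x within A i)"
  shows "(f has_derivative D) (at x within (\<Union>i\<in>I. A i))"
  using assms(1,3)
proof (induction I rule: finite_induct)
  case empty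
  show ?case unfolding has_derivative_at_within using assms(2) by simp
next
  case (insert i I)
  then show ?case by (simp add: has_derivative_within_Un)
qed

text \<open>The filter is trivial here. In a finite union of closed pieces, the derivative at x is
  therefore decided by the pieces that contain x.\<close>

lemma has_derivative_within_notin_closed:
  assumes "closed A" "x \<notin> A" "bounded_linear D"
  shows "(f has_derivative D) (at x within A)"
proof -
  have "at x within A = bot"
    using assms(1,2) by (simp add: at_within_eq_bot_iff)
  then show ?thesis unfolding has_derivative_at_within using assms(3) by simp
qed

interpretation fs: scalar_space fun_scale
  by (intro scalar_space.intro vector_space_fun_scale)

lemma fun_dim_eq: "fun_dim U = fs.dim U"
  by (simp add: fun_dim_def)

context powell_sabin
begin

abbreviation T :: "(real^2) set" where "T \<equiv> ps_T z"

abbreviation splines :: "nat \<Rightarrow> (real^2 \<Rightarrow> real) set" where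
  "splines r \<equiv> ps_S (int r) z"

abbreviation splines0 :: "nat \<Rightarrow> (real^2 \<Rightarrow> real) set" where
  "splines0 r \<equiv> ps_S0 (int r) z"

abbreviation grad :: "(real^2 \<Rightarrow> real) \<Rightarrow> real^2 \<Rightarrow> real^2" where
  "grad \<equiv> grad_on T"


text \<open>C^1 matching, required on every pairwise intersection; for triangles that are not
  neighbours this is a condition at \<open>z 0\<close>.\<close>

definition compatible :: "(nat \<Rightarrow> real^2 \<Rightarrow> real) \<Rightarrow> bool" where
  "compatible P \<longleftrightarrow> (\<forall>j<6. \<forall>k<6. \<forall>x\<in>tri j \<inter> tri k.
     P j x = P k x \<and> (\<forall>v. dderiv v (P j) x = dderiv v (P k) x))"

lemma compatibleI:
  assumes "\<And>j k x. j < 6 \<Longrightarrow> k < 6 \<Longrightarrow> x \<in> tri j \<Longrightarrow> x \<in> tri k \<Longrightarrow> P j x = P k x"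
    "\<And>j k x v. j < 6 \<Longrightarrow> k < 6 \<Longrightarrow> x \<in> tri j \<Longrightarrow> x \<in> tri k \<Longrightarrow> dderiv v (P j) x = dderiv v (P k) x"
  shows "compatible P"
  unfolding compatible_def by (intro allI impI ballI conjI) (erule IntE, erule (3) assms)+

lemma compatibleD:
  assumes "compatible P" "j < 6" "k < 6" "x \<in> tri j" "x \<in> tri k"
  shows "P j x = P k x" "dderiv v (P j) x = dderiv v (P k) x"
  using assms(1)[unfolded compatible_def, rule_format, OF assms(2,3) IntI[OF assms(4,5)]] by simp_all

text \<open>Values and gradients are prescribed on the closed triangles. The gradient of
  \<open>q\<close> is relative to the whole of \<open>T\<close>, so neighbouring pieces are
  automatically matched on common edges.\<close>

definition pieces :: "nat \<Rightarrow> (real^2 \<Rightarrow> real) \<Rightarrow> (nat \<Rightarrow> real^2 \<Rightarrow> real) \<Rightarrow> bool" where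
  "pieces r q P \<longleftrightarrow> (\<forall>j<6. polyfun r (P j) \<and> (\<forall>x\<in>tri j. q x = P j x \<and>
     (\<forall>v. grad q x \<bullet> v = dderiv v (P j) x)))"

lemma piecesD:
  assumes "pieces r q P" "j < 6"
  shows "polyfun r (P j)" "x \<in> tri j \<Longrightarrow> q x = P j x"
    "x \<in> tri j \<Longrightarrow> grad q x \<bullet> v = dderiv v (P j) x"
  using assms unfolding pieces_def by auto

lemma pieces_compatible:
  assumes "pieces r q P"
  shows "compatible P"
proof (rule compatibleI)
  fix j k :: nat and x assume j: "j < 6" "x \<in> tri j" and k: "k < 6" "x \<in> tri k"
  show "P j x = P k x" using piecesD(2)[OF assms j] piecesD(2)[OF assms k] by simp
  show "dderiv v (P j) x = dderiv v (P k) x" for v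
    using piecesD(3)[OF assms j] piecesD(3)[OF assms k] by simp
qed

lemma closure_interior_tri: "j < 6 \<Longrightarrow> closure (interior (tri j)) = tri j"
  using convex_closure_interior[OF convex_tri interior_tri] closed_tri by simp

text \<open>Membership provides a polynomial on the open triangle only. Continuity extends the
  equality to the closed triangle, and there uniqueness of derivatives within a convex set
  identifies the gradients.\<close>

lemma ps_S_pieces:
  assumes q: "q \<in> splines r"
  shows "\<exists>P. pieces r q P"
proof -
  have "\<exists>f. polyfun r f \<and> (\<forall>x\<in>tri j. q x = f x \<and> (\<forall>v. grad q x \<bullet> v = dderiv v f x))"
    if j: "j < 6" for j
  proof -
    have "tri j \<in> ps_triangles z" using j by (auto simp: ps_triangles_eq)
    then obtain p where p: "p \<in> poly_space (int r) (tri j)" "\<forall>x\<in>interior (tri j). q x = p x"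
      using q unfolding ps_S_def ps_poly_def by auto
    then obtain f where f: "polyfun r f" "\<forall>x\<in>tri j. p x = f x" unfolding mem_poly_space by blast
    have cq: "continuous_on (tri j) q"
      using q tri_subset_T[OF j] unfolding ps_S_def by (auto intro: continuous_on_subset)
    have eq: "q x = f x" if "x \<in> tri j" for x
    proof -
      have "continuous_on (closure (interior (tri j))) (\<lambda>x. q x - f x)"
        unfolding closure_interior_tri[OF j]
        by (intro continuous_on_diff cq polyfun_continuous_on[OF f(1)])
      then have "q x - f x = 0"
        by (rule continuous_constant_on_closure) (use p(2) f(2) interior_subset that closure_interior_tri[OF j] in auto)
      then show ?thesis by simp
    qed
    have "grad q x \<bullet> v = dderiv v f x" if x: "x \<in> tri j" for x v
    proof -
      have xT: "x \<in> T" using x tri_subset_T[OF j] by blast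
      then obtain D where D: "(q has_derivative D) (at x within T)"
        using q unfolding ps_S_def differentiable_def by blast
      have 1: "(q has_derivative D) (at x within tri j)"
        by (rule has_derivative_subset[OF D tri_subset_T[OF j]])
      have 2: "(q has_derivative (\<lambda>v. dderiv v f x)) (at x within tri j)"
        by (rule has_derivative_transform[OF x _ has_derivative_at_withinI[OF polyfun_has_derivative[OF f(1)]]])
          (simp add: eq)
      have "D = (\<lambda>v. dderiv v f x)"
        by (rule has_derivative_unique_within_convex[OF convex_tri interior_tri[OF j] x 1 2])
      then show ?thesis using inner_grad_on[OF convex_T interior_T xT D] by simp
    qed
    then show ?thesis using f(1) eq by blast
  qed
  then obtain P where "\<forall>j. j < 6 \<longrightarrow> polyfun r (P j) \<and> (\<forall>x\<in>tri j. q x = P j x \<and> (\<forall>v. grad q x \<bullet> v = dderiv v (P j) x))"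
    by metis
  then show ?thesis unfolding pieces_def by blast
qed

lemma ps_S_zero_outside: "q \<in> ps_S k z \<Longrightarrow> x \<notin> T \<Longrightarrow> q x = 0"
  unfolding ps_S_def ps_poly_def by auto

text \<open>The converse of \<open>ps_S_pieces\<close>. At a given point all triangles containing it
  propose the same derivative by compatibility, and the other triangles impose nothing; continuity
  is checked on the closed triangles.\<close>

lemma glue:
  assumes P: "\<And>j. j < 6 \<Longrightarrow> polyfun r (P j)" and C: "compatible P"
    and out: "\<And>x. x \<notin> T \<Longrightarrow> q x = 0" and q: "\<And>j x. j < 6 \<Longrightarrow> x \<in> tri j \<Longrightarrow> q x = P j x"
  shows "q \<in> splines r \<and> pieces r q P"
proof -
  have D: "(q has_derivative (\<lambda>v. dderiv v (P j) x)) (at x within T)" if j: "j < 6" "x \<in> tri j" for j x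
    unfolding T_split
  proof (rule has_derivative_within_UN)
    let ?D = "\<lambda>v. dderiv v (P j) x"
    show bl: "bounded_linear ?D"
      using polyfun_has_derivative[OF P[OF j(1)]] has_derivative_bounded_linear by blast
    fix k :: nat assume "k \<in> {..<6}"
    then have k: "k < 6" by simp
    show "(q has_derivative ?D) (at x within tri k)"
    proof (cases "x \<in> tri k")
      case True
      have "?D = (\<lambda>v. dderiv v (P k) x)" using compatibleD(2)[OF C j(1) k j(2) True] by blast
      then show ?thesis
        using has_derivative_transform[OF True q[OF k] has_derivative_at_withinI[OF polyfun_has_derivative[OF P[OF k]]]]
        by simp
    next
      case False
      then show ?thesis using has_derivative_within_notin_closed closed_tri bl by blast
    qed
  qed simp
  have g: "grad q x \<bullet> v = dderiv v (P j) x" if "j < 6" "x \<in> tri j" for j x v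
    using inner_grad_on[OF convex_T interior_T _ D[OF that]] tri_subset_T that by blast
  have pw: "continuous_on T f" if f: "\<And>j. j < 6 \<Longrightarrow> continuous_on (tri j) f" for f :: "real^2 \<Rightarrow> 'b::topological_space"
    unfolding T_split by (intro continuous_on_closed_Union) (simp_all add: closed_tri f)
  have cq: "continuous_on T q"
  proof (rule pw)
    fix j :: nat assume j: "j < 6"
    show "continuous_on (tri j) q"
      by (rule iffD2[OF continuous_on_cong[OF refl q[OF j]] polyfun_continuous_on[OF P[OF j]]])
  qed
  have crot: "continuous_on T (rot_on T q)"
  proof (rule pw)
    fix j :: nat assume j: "j < 6"
    have "rot_on T q x = dderiv (axis 2 1) (P j) x *\<^sub>R axis 1 1 + (- dderiv (axis 1 1) (P j) x) *\<^sub>R axis 2 1"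
      if "x \<in> tri j" for x
    proof -
      have "grad q x $ 1 = dderiv (axis 1 1) (P j) x" "grad q x $ 2 = dderiv (axis 2 1) (P j) x"
        using g[OF j that, of "axis 1 1"] g[OF j that, of "axis 2 1"] by (simp_all add: inner_axis)
      moreover have "axis 1 1 $ 1 = (1::real)" "axis 1 1 $ (2::2) = (0::real)" "axis 2 1 $ (1::2) = (0::real)" "axis 2 1 $ 2 = (1::real)"
        by (simp_all add: axis_def)
      ultimately show ?thesis by (simp add: rot_on_def vec2_eq_iff vector_2)
    qed
    moreover have "continuous_on (tri j) (\<lambda>x. dderiv (axis 2 1) (P j) x *\<^sub>R (axis 1 1 :: real^2)
        + (- dderiv (axis 1 1) (P j) x) *\<^sub>R axis 2 1)"
      by (intro continuous_intros polyfun_continuous_on[OF polyfun_dderiv[OF P[OF j]]])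
    ultimately show "continuous_on (tri j) (rot_on T q)" by (simp cong: continuous_on_cong)
  qed
  have "q \<in> ps_poly (int r) z"
    unfolding ps_poly_def
  proof (intro CollectI conjI ballI allI impI)
    fix S assume "S \<in> ps_triangles z"
    then obtain j where j: "j < 6" "S = tri j" unfolding ps_triangles_eq by auto
    define p where "p x = (if x \<in> S then P j x else 0)" for x
    have "p \<in> poly_space (int r) S"
      unfolding mem_poly_space p_def using P[OF j(1)] by auto
    moreover have "q x = p x" if "x \<in> interior S" for x
      using q[OF j(1), of x] that interior_subset[of S] j(2) unfolding p_def by auto
    ultimately show "\<exists>p\<in>poly_space (int r) S. \<forall>x\<in>interior S. q x = p x" by blast
  qed (rule out)
  moreover have "q differentiable (at x within T)" if x: "x \<in> T" for x
  proof -
    obtain j where "j < 6" "x \<in> tri j" using x unfolding T_split by auto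
    then show ?thesis using D differentiable_def by blast
  qed
  ultimately have "q \<in> splines r" using cq crot unfolding ps_S_def by auto
  moreover have "pieces r q P" unfolding pieces_def using P q g by auto
  ultimately show ?thesis by blast
qed

lemma pieces_add:
  assumes "q1 \<in> splines r" "pieces r q1 P1" "q2 \<in> splines r" "pieces r q2 P2"
  shows "q1 + q2 \<in> splines r \<and> pieces r (q1 + q2) (\<lambda>j x. P1 j x + P2 j x)"
proof (rule glue)
  fix j :: nat assume j: "j < 6"
  show "polyfun r (\<lambda>x. P1 j x + P2 j x)" using assms piecesD(1) j by (intro polyfun_add) auto
  fix x assume "x \<in> tri j"
  then show "(q1 + q2) x = P1 j x + P2 j x"
    using piecesD(2)[OF assms(2) j] piecesD(2)[OF assms(4) j] by simp
next
  have "dderiv v (\<lambda>x. P1 j x + P2 j x) x = dderiv v (P1 j) x + dderiv v (P2 j) x" if "j < 6" for j v x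
    using dderiv_add[OF piecesD(1)[OF assms(2) that] piecesD(1)[OF assms(4) that]] by simp
  then show "compatible (\<lambda>j x. P1 j x + P2 j x)"
    by (intro compatibleI)
      (simp_all, (intro arg_cong2[where f = "(+)"] compatibleD[OF pieces_compatible[OF assms(2)]]
        compatibleD[OF pieces_compatible[OF assms(4)]]; assumption)+)
qed (simp add: ps_S_zero_outside[OF assms(1)] ps_S_zero_outside[OF assms(3)])

lemma pieces_scale:
  assumes "q \<in> splines r" "pieces r q P"
  shows "fun_scale c q \<in> splines r \<and> pieces r (fun_scale c q) (\<lambda>j x. c * P j x)"
proof (rule glue)
  fix j :: nat assume j: "j < 6"
  show "polyfun r (\<lambda>x. c * P j x)" using assms piecesD(1) j by (intro polyfun_cmult) auto
  fix x assume "x \<in> tri j"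
  then show "fun_scale c q x = c * P j x"
    using piecesD(2)[OF assms(2) j] by (simp add: fun_scale_def)
next
  have "dderiv v (\<lambda>x. c * P j x) x = c * dderiv v (P j) x" if "j < 6" for j v x
    using dderiv_cmult[OF piecesD(1)[OF assms(2) that]] by simp
  then show "compatible (\<lambda>j x. c * P j x)"
    by (intro compatibleI)
      (simp_all, (intro disjI2 compatibleD[OF pieces_compatible[OF assms(2)]]; assumption)+)
qed (simp add: fun_scale_def ps_S_zero_outside[OF assms(1)])

lemma global_polyfun_mem_ps_S:
  assumes "polyfun r f"
  shows "(\<lambda>x. if x \<in> T then f x else 0) \<in> splines r"
proof -
  have "(\<lambda>x. if x \<in> T then f x else 0) \<in> splines r \<and> pieces r (\<lambda>x. if x \<in> T then f x else 0) (\<lambda>j. f)"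
    by (rule glue) (use assms tri_subset_T in \<open>auto simp: compatible_def\<close>)
  then show ?thesis by blast
qed

lemma subspace_ps_S: "fs.subspace (splines r)"
proof -
  have "0 \<in> splines r"
    using global_polyfun_mem_ps_S[OF polyfun_const[of r 0]] by (simp add: func_zero)
  moreover have "x + y \<in> splines r" if "x \<in> splines r" "y \<in> splines r" for x y
    using pieces_add[OF that(1) _ that(2)] ps_S_pieces[OF that(1)] ps_S_pieces[OF that(2)] by blast
  moreover have "fun_scale c x \<in> splines r" if "x \<in> splines r" for c x
    using pieces_scale[OF that] ps_S_pieces[OF that] by blast
  ultimately show ?thesis unfolding fs.subspace_def by simp
qed

lemma mem_T_tri: "x \<in> T \<Longrightarrow> \<exists>j<6. x \<in> tri j"
  unfolding T_split by auto

lemma grad_on_add: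
  assumes "q1 \<in> splines r" "q2 \<in> splines r" "x \<in> T"
  shows "grad (q1 + q2) x \<bullet> v = grad q1 x \<bullet> v + grad q2 x \<bullet> v"
proof -
  obtain P1 P2 where P: "pieces r q1 P1" "pieces r q2 P2" using ps_S_pieces assms by blast
  obtain j where j: "j < 6" "x \<in> tri j" using mem_T_tri assms(3) by blast
  have "pieces r (q1 + q2) (\<lambda>j x. P1 j x + P2 j x)" using pieces_add assms P by blast
  from piecesD(3)[OF this j] show ?thesis
    using piecesD(3)[OF P(1) j] piecesD(3)[OF P(2) j]
      dderiv_add[OF piecesD(1)[OF P(1) j(1)] piecesD(1)[OF P(2) j(1)]] by simp
qed

lemma grad_on_scale:
  assumes "q \<in> splines r" "x \<in> T"
  shows "grad (fun_scale c q) x \<bullet> v = c * (grad q x \<bullet> v)"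
proof -
  obtain P where P: "pieces r q P" using ps_S_pieces assms by blast
  obtain j where j: "j < 6" "x \<in> tri j" using mem_T_tri assms(2) by blast
  have "pieces r (fun_scale c q) (\<lambda>j x. c * P j x)" using pieces_scale assms P by blast
  from piecesD(3)[OF this j] show ?thesis
    using piecesD(3)[OF P j] dderiv_cmult[OF piecesD(1)[OF P j(1)]] by simp
qed

lemma linear_fun_eval: "fs.linear_fun_on U (\<lambda>q. q x)"
  unfolding fs.linear_fun_on_def by (simp add: fun_scale_def)

lemma linear_fun_grad: "x \<in> T \<Longrightarrow> fs.linear_fun_on (splines r) (\<lambda>q. grad q x \<bullet> v)"
  unfolding fs.linear_fun_on_def by (auto simp: grad_on_add grad_on_scale)

lemma ps_S0_subset: "ps_S0 k z \<subseteq> ps_S k z"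
  unfolding ps_S0_def by auto

lemma mem_ps_S0:
  "q \<in> splines0 r \<longleftrightarrow> q \<in> splines r \<and> (\<forall>x\<in>frontier T. q x = 0 \<and> grad q x = 0)"
  unfolding ps_S0_def by (simp add: rot_on_eq_0_iff)

lemma frontier_subset_T: "frontier T \<subseteq> T"
  using closed_T frontier_subset_closed by blast

lemma mem_ps_S0':
  "q \<in> splines0 r \<longleftrightarrow> q \<in> splines r \<and> (\<forall>x\<in>frontier T. q x = 0 \<and> (\<forall>v. grad q x \<bullet> v = 0))"
proof -
  have "grad q x = 0 \<longleftrightarrow> (\<forall>v. grad q x \<bullet> v = 0)" for x
    using inner_eq_zero_iff[of "grad q x"] by fastforce
  then show ?thesis unfolding mem_ps_S0 by blast
qed

lemma subspace_ps_S0: "fs.subspace (splines0 r)"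
proof (rule fs.subspaceI)
  note S = subspace_ps_S[of r]
  have z: "0 \<in> splines r" using S fs.subspace_0 by blast
  have "grad 0 x \<bullet> v = 0" if "x \<in> T" for x v
    using grad_on_scale[OF z that, of 0 v] by (simp add: fun_scale_def func_zero)
  then have "grad 0 x = 0" if "x \<in> T" for x
    using that inner_eq_zero_iff by blast
  then show "0 \<in> splines0 r" using z frontier_subset_T unfolding mem_ps_S0 by auto
  fix p q c assume p: "p \<in> splines0 r"
  then have pS: "p \<in> splines r" by (simp add: mem_ps_S0)
  have "grad (fun_scale c p) x \<bullet> v = 0" if "x \<in> frontier T" for x v
    using grad_on_scale[OF pS, of x c v] p that frontier_subset_T unfolding mem_ps_S0' by auto
  then show "fun_scale c p \<in> splines0 r"
    using p fs.subspace_scale[OF S pS, of c] unfolding mem_ps_S0' by (auto simp: fun_scale_def)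
  assume q: "q \<in> splines0 r"
  then have qS: "q \<in> splines r" by (simp add: mem_ps_S0)
  have "grad (p + q) x \<bullet> v = 0" if "x \<in> frontier T" for x v
    using grad_on_add[OF pS qS, of x v] p q that frontier_subset_T unfolding mem_ps_S0' by auto
  then show "p + q \<in> splines0 r"
    using p q fs.subspace_add[OF S pS qS] unfolding mem_ps_S0' by auto
qed

end

section \<open>Boundary degrees of freedom\<close>

definition poly_integral :: "real poly \<Rightarrow> real" where
  "poly_integral p = integral {0..1} (poly p)"

lemma poly_integrable: "poly p integrable_on {0..1::real}"
  by (intro integrable_continuous_real continuous_intros)

lemma poly_integral_add: "poly_integral (p + q) = poly_integral p + poly_integral q"
proof -
  have "poly (p + q) = (\<lambda>x. poly p x + poly q x)" by (simp add: fun_eq_iff)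
  then show ?thesis
    unfolding poly_integral_def using integral_add[OF poly_integrable poly_integrable, of p q] by simp
qed

lemma poly_integral_smult: "poly_integral (smult c p) = c * poly_integral p"
proof -
  have "poly (smult c p) = (\<lambda>x. c * poly p x)" by (simp add: fun_eq_iff)
  then show ?thesis unfolding poly_integral_def by simp
qed

lemma poly_integral_0 [simp]: "poly_integral 0 = 0"
  using poly_integral_smult[of 0 0] by simp

lemma poly_integral_sum: "poly_integral (\<Sum>i\<in>I. f i) = (\<Sum>i\<in>I. poly_integral (f i))"
proof (induction I rule: infinite_finite_induct)
  case (insert i I)
  then show ?case by (simp add: poly_integral_add)
qed simp_all

lemma poly_integral_pderiv: "poly_integral (pderiv p) = poly p 1 - poly p 0"
proof -
  have "(poly (pderiv p) has_integral (poly p 1 - poly p 0)) {0..1}"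
    by (rule fundamental_theorem_of_calculus)
      (auto intro: DERIV_subset[OF poly_DERIV] simp flip: has_real_derivative_iff_has_vector_derivative)
  then show ?thesis unfolding poly_integral_def by (rule integral_unique)
qed

lemma poly_integral_square_nonneg: "poly_integral (p * p) \<ge> 0"
  unfolding poly_integral_def by (rule integral_nonneg[OF poly_integrable]) simp

lemma poly_integral_square_eq_0:
  assumes "poly_integral (p * p) = 0"
  shows "p = 0"
proof (rule poly_eq_0_on_unit_interval)
  have "continuous_on {0..1} (poly (p * p))" by (intro continuous_intros)
  from integral_eq_0_iff[OF this] assms
  have "\<forall>s\<in>{0..1}. poly (p * p) s = 0" unfolding poly_integral_def by simp
  then show "poly p s = 0" if "0 \<le> s" "s \<le> 1" for s using that by simp
qed

lemma pderiv_eq_0_imp_zero: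
  fixes p :: "real poly"
  assumes "pderiv p = 0" "poly p s = 0"
  shows "p = 0"
proof -
  have "degree p = 0" using assms(1) by (simp add: pderiv_eq_0_iff)
  then obtain c where "p = [:c:]" by (rule degree_eq_zeroE)
  then show ?thesis using assms(2) by simp
qed

text \<open>The offset c means that moments of degree up to r - c vanish. The zero polynomial is
  listed separately because its degree is 0, while for c > r there are no moments.\<close>

lemma poly_integral_orthogonal:
  assumes "\<And>k. k + c \<le> r \<Longrightarrow> poly_integral (g * monom 1 k) = 0" "u = 0 \<or> degree u + c \<le> r"
  shows "poly_integral (g * u) = 0"
proof (cases "u = 0")
  case True
  then show ?thesis by simp
next
  case False
  have "g * u = (\<Sum>i\<le>degree u. smult (coeff u i) (g * monom 1 i))"
    by (subst (1) poly_as_sum_of_monoms[of u, symmetric])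
      (simp add: sum_distrib_left smult_monom flip: mult_smult_right)
  then have "poly_integral (g * u) = (\<Sum>i\<le>degree u. coeff u i * poly_integral (g * monom 1 i))"
    by (simp add: poly_integral_sum poly_integral_smult)
  also have "\<dots> = 0"
    using assms False by (intro sum.neutral ballI) auto
  finally show ?thesis .
qed

text \<open>Each derivative shifts one unit from the degree to the offset; the alternative of being
  zero absorbs the case of a constant.\<close>

lemma degree_pderiv_plus:
  fixes p :: "real poly"
  assumes "p = 0 \<or> degree p + c \<le> r"
  shows "pderiv p = 0 \<or> degree (pderiv p) + Suc c \<le> r"
  using assms pderiv_eq_0_iff[of p] degree_pderiv[of p] by (cases "degree p = 0") auto

text \<open>Testing with \<open>p''''\<close> and integrating by parts twice gives \<open>\<integral> (p'')\<^sup>2 = 0\<close>.\<close>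

lemma double_zero_ends_orthogonal:
  fixes p :: "real poly"
  assumes deg: "degree p \<le> r"
    and ends: "poly p 0 = 0" "poly (pderiv p) 0 = 0" "poly p 1 = 0" "poly (pderiv p) 1 = 0"
    and orth: "\<And>k. k + 4 \<le> r \<Longrightarrow> poly_integral (p * monom 1 k) = 0"
  shows "p = 0"
proof -
  let ?p2 = "pderiv (pderiv p)"
  let ?p3 = "pderiv ?p2"
  let ?p4 = "pderiv ?p3"
  have "?p4 = 0 \<or> degree ?p4 + Suc (Suc (Suc (Suc 0))) \<le> r"
    by (intro degree_pderiv_plus) (use deg in simp)
  then have "?p4 = 0 \<or> degree ?p4 + 4 \<le> r" by auto
  then have "poly_integral (p * ?p4) = 0"
    by (intro poly_integral_orthogonal[OF orth])
  \<comment> \<open>Both integrations by parts in one identity; the polynomial under the outer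
    derivative vanishes at 0 and 1 because p and p' do.\<close>
  moreover have "pderiv (p * ?p3 - pderiv p * ?p2) + ?p2 * ?p2 = p * ?p4"
    by (simp add: pderiv_mult pderiv_diff algebra_simps)
  moreover have "poly_integral (pderiv (p * ?p3 - pderiv p * ?p2)) = 0"
    using ends by (simp add: poly_integral_pderiv)
  ultimately have "poly_integral (?p2 * ?p2) = 0"
    by (metis add_0 poly_integral_add)
  then have "?p2 = 0" by (rule poly_integral_square_eq_0)
  then have "pderiv p = 0" using ends(2) by (rule pderiv_eq_0_imp_zero)
  then show ?thesis using ends(1) by (rule pderiv_eq_0_imp_zero)
qed

lemma degree_le_2_coeffs:
  assumes "degree p \<le> 2"
  obtains a b c :: real where "p = [:a, b, c:]"
proof
  show "p = [:coeff p 0, coeff p 1, coeff p 2:]"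
  proof (rule poly_eqI)
    fix n show "coeff p n = coeff [:coeff p 0, coeff p 1, coeff p 2:] n"
    proof (cases "n \<le> 2")
      case True
      then have "n = 0 \<or> n = 1 \<or> n = 2" by linarith
      then show ?thesis by (auto simp: numeral_2_eq_2)
    next
      case False
      then have "coeff p n = 0" using assms by (intro coeff_eq_0) simp
      moreover have "degree [:coeff p 0, coeff p 1, coeff p 2:] \<le> 2" by (simp)
      then have "coeff [:coeff p 0, coeff p 1, coeff p 2:] n = 0" using False by (intro coeff_eq_0) linarith
      ultimately show ?thesis by simp
    qed
  qed
qed

text \<open>The case r = 2 on a split side. The halves have relative lengths \<mu> and \<nu>, and D
  is the common tangential derivative at the split point. The double zeros leave c s^2 and c (1 -
  s)^2, whose slopes 2c and -2c cannot both be positive multiples of D unless c = 0.\<close>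

lemma quadratic_C1_zero_ends:
  fixes p q :: "real poly"
  assumes "degree p \<le> 2" "degree q \<le> 2"
    and "poly p 0 = 0" "poly (pderiv p) 0 = 0" "poly q 1 = 0" "poly (pderiv q) 1 = 0"
    and "poly p 1 = poly q 0" "poly (pderiv p) 1 = \<mu> * D" "poly (pderiv q) 0 = \<nu> * D" "0 < \<mu>" "0 < \<nu>"
  shows "p = 0 \<and> q = 0"
proof -
  obtain a b c where p: "p = [:a, b, c:]" using degree_le_2_coeffs[OF assms(1)] .
  obtain a' b' c' where q: "q = [:a', b', c':]" using degree_le_2_coeffs[OF assms(2)] .
  have 1: "a = 0" "b = 0" "c = a'" using assms(3,4,7) unfolding p q by (simp_all add: pderiv_pCons)
  have 2: "b' = - 2 * a'" "c' = a'" using assms(5,6) unfolding q by (simp_all add: pderiv_pCons)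
  have 3: "2 * a' = \<mu> * D" "- 2 * a' = \<nu> * D" using assms(8,9) 1 2 unfolding p q by (simp_all add: pderiv_pCons)
  then have "(\<mu> + \<nu>) * D = 0" by (simp add: algebra_simps)
  then have "D = 0" using assms(10,11) by simp
  then show ?thesis using 1 2 3 by (simp add: p q)
qed

text \<open>Testing with the second derivatives: the boundary terms at the common end have opposite signs.\<close>

lemma C1_pair_orthogonal:
  fixes p q :: "real poly"
  assumes "degree p + 1 \<le> r" "degree q + 1 \<le> r"
    and "poly p 0 = 0" "poly q 1 = 0" "poly p 1 = poly q 0"
    and "poly (pderiv p) 1 = \<mu> * D" "poly (pderiv q) 0 = \<nu> * D" "0 < \<mu>" "0 < \<nu>"
    and orth: "\<And>k. k + 3 \<le> r \<Longrightarrow> poly_integral (p * monom 1 k) = 0"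
      "\<And>k. k + 3 \<le> r \<Longrightarrow> poly_integral (q * monom 1 k) = 0"
  shows "p = 0 \<and> q = 0"
proof -
  have parts: "poly_integral (pderiv g * pderiv g) = poly (g * pderiv g) 1 - poly (g * pderiv g) 0"
    if "degree g + 1 \<le> r" "\<And>k. k + 3 \<le> r \<Longrightarrow> poly_integral (g * monom 1 k) = 0" for g
  proof -
    have "pderiv (pderiv g) = 0 \<or> degree (pderiv (pderiv g)) + Suc (Suc 1) \<le> r"
      by (intro degree_pderiv_plus) (use that(1) in simp)
    then have "pderiv (pderiv g) = 0 \<or> degree (pderiv (pderiv g)) + 3 \<le> r" by auto
    then have "poly_integral (g * pderiv (pderiv g)) = 0"
      by (intro poly_integral_orthogonal[OF that(2)])
    moreover have "pderiv (g * pderiv g) = g * pderiv (pderiv g) + pderiv g * pderiv g"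
      by (simp add: pderiv_mult)
    ultimately show ?thesis
      using poly_integral_pderiv[of "g * pderiv g"] by (simp add: poly_integral_add)
  qed
  have P: "poly_integral (pderiv p * pderiv p) = \<mu> * (poly q 0 * D)"
    using parts[OF assms(1) orth(1)] assms by simp
  have Q: "poly_integral (pderiv q * pderiv q) = - (\<nu> * (poly q 0 * D))"
    using parts[OF assms(2) orth(2)] assms by simp
  have "poly q 0 * D \<ge> 0"
    using P poly_integral_square_nonneg[of "pderiv p"] assms(8) by (simp add: zero_le_mult_iff)
  moreover have "poly q 0 * D \<le> 0"
    using Q poly_integral_square_nonneg[of "pderiv q"] assms(9) by (simp add: mult_le_0_iff)
  ultimately have "poly q 0 * D = 0" by linarith
  then have "pderiv p = 0" "pderiv q = 0" using P Q by (auto intro!: poly_integral_square_eq_0)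
  then show ?thesis using pderiv_eq_0_imp_zero assms(3,4) by blast
qed

text \<open>The parameter runs over the unit interval instead of arc length;
  \<open>edge_integral\<close> carries the additional factor \<open>dist a b\<close>.\<close>

definition moment :: "nat \<Rightarrow> real^2 \<Rightarrow> real^2 \<Rightarrow> (real^2 \<Rightarrow> real) \<Rightarrow> real" where
  "moment k a b f = integral {0..1} (\<lambda>s. f (linepath a b s) * s ^ k)"

lemma linepath_eq: "linepath a b s = a + s *\<^sub>R (b - a)"
  by (simp add: linepath_def algebra_simps)

lemma moment_eq_poly_integral:
  assumes "\<And>s. poly p s = f (a + s *\<^sub>R (b - a))"
  shows "moment k a b f = poly_integral (p * monom 1 k)"
proof -
  have "poly (p * monom 1 k) = (\<lambda>s. f (linepath a b s) * s ^ k)"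
    by (simp add: fun_eq_iff assms poly_monom linepath_eq)
  then show ?thesis unfolding moment_def poly_integral_def by simp
qed

lemma dderiv_scaleR:
  assumes "polyfun r f"
  shows "dderiv (c *\<^sub>R v) f = (\<lambda>x. c * dderiv v f x)"
  using dderiv_linear[OF assms, of c v 0 0] by (intro ext) simp

text \<open>A polynomial that vanishes on a segment vanishes on the whole line, so the derivative
  along it is zero at the endpoints too, where second derivatives are needed below.\<close>

lemma dderiv_eq_0_if_segment:
  assumes "polyfun r f" "\<And>x. x \<in> closed_segment a (a + v) \<Longrightarrow> f x = 0" "0 \<le> s" "s \<le> 1"
  shows "dderiv v f (a + s *\<^sub>R v) = 0"
proof -
  obtain p where p: "\<And>s. poly p s = f (a + s *\<^sub>R v)" using polyfun_line[OF assms(1)] by metis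
  have "p = 0"
  proof (rule poly_eq_0_on_unit_interval)
    fix s :: real assume "0 \<le> s" "s \<le> 1"
    then have "a + s *\<^sub>R v \<in> closed_segment a (a + v)"
      unfolding in_segment by (intro exI[of _ s]) (simp add: algebra_simps)
    then show "poly p s = 0" using p assms(2) by simp
  qed
  then show ?thesis using poly_pderiv_line[OF assms(1) p, of s] by simp
qed

text \<open>Two polynomials that agree to first order along the segment from \<open>m\<close> to \<open>p\<close> and vanish
  on the collinear segments \<open>[a, m]\<close> and \<open>[m, b]\<close> have the same mixed second derivatives at \<open>m\<close>,
  so that the normal derivative is continuously differentiable along \<open>[a, b]\<close> at \<open>m\<close>.\<close>

lemma split_edge_vanish:
  fixes a b m p n :: "real^2"
  assumes P: "polyfun r P" and Q: "polyfun r Q" and r: "2 \<le> r"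
    and m: "m = (1 - \<mu>) *\<^sub>R a + \<mu> *\<^sub>R b" "0 < \<mu>" "\<mu> < 1"
    and agree: "\<And>x. x \<in> closed_segment p m \<Longrightarrow> P x = Q x"
      "\<And>x v. x \<in> closed_segment p m \<Longrightarrow> dderiv v P x = dderiv v Q x"
    and cr: "cross2 (b - a) (p - m) \<noteq> 0" "cross2 (b - a) n \<noteq> 0"
    and ends: "P a = 0" "\<And>v. dderiv v P a = 0" "Q b = 0" "\<And>v. dderiv v Q b = 0"
    and mid: "3 \<le> r \<Longrightarrow> P m = 0" "3 \<le> r \<Longrightarrow> dderiv (b - a) P m = 0"
    and mn: "\<And>k. k + 3 \<le> r \<Longrightarrow> moment k a m (dderiv n P) = 0"
      "\<And>k. k + 3 \<le> r \<Longrightarrow> moment k m b (dderiv n Q) = 0"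
    and mv: "\<And>k. k + 4 \<le> r \<Longrightarrow> moment k a m P = 0"
      "\<And>k. k + 4 \<le> r \<Longrightarrow> moment k m b Q = 0"
  shows "\<And>x. x \<in> closed_segment a m \<Longrightarrow> P x = 0" "\<And>x v. x \<in> closed_segment a m \<Longrightarrow> dderiv v P x = 0"
    "\<And>x. x \<in> closed_segment m b \<Longrightarrow> Q x = 0" "\<And>x v. x \<in> closed_segment m b \<Longrightarrow> dderiv v Q x = 0"
proof -
  define t where "t = b - a"
  have d: "m - a = \<mu> *\<^sub>R t" "b - m = (1 - \<mu>) *\<^sub>R t"
    unfolding m(1) t_def by (simp_all add: algebra_simps)
  have mm: "m \<in> closed_segment p m" by simp
  have seg: "\<exists>s. 0 \<le> s \<and> s \<le> 1 \<and> x = c + s *\<^sub>R (e - c)" if "x \<in> closed_segment c e" for x c e :: "real^2"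
    using that unfolding in_segment by (auto simp: algebra_simps)
  obtain f1 where f1: "degree f1 \<le> r" "\<And>s. poly f1 s = P (a + s *\<^sub>R (m - a))"
    using polyfun_line[OF P] by metis
  obtain f2 where f2: "degree f2 \<le> r" "\<And>s. poly f2 s = Q (m + s *\<^sub>R (b - m))"
    using polyfun_line[OF Q] by metis
  note f1' = poly_pderiv_line[OF P f1(2)] and f2' = poly_pderiv_line[OF Q f2(2)]
  have e1: "poly f1 0 = 0" "poly (pderiv f1) 0 = 0" "poly f1 1 = P m" "poly (pderiv f1) 1 = \<mu> * dderiv t P m"
    using ends by (simp_all add: f1(2) f1') (simp add: d dderiv_scaleR[OF P])
  have e2: "poly f2 1 = 0" "poly (pderiv f2) 1 = 0" "poly f2 0 = P m" "poly (pderiv f2) 0 = (1 - \<mu>) * dderiv t P m"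
    using ends agree[OF mm] by (simp_all add: f2(2) f2') (simp add: d dderiv_scaleR[OF Q])
  have f0: "f1 = 0 \<and> f2 = 0"
  proof (cases "3 \<le> r")
    case True
    have "f1 = 0"
      using e1 mid[OF True] moment_eq_poly_integral[of f1 P, OF f1(2)] mv(1)
      by (intro double_zero_ends_orthogonal[OF f1(1)]) (simp_all add: t_def)
    moreover have "f2 = 0"
      using e2 mid[OF True] moment_eq_poly_integral[of f2 Q, OF f2(2)] mv(2)
      by (intro double_zero_ends_orthogonal[OF f2(1)]) (simp_all add: t_def)
    ultimately show ?thesis by simp
  next
    case False
    \<comment> \<open>No values at the split point are prescribed in this degree; the C^1 condition
      there takes their place.\<close>
    then have "r = 2" using r by simp
    then show ?thesis
      using f1(1) f2(1) e1 e2 m by (intro quadratic_C1_zero_ends[of f1 f2 \<mu> "dderiv t P m" "1 - \<mu>"]) simp_all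
  qed
  show P0: "P x = 0" if "x \<in> closed_segment a m" for x
    using seg[OF that] f1(2) f0 by force
  show Q0: "Q x = 0" if "x \<in> closed_segment m b" for x
    using seg[OF that] f2(2) f0 by force
  have tP: "dderiv t P x = 0" if x: "x \<in> closed_segment a m" for x
  proof -
    obtain s where "x = a + s *\<^sub>R (m - a)" using seg[OF x] by blast
    then have "dderiv (m - a) P x = 0" using f1'[of s] f0 by simp
    then show ?thesis using m(2) by (simp add: d dderiv_scaleR[OF P])
  qed
  have tQ: "dderiv t Q x = 0" if x: "x \<in> closed_segment m b" for x
  proof -
    obtain s where "x = m + s *\<^sub>R (b - m)" using seg[OF x] by blast
    then have "dderiv (b - m) Q x = 0" using f2'[of s] f0 by simp
    then show ?thesis using m(3) by (simp add: d dderiv_scaleR[OF Q])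
  qed
  \<comment> \<open>The jump across the interior edge. Its first derivatives vanish along that edge,
    hence so do their derivatives in the direction p - m.\<close>
  define J where "J = (\<lambda>x. Q x - P x)"
  have J: "polyfun r J" unfolding J_def by (rule polyfun_diff[OF Q P])
  have dJ: "dderiv v J = (\<lambda>x. dderiv v Q x - dderiv v P x)" for v
    unfolding J_def by (rule dderiv_diff[OF Q P])
  have vJ: "dderiv (p - m) (dderiv w J) m = 0" for w
    using dderiv_eq_0_if_segment[OF polyfun_dderiv[OF J], of m "p - m" w 0] agree
    by (simp add: dJ closed_segment_commute)
  have ttP: "dderiv t (dderiv t P) m = 0"
  proof -
    have "dderiv (m - a) (dderiv t P) (a + 1 *\<^sub>R (m - a)) = 0"
      by (rule dderiv_eq_0_if_segment[OF polyfun_dderiv[OF P]]) (simp_all add: tP)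
    then show ?thesis using m(2) by (simp add: d dderiv_scaleR[OF polyfun_dderiv[OF P]])
      (simp add: d[symmetric])
  qed
  have ttQ: "dderiv t (dderiv t Q) m = 0"
  proof -
    have "dderiv (b - m) (dderiv t Q) (m + 0 *\<^sub>R (b - m)) = 0"
      by (rule dderiv_eq_0_if_segment[OF polyfun_dderiv[OF Q]]) (simp_all add: tQ)
    then show ?thesis using m(3) by (simp add: d dderiv_scaleR[OF polyfun_dderiv[OF Q]])
  qed
  have dd_J: "dderiv v (dderiv w J) m = dderiv v (dderiv w Q) m - dderiv v (dderiv w P) m" for v w
    unfolding dJ[of w] dderiv_diff[OF polyfun_dderiv[OF Q] polyfun_dderiv[OF P]] by simp
  \<comment> \<open>In the mixed derivative of the jump along t and n, the t-part is zero because
    both pieces vanish along the side, and the (p - m)-part is zero by \<open>vJ\<close>.\<close>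
  obtain \<alpha> \<beta> where n: "n = \<alpha> *\<^sub>R t + \<beta> *\<^sub>R (p - m)"
    using cross2_basis[OF cr(1), of n] unfolding t_def by blast
  have "dderiv n J = (\<lambda>x. \<alpha> * dderiv t J x + \<beta> * dderiv (p - m) J x)"
    unfolding n by (rule ext, rule dderiv_linear[OF J])
  then have "dderiv t (dderiv n J) m = \<alpha> * dderiv t (dderiv t J) m + \<beta> * dderiv t (dderiv (p - m) J) m"
    using dderiv_add[OF polyfun_cmult[OF polyfun_dderiv[OF J]] polyfun_cmult[OF polyfun_dderiv[OF J]]]
      dderiv_cmult[OF polyfun_dderiv[OF J]] by simp
  moreover have "dderiv t (dderiv (p - m) J) m = 0"
    using vJ[of t] dderiv_commute[OF J, of t "p - m"] by simp
  ultimately have tn: "dderiv t (dderiv n P) m = dderiv t (dderiv n Q) m"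
    using ttP ttQ by (simp add: dd_J)
  have nP: "polyfun (r - 1) (dderiv n P)" and nQ: "polyfun (r - 1) (dderiv n Q)"
    by (intro polyfun_dderiv P Q)+
  obtain g1 where g1: "degree g1 \<le> r - 1" "\<And>s. poly g1 s = dderiv n P (a + s *\<^sub>R (m - a))"
    using polyfun_line[OF nP] by metis
  obtain g2 where g2: "degree g2 \<le> r - 1" "\<And>s. poly g2 s = dderiv n Q (m + s *\<^sub>R (b - m))"
    using polyfun_line[OF nQ] by metis
  note g1' = poly_pderiv_line[OF nP g1(2)] and g2' = poly_pderiv_line[OF nQ g2(2)]
  have "g1 = 0 \<and> g2 = 0"
  proof (rule C1_pair_orthogonal)
    show "poly (pderiv g1) 1 = \<mu> * dderiv t (dderiv n P) m"
      by (simp add: g1') (simp add: d dderiv_scaleR[OF nP])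
    show "poly (pderiv g2) 0 = (1 - \<mu>) * dderiv t (dderiv n P) m"
      by (simp add: g2' tn) (simp add: d dderiv_scaleR[OF nQ])
    show "poly_integral (g1 * monom 1 k) = 0" if "k + 3 \<le> r" for k
      using moment_eq_poly_integral[of g1 "dderiv n P", OF g1(2)] mn(1)[OF that] by simp
    show "poly_integral (g2 * monom 1 k) = 0" if "k + 3 \<le> r" for k
      using moment_eq_poly_integral[of g2 "dderiv n Q", OF g2(2)] mn(2)[OF that] by simp
  qed (use g1 g2 r ends agree[OF mm] m in \<open>simp_all\<close>)
  then have nP0: "dderiv n P x = 0" if "x \<in> closed_segment a m" for x
    using seg[OF that] g1(2) by force
  have nQ0: "dderiv n Q x = 0" if "x \<in> closed_segment m b" for x
    using seg[OF that] g2(2) \<open>g1 = 0 \<and> g2 = 0\<close> by force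
  have v: "\<exists>\<alpha> \<beta>. v = \<alpha> *\<^sub>R t + \<beta> *\<^sub>R n" for v
    using cross2_basis[OF cr(2)] unfolding t_def .
  show "dderiv v P x = 0" if x: "x \<in> closed_segment a m" for x v
    using v[of v] dderiv_linear[OF P] tP[OF x] nP0[OF x] by force
  show "dderiv v Q x = 0" if x: "x \<in> closed_segment m b" for x v
    using v[of v] dderiv_linear[OF Q] tQ[OF x] nQ0[OF x] by force
qed

lemma moment_cong:
  assumes "\<And>x. x \<in> closed_segment a b \<Longrightarrow> f x = g x"
  shows "moment k a b f = moment k a b g"
  unfolding moment_def
proof (rule integral_cong)
  fix s :: real assume "s \<in> {0..1}"
  then have "linepath a b s \<in> closed_segment a b" by (rule linepath_in_path)
  then show "f (linepath a b s) * s ^ k = g (linepath a b s) * s ^ k" using assms by simp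
qed

section \<open>The boundary functionals of the split\<close>

context powell_sabin
begin

abbreviation edge_moment :: "nat \<Rightarrow> nat \<Rightarrow> (real^2 \<Rightarrow> real) \<Rightarrow> real" where
  "edge_moment k j \<equiv> moment k (node j) (node (Suc j))"

abbreviation side_vec :: "nat \<Rightarrow> real^2" where
  "side_vec s \<equiv> node (2 * s + 2) - node (2 * s)"

text \<open>Side s has the nodes 2s, 2s + 1, 2s + 2 and contains the edges j with j div 2 = s. The
  normals are replaced by arbitrary directions \<nu>, and moments against all polynomials by those
  against powers of the parameter. Coinciding functionals collapse in the set, which agrees with its
  use in upper bounds.\<close>

definition boundary_dofs :: "(nat \<Rightarrow> real^2) \<Rightarrow> nat \<Rightarrow> ((real^2 \<Rightarrow> real) \<Rightarrow> real) set" where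
  "boundary_dofs \<nu> r =
     (\<lambda>s q. q (node (2 * s))) ` {..<3} \<union>
     (\<lambda>(s, v) q. grad q (node (2 * s)) \<bullet> v) ` ({..<3} \<times> {axis 1 1, axis 2 1}) \<union>
     (if 3 \<le> r then (\<lambda>s q. q (node (2 * s + 1))) ` {..<3} \<union>
        (\<lambda>s q. grad q (node (2 * s + 1)) \<bullet> (side_vec s)) ` {..<3} else {}) \<union>
     (\<lambda>(j, k) q. edge_moment k j (\<lambda>x. grad q x \<bullet> \<nu> (j div 2))) ` ({..<6} \<times> {..<r - 2}) \<union>
     (\<lambda>(j, k) q. edge_moment k j q) ` ({..<6} \<times> {..<r - 3})"

lemma boundary_dofs_zero_iff:
  "(\<forall>f\<in>boundary_dofs \<nu> r. f q = 0) \<longleftrightarrow>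
     (\<forall>s<3. q (node (2 * s)) = 0 \<and> grad q (node (2 * s)) \<bullet> axis 1 1 = 0
        \<and> grad q (node (2 * s)) \<bullet> axis 2 1 = 0) \<and>
     (3 \<le> r \<longrightarrow> (\<forall>s<3. q (node (2 * s + 1)) = 0
        \<and> grad q (node (2 * s + 1)) \<bullet> (side_vec s) = 0)) \<and>
     (\<forall>j<6. \<forall>k<r - 2. edge_moment k j (\<lambda>x. grad q x \<bullet> \<nu> (j div 2)) = 0) \<and>
     (\<forall>j<6. \<forall>k<r - 3. edge_moment k j q = 0)"
  unfolding boundary_dofs_def by (cases "3 \<le> r") (simp_all add: ball_Un, blast+)

lemma card_boundary_dofs:
  "finite (boundary_dofs \<nu> r)"
  "card (boundary_dofs \<nu> r) \<le> 9 + (if 3 \<le> r then 6 else 0) + 6 * (r - 2) + 6 * (r - 3)"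
proof -
  show "finite (boundary_dofs \<nu> r)" unfolding boundary_dofs_def by simp
  have c: "card (f ` A) \<le> n" if "finite A" "card A \<le> n" for f :: "'b \<Rightarrow> 'c" and A n
    using card_image_le[OF that(1)] that(2) by (rule order_trans)
  have u: "card (A \<union> B) \<le> m + n" if "card A \<le> m" "card B \<le> n" for A B :: "'c set" and m n
    using card_Un_le[of A B] that by linarith
  have "card (boundary_dofs \<nu> r) \<le> 3 + 3 * 2 + (if 3 \<le> r then 3 + 3 else 0) + 6 * (r - 2) + 6 * (r - 3)"
    unfolding boundary_dofs_def
    by (cases "3 \<le> r"; simp only: if_True if_False; intro u c; simp add: card_cartesian_product card_insert_if)
  then show "card (boundary_dofs \<nu> r) \<le> 9 + (if 3 \<le> r then 6 else 0) + 6 * (r - 2) + 6 * (r - 3)"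
    by (simp split: if_splits)
qed

lemma less_3_cases: "(s::nat) < 3 \<Longrightarrow> (s = 0 \<Longrightarrow> P) \<Longrightarrow> (s = 1 \<Longrightarrow> P) \<Longrightarrow> (s = 2 \<Longrightarrow> P) \<Longrightarrow> P"
  by linarith

lemma side:
  assumes "s < 3"
  shows "node (2 * s + 1) \<in> open_segment (node (2 * s)) (node (2 * s + 2))"
    and "cross2 (node (2 * s) - z 0) (node (2 * s + 2) - z 0) > 0"
  using assms midpoints macro_cross by (elim less_3_cases; simp add: node_def del: cross2_linear)+

lemma edge_in_T: "j < 6 \<Longrightarrow> edge j \<subseteq> T"
  using edge_subset_tri tri_subset_T by blast

lemma node_in_T: "j < 6 \<Longrightarrow> node j \<in> T" "j < 6 \<Longrightarrow> node (Suc j) \<in> T"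
  using edge_in_T by auto

lemma vector2_expand: "(v::real^2) = v $ 1 *\<^sub>R axis 1 1 + v $ 2 *\<^sub>R axis 2 1"
  by (simp add: vec_eq_iff forall_2 axis_def)

text \<open>\<open>split_edge_vanish\<close> is applied to each side with p = \<open>z 0\<close>.
  Directions \<nu> merely transverse to the sides cover both the unit normals and the choice made
  for the dimension bound.\<close>

lemma boundary_dofs_imp_ps_S0:
  assumes q: "q \<in> splines r" and r: "2 \<le> r"
    and \<nu>: "\<And>s. s < 3 \<Longrightarrow> cross2 (side_vec s) (\<nu> s) \<noteq> 0"
    and "\<forall>f\<in>boundary_dofs \<nu> r. f q = 0"
  shows "q \<in> splines0 r"
proof -
  note dofs = assms(4)[unfolded boundary_dofs_zero_iff]
  obtain P where P: "pieces r q P" using ps_S_pieces q by blast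
  have v0: "q (node (2 * s)) = 0" "grad q (node (2 * s)) \<bullet> v = 0" if s: "s < 3" for s v
  proof -
    show "q (node (2 * s)) = 0" using dofs s by blast
    have "grad q (node (2 * s)) \<bullet> axis 1 1 = 0" "grad q (node (2 * s)) \<bullet> axis 2 1 = 0"
      using dofs s by blast+
    then show "grad q (node (2 * s)) \<bullet> v = 0"
      by (subst vector2_expand) (simp add: inner_add_right)
  qed
  have v1: "q (node (2 * s + 2)) = 0" "grad q (node (2 * s + 2)) \<bullet> v = 0" if s: "s < 3" for s v
  proof -
    \<comment> \<open>The last side closes the boundary: node 6 is node 0 again.\<close>
    have "node (2 * s + 2) = node (2 * ((s + 1) mod 3))"
      using s by (elim less_3_cases) (simp_all add: node_def)
    moreover have "(s + 1) mod 3 < 3" by simp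
    ultimately show "q (node (2 * s + 2)) = 0" "grad q (node (2 * s + 2)) \<bullet> v = 0"
      using v0 by metis+
  qed
  have edge: "\<forall>j\<in>{2 * s, 2 * s + 1}. \<forall>x\<in>edge j. q x = 0 \<and> (\<forall>v. grad q x \<bullet> v = 0)"
    if s: "s < 3" for s
  proof -
    define a where "a = node (2 * s)"
    define b where "b = node (2 * s + 2)"
    define m where "m = node (2 * s + 1)"
    have nodes: "node (Suc (2 * s)) = m" "node (Suc (2 * s + 1)) = b" "node (2 * s + 1) = m"
      by (simp_all add: a_def b_def m_def)
    have j: "2 * s < 6" "2 * s + 1 < 6" using s by auto
    obtain \<mu> where \<mu>: "m = (1 - \<mu>) *\<^sub>R a + \<mu> *\<^sub>R b" "0 < \<mu>" "\<mu> < 1"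
      using side(1)[OF s] unfolding a_def b_def m_def in_segment by blast
    \<comment> \<open>Twice the area of the large triangle over this side, wherever m lies on it;
      hence the interior edge is transverse to the side.\<close>
    have cr: "cross2 (b - a) (z 0 - m) = cross2 (a - z 0) (b - z 0)"
      unfolding \<mu>(1) cross2_def by (simp add: algebra_simps)
    have pP: "polyfun r (P (2 * s))" "polyfun r (P (2 * s + 1))" using piecesD(1)[OF P] j by auto
    have segs: "closed_segment a m \<subseteq> tri (2 * s)" "closed_segment m b \<subseteq> tri (2 * s + 1)"
      "closed_segment (z 0) m \<subseteq> tri (2 * s)" "closed_segment (z 0) m \<subseteq> tri (2 * s + 1)"
      using edge_subset_tri[of "2 * s"] edge_subset_tri[of "2 * s + 1"]
        right_ray_subset_tri[of "2 * s"] left_ray_subset_tri[of "2 * s + 1"]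
      unfolding nodes by (simp_all add: a_def)
    note E1 = piecesD(2,3)[OF P j(1)] and E2 = piecesD(2,3)[OF P j(2)]
    note C = compatibleD[OF pieces_compatible[OF P] j]
    have M: "moment k a m (\<lambda>x. grad q x \<bullet> \<nu> s) = moment k a m (dderiv (\<nu> s) (P (2 * s)))"
      "moment k m b (\<lambda>x. grad q x \<bullet> \<nu> s) = moment k m b (dderiv (\<nu> s) (P (2 * s + 1)))"
      "moment k a m q = moment k a m (P (2 * s))" "moment k m b q = moment k m b (P (2 * s + 1))" for k
      using E1 E2 segs by (auto intro!: moment_cong)
    have ends: "a \<in> tri (2 * s)" "m \<in> tri (2 * s)" "b \<in> tri (2 * s + 1)"
      using segs by auto
    have mid: "P (2 * s) m = 0" "dderiv (b - a) (P (2 * s)) m = 0" if "3 \<le> r"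
    proof -
      have "q m = 0" "grad q m \<bullet> (b - a) = 0"
        using dofs s that unfolding a_def b_def m_def by blast+
      then show "P (2 * s) m = 0" "dderiv (b - a) (P (2 * s)) m = 0" using E1 ends by auto
    qed
    have dn: "moment k a m (\<lambda>x. grad q x \<bullet> \<nu> s) = 0" "moment k m b (\<lambda>x. grad q x \<bullet> \<nu> s) = 0"
      if "k + 3 \<le> r" for k
    proof -
      have "\<forall>j<6. \<forall>k<r - 2. edge_moment k j (\<lambda>x. grad q x \<bullet> \<nu> (j div 2)) = 0"
        using dofs by blast
      moreover have "k < r - 2" using that by linarith
      moreover have "2 * s div 2 = s" "(2 * s + 1) div 2 = s" by simp_all
      ultimately show "moment k a m (\<lambda>x. grad q x \<bullet> \<nu> s) = 0" "moment k m b (\<lambda>x. grad q x \<bullet> \<nu> s) = 0"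
        using j nodes unfolding a_def by metis+
    qed
    have dv: "moment k a m q = 0" "moment k m b q = 0" if "k + 4 \<le> r" for k
    proof -
      have "\<forall>j<6. \<forall>k<r - 3. edge_moment k j q = 0"
        using dofs by blast
      moreover have "k < r - 3" using that by linarith
      ultimately show "moment k a m q = 0" "moment k m b q = 0"
        using j nodes unfolding a_def by metis+
    qed
    have vanish: "\<forall>x\<in>closed_segment a m. P (2 * s) x = 0 \<and> (\<forall>v. dderiv v (P (2 * s)) x = 0)"
      "\<forall>x\<in>closed_segment m b. P (2 * s + 1) x = 0 \<and> (\<forall>v. dderiv v (P (2 * s + 1)) x = 0)"
    proof -
      note L = split_edge_vanish[OF pP r \<mu>, of "z 0" "\<nu> s"]
      have agree: "P (2 * s) x = P (2 * s + 1) x" "dderiv v (P (2 * s)) x = dderiv v (P (2 * s + 1)) x"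
        if "x \<in> closed_segment (z 0) m" for x v
        using C(1)[of x] C(2)[of x v] that segs by blast+
      have c1: "cross2 (b - a) (z 0 - m) \<noteq> 0" using cr side(2)[OF s] by (simp add: a_def b_def)
      have c2: "cross2 (b - a) (\<nu> s) \<noteq> 0" using \<nu>[OF s] by (simp add: a_def b_def)
      have e: "P (2 * s) a = 0" "dderiv v (P (2 * s)) a = 0" "P (2 * s + 1) b = 0" "dderiv v (P (2 * s + 1)) b = 0" for v
        using v0[OF s] v1[OF s] E1(1)[OF ends(1)] E1(2)[OF ends(1)] E2(1)[OF ends(3)] E2(2)[OF ends(3)]
        by (simp_all add: a_def b_def)
      note L' = L[OF agree c1 c2 e mid dn[unfolded M] dv[unfolded M]]
      show "\<forall>x\<in>closed_segment a m. P (2 * s) x = 0 \<and> (\<forall>v. dderiv v (P (2 * s)) x = 0)"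
        using L'(1,2) by blast
      show "\<forall>x\<in>closed_segment m b. P (2 * s + 1) x = 0 \<and> (\<forall>v. dderiv v (P (2 * s + 1)) x = 0)"
        using L'(3,4) by blast
    qed
    show ?thesis
    proof (intro ballI)
      fix j x assume jj: "j \<in> {2 * s, 2 * s + 1}" and x: "x \<in> edge j"
      consider "j = 2 * s" | "j = 2 * s + 1" using jj by blast
      then show "q x = 0 \<and> (\<forall>v. grad q x \<bullet> v = 0)"
      proof cases
        case 1
        then have "x \<in> closed_segment a m" using x nodes by (simp add: a_def)
        then have xt: "x \<in> tri (2 * s)" using segs by blast
        show ?thesis unfolding E1(1)[OF xt] E1(2)[OF xt] using vanish(1) \<open>x \<in> closed_segment a m\<close> by blast
      next
        case 2
        then have "x \<in> closed_segment m b" using x nodes by simp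
        then have xt: "x \<in> tri (2 * s + 1)" using segs by blast
        show ?thesis unfolding E2(1)[OF xt] E2(2)[OF xt] using vanish(2) \<open>x \<in> closed_segment m b\<close> by blast
      qed
    qed
  qed
  have "q x = 0 \<and> (\<forall>v. grad q x \<bullet> v = 0)" if x: "x \<in> frontier T" for x
  proof -
    obtain j where j: "j < 6" "x \<in> edge j"
      using x unfolding frontier_T by blast
    have "j div 2 < 3" "j \<in> {2 * (j div 2), 2 * (j div 2) + 1}" using j(1) by auto
    then show ?thesis using edge j(2) by blast
  qed
  then show ?thesis using q unfolding mem_ps_S0' by blast
qed

lemma continuous_grad_inner:
  assumes q: "q \<in> splines r" and j: "j < 6"
  shows "continuous_on (edge j) (\<lambda>x. grad q x \<bullet> v)"
proof -
  obtain P where P: "pieces r q P" using ps_S_pieces q by blast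
  have "continuous_on (edge j) (dderiv v (P j))"
    using polyfun_continuous_on polyfun_dderiv piecesD(1)[OF P j] by blast
  then show ?thesis
    by (rule continuous_on_eq) (use piecesD(3)[OF P j, of _ v] edge_subset_tri[of j] in \<open>auto simp: subset_iff\<close>)
qed

lemma moment_integrable:
  assumes "continuous_on (closed_segment a b) f"
  shows "(\<lambda>s. f (linepath a b s) * s ^ k) integrable_on {0..1}"
proof (rule integrable_continuous_real)
  have "continuous_on {0..1} (\<lambda>s. f (linepath a b s))"
    by (rule continuous_on_compose2[OF assms continuous_on_linepath]) (auto intro: linepath_in_path)
  then show "continuous_on {0..1} (\<lambda>s. f (linepath a b s) * s ^ k)"
    by (intro continuous_intros)
qed

lemma moment_add:
  assumes "continuous_on (closed_segment a b) f" "continuous_on (closed_segment a b) g"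
  shows "moment k a b (\<lambda>x. f x + g x) = moment k a b f + moment k a b g"
  unfolding moment_def distrib_right
  by (rule integral_add) (intro moment_integrable assms)+

lemma moment_cmult: "moment k a b (\<lambda>x. c * f x) = c * moment k a b f"
  unfolding moment_def by (simp add: mult.assoc)

lemma continuous_edge: "q \<in> ps_S k z \<Longrightarrow> j < 6 \<Longrightarrow> continuous_on (edge j) q"
  unfolding ps_S_def using edge_in_T continuous_on_subset by blast

lemma linear_fun_edge_moment:
  assumes lin: "\<And>x. x \<in> edge j \<Longrightarrow> fs.linear_fun_on U (\<lambda>q. F q x)"
    and cont: "\<And>q. q \<in> U \<Longrightarrow> continuous_on (edge j) (F q)"
  shows "fs.linear_fun_on U (\<lambda>q. edge_moment k j (F q))"
  unfolding fs.linear_fun_on_def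
proof (intro conjI ballI allI)
  fix p q assume pq: "p \<in> U" "q \<in> U"
  have "edge_moment k j (F (p + q)) = edge_moment k j (\<lambda>x. F p x + F q x)"
    by (rule moment_cong) (use lin pq in \<open>auto simp: fs.linear_fun_on_def\<close>)
  then show "edge_moment k j (F (p + q)) = edge_moment k j (F p) + edge_moment k j (F q)"
    using moment_add[OF cont[OF pq(1)] cont[OF pq(2)]] by simp
next
  fix c q assume q: "q \<in> U"
  have "edge_moment k j (F (fun_scale c q)) = edge_moment k j (\<lambda>x. c * F q x)"
    by (rule moment_cong) (use lin q in \<open>auto simp: fs.linear_fun_on_def\<close>)
  then show "edge_moment k j (F (fun_scale c q)) = c * edge_moment k j (F q)"
    by (simp add: moment_cmult)
qed

lemma linear_fun_moment: "j < 6 \<Longrightarrow> fs.linear_fun_on (splines r) (\<lambda>q. edge_moment k j q)"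
  using continuous_edge by (intro linear_fun_edge_moment linear_fun_eval) auto

lemma linear_fun_moment_grad:
  assumes "j < 6"
  shows "fs.linear_fun_on (splines r) (\<lambda>q. edge_moment k j (\<lambda>x. grad q x \<bullet> v))"
  using linear_fun_grad continuous_grad_inner assms edge_in_T[OF assms]
  by (intro linear_fun_edge_moment) auto

lemma linear_boundary_dofs:
  assumes "f \<in> boundary_dofs \<nu> r"
  shows "fs.linear_fun_on (splines r) f"
proof -
  have "node (2 * s) \<in> T" "node (2 * s + 1) \<in> T" if "s < 3" for s
    using that node_in_T[of "2 * s"] by auto
  then show ?thesis
    using assms unfolding boundary_dofs_def
    by (auto intro: linear_fun_eval linear_fun_moment linear_fun_moment_grad intro!: linear_fun_grad split: if_splits)
qed

lemma dim_ps_S_le: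
  assumes r: "2 \<le> r" and dim0: "fs.dim_upto (splines0 r) d"
  shows "fs.dim_upto (splines r) (d + (9 + (if 3 \<le> r then 6 else 0) + 6 * (r - 2) + 6 * (r - 3)))"
proof -
  \<comment> \<open>Any transverse direction serves for counting; the one from a vertex to the
    interior point is at hand.\<close>
  define \<nu> :: "nat \<Rightarrow> real^2" where "\<nu> s = z 0 - node (2 * s)" for s
  have "cross2 (side_vec s) (\<nu> s) \<noteq> 0" if "s < 3" for s
    using side(2)[OF that] by (simp add: \<nu>_def cross2_def algebra_simps)
  then have "{q \<in> splines r. \<forall>f\<in>boundary_dofs \<nu> r. f q = 0} \<subseteq> splines0 r"
    using boundary_dofs_imp_ps_S0[OF _ r] by blast
  then have "fs.dim_upto {q \<in> splines r. \<forall>f\<in>boundary_dofs \<nu> r. f q = 0} d"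
    using fs.dim_upto_mono[OF dim0] by blast
  then have "fs.dim_upto (splines r) (d + card (boundary_dofs \<nu> r))"
    using fs.dim_upto_kernel_family[OF card_boundary_dofs(1)[of \<nu> r] subspace_ps_S, where f = "\<lambda>f. f" and n = d]
      linear_boundary_dofs by blast
  then show ?thesis
    by (rule fs.dim_upto_mono) (use card_boundary_dofs(2) in simp_all)
qed

end

section \<open>Lowering the degree by two\<close>

text \<open>Used to separate homogeneous components along a ray, where the component of degree d
  contributes s^d times its value at the end.\<close>

lemma power_sum_coeffs_unique:
  fixes a b :: "nat \<Rightarrow> real"
  assumes "\<And>s. 0 \<le> s \<Longrightarrow> s \<le> 1 \<Longrightarrow> (\<Sum>d\<le>n. s ^ d * a d) = (\<Sum>d\<le>n. s ^ d * b d)" "d \<le> n"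
  shows "a d = b d"
proof -
  let ?p = "\<Sum>d\<le>n. monom (a d - b d) d"
  have "?p = 0"
  proof (rule poly_eq_0_on_unit_interval)
    fix s :: real assume "0 \<le> s" "s \<le> 1"
    from assms(1)[OF this] have "(\<Sum>d\<le>n. s ^ d * a d - s ^ d * b d) = 0" by (simp add: sum_subtractf)
    then show "poly ?p s = 0" by (simp add: poly_sum poly_monom algebra_simps)
  qed
  moreover have "coeff ?p d = a d - b d"
    using assms(2) by (simp add: coeff_sum sum.delta)
  ultimately show ?thesis by simp
qed

text \<open>The gradients vanish along the two sides at c, so the mixed derivatives along p - c and
  either side vanish for the piece at that side. The C^1 match along [p, c] transfers this from Q to
  P, and the two sides span the direction p - c.\<close>

lemma corner_second_derivative:
  fixes c p e e' :: "real^2"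
  assumes P: "polyfun r P" and Q: "polyfun r Q"
    and agree: "\<And>x v. x \<in> closed_segment p c \<Longrightarrow> dderiv v P x = dderiv v Q x"
    and zP: "\<And>x v. x \<in> closed_segment c e \<Longrightarrow> dderiv v P x = 0"
    and zQ: "\<And>x v. x \<in> closed_segment c e' \<Longrightarrow> dderiv v Q x = 0"
    and cr: "cross2 (e - c) (e' - c) \<noteq> 0"
  shows "dderiv (p - c) (dderiv (p - c) P) c = 0"
proof -
  define J where "J = (\<lambda>x. Q x - P x)"
  have J: "polyfun r J" unfolding J_def by (rule polyfun_diff[OF Q P])
  have dJ: "dderiv v J = (\<lambda>x. dderiv v Q x - dderiv v P x)" for v
    unfolding J_def by (rule dderiv_diff[OF Q P])
  have vJ: "dderiv (p - c) (dderiv w J) c = 0" for w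
    using dderiv_eq_0_if_segment[OF polyfun_dderiv[OF J], of c "p - c" w 0] agree
    by (simp add: dJ closed_segment_commute)
  have PQ: "dderiv (p - c) (dderiv w Q) c = dderiv (p - c) (dderiv w P) c" for w
    using vJ[of w] unfolding dJ[of w] dderiv_diff[OF polyfun_dderiv[OF Q] polyfun_dderiv[OF P]] by simp
  have "dderiv (e - c) (dderiv (p - c) P) (c + 0 *\<^sub>R (e - c)) = 0"
    by (rule dderiv_eq_0_if_segment[OF polyfun_dderiv[OF P]]) (simp_all add: zP)
  then have 1: "dderiv (p - c) (dderiv (e - c) P) c = 0"
    using dderiv_commute[OF P, of "p - c" "e - c"] by simp
  have "dderiv (e' - c) (dderiv (p - c) Q) (c + 0 *\<^sub>R (e' - c)) = 0"
    by (rule dderiv_eq_0_if_segment[OF polyfun_dderiv[OF Q]]) (simp_all add: zQ)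
  then have 2: "dderiv (p - c) (dderiv (e' - c) P) c = 0"
    using dderiv_commute[OF Q, of "p - c" "e' - c"] PQ[of "e' - c"] by simp
  obtain \<alpha> \<beta> where n: "p - c = \<alpha> *\<^sub>R (e - c) + \<beta> *\<^sub>R (e' - c)"
    using cross2_basis[OF cr] by blast
  define v where "v = p - c"
  have "dderiv v P = (\<lambda>x. \<alpha> * dderiv (e - c) P x + \<beta> * dderiv (e' - c) P x)"
    unfolding v_def n by (rule ext, rule dderiv_linear[OF P])
  then have "dderiv v (dderiv v P) c = \<alpha> * dderiv v (dderiv (e - c) P) c + \<beta> * dderiv v (dderiv (e' - c) P) c"
    using dderiv_add[OF polyfun_cmult[OF polyfun_dderiv[OF P]] polyfun_cmult[OF polyfun_dderiv[OF P]]]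
      dderiv_cmult[OF polyfun_dderiv[OF P]] by simp
  then show ?thesis using 1 2 unfolding v_def by simp
qed

lemma polyfun_1_affine:
  "polyfun r f \<Longrightarrow> r \<le> 1 \<Longrightarrow> \<exists>c v. f = (\<lambda>x. c + v \<bullet> x)"
proof (induction rule: polyfun.induct)
  case (polyfun_const r c)
  show ?case by (intro exI[of _ c] exI[of _ 0]) simp
next
  case (polyfun_add r f g)
  then obtain c v c' v' where "f = (\<lambda>x. c + v \<bullet> x)" "g = (\<lambda>x. c' + v' \<bullet> x)" by blast
  then show ?case by (intro exI[of _ "c + c'"] exI[of _ "v + v'"]) (simp add: inner_add_left fun_eq_iff)
next
  case (polyfun_mult r f u)
  then have "r = 0" by simp
  then obtain c where "f = (\<lambda>x. c)" using polyfun_0_const[OF polyfun_mult.hyps] by blast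
  then have "(\<lambda>x. (u \<bullet> x) * f x) = (\<lambda>x. 0 + (c *\<^sub>R u) \<bullet> x)" by (simp add: mult.commute)
  then show ?case by blast
qed

text \<open>\<open>(E - r) (E - (r - 1))\<close> for the Euler operator \<open>E\<close> centred at \<open>a\<close>: it multiplies the
  homogeneous component of degree \<open>d\<close> by \<open>(r - d) (r - 1 - d)\<close>, so it kills those of degree
  \<open>r\<close> and \<open>r - 1\<close>.\<close>

definition euler_op :: "'a::real_inner \<Rightarrow> ('a \<Rightarrow> real) \<Rightarrow> 'a \<Rightarrow> real" where
  "euler_op a f x = dderiv (x - a) f x"

definition lowering_op :: "'a::real_inner \<Rightarrow> nat \<Rightarrow> ('a \<Rightarrow> real) \<Rightarrow> 'a \<Rightarrow> real" where
  "lowering_op a r f x = euler_op a (euler_op a f) x - (2 * real r - 1) * euler_op a f x + real r * (real r - 1) * f x"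

definition lowering_weight :: "nat \<Rightarrow> nat \<Rightarrow> real" where
  "lowering_weight r d = (real r - real d) * (real r - 1 - real d)"

lemma euler_op_hompoly_sum:
  assumes "\<And>d. d \<le> r \<Longrightarrow> hompoly d (h d)"
  shows "euler_op a (\<lambda>x. \<Sum>d\<le>r. h d (x - a)) = (\<lambda>x. \<Sum>d\<le>r. real d * h d (x - a))"
  by (intro ext) (auto simp: euler_op_def dderiv_hompoly_sum_centered assms intro!: sum.cong hompoly_euler)

lemma lowering_op_hompoly_sum:
  assumes h: "\<And>d. hompoly d (h d)" and r: "2 \<le> r"
  shows "lowering_op a r (\<lambda>x. \<Sum>d\<le>r. h d (x - a)) = (\<lambda>x. \<Sum>d\<le>r - 2. lowering_weight r d * h d (x - a))"
proof
  fix x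
  have "euler_op a (\<lambda>x. \<Sum>d\<le>r. real d * h d (x - a)) = (\<lambda>x. \<Sum>d\<le>r. real d * (real d * h d (x - a)))"
    using euler_op_hompoly_sum[of r "\<lambda>d x. real d * h d x" a] hompoly_cmult[OF h] by simp
  then have "lowering_op a r (\<lambda>x. \<Sum>d\<le>r. h d (x - a)) x = (\<Sum>d\<le>r. real d * (real d * h d (x - a)))
      - (2 * real r - 1) * (\<Sum>d\<le>r. real d * h d (x - a)) + real r * (real r - 1) * (\<Sum>d\<le>r. h d (x - a))"
    using h by (simp add: lowering_op_def euler_op_hompoly_sum)
  also have "\<dots> = (\<Sum>d\<le>r. lowering_weight r d * h d (x - a))"
    unfolding sum_distrib_left sum_subtractf[symmetric] sum.distrib[symmetric]
    by (intro sum.cong refl) (simp add: lowering_weight_def algebra_simps)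
  also have "\<dots> = (\<Sum>d\<le>r - 2. lowering_weight r d * h d (x - a))"
  proof (rule sum.mono_neutral_right)
    show "\<forall>d\<in>{..r} - {..r - 2}. lowering_weight r d * h d (x - a) = 0"
    proof
      fix d assume "d \<in> {..r} - {..r - 2}"
      then have "d = r \<or> d + 1 = r" using r by auto
      then show "lowering_weight r d * h d (x - a) = 0" by (auto simp: lowering_weight_def)
    qed
  qed (use r in auto)
  finally show "lowering_op a r (\<lambda>x. \<Sum>d\<le>r. h d (x - a)) x = (\<Sum>d\<le>r - 2. lowering_weight r d * h d (x - a))" .
qed

lemma lowering_weight_nonzero: "d + 2 \<le> r \<Longrightarrow> lowering_weight r d \<noteq> 0"
  by (auto simp: lowering_weight_def)

lemma polyfun_euler_op:
  assumes "polyfun r f"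
  shows "polyfun r (euler_op a f)"
proof -
  obtain h where h: "\<forall>d. hompoly d (h d)" "f = (\<lambda>x. \<Sum>d\<le>r. h d (x - a))"
    using polyfun_hompoly_sum_centered[OF assms] by blast
  show ?thesis unfolding h(2) euler_op_hompoly_sum[OF h(1)[rule_format]]
    using hompoly_sum_centered_polyfun[of r "\<lambda>d x. real d * h d x" a] hompoly_cmult h(1) by auto
qed

lemma euler_op_add:
  "polyfun r f \<Longrightarrow> polyfun r g \<Longrightarrow> euler_op a (\<lambda>x. f x + g x) = (\<lambda>x. euler_op a f x + euler_op a g x)"
  by (intro ext) (simp add: euler_op_def dderiv_add)

lemma euler_op_cmult: "polyfun r f \<Longrightarrow> euler_op a (\<lambda>x. c * f x) = (\<lambda>x. c * euler_op a f x)"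
  by (intro ext) (simp add: euler_op_def dderiv_cmult)

lemma lowering_op_add:
  assumes "polyfun r f" "polyfun r g"
  shows "lowering_op a r (\<lambda>x. f x + g x) x = lowering_op a r f x + lowering_op a r g x"
  unfolding lowering_op_def euler_op_add[OF assms]
    euler_op_add[OF polyfun_euler_op[OF assms(1)] polyfun_euler_op[OF assms(2)]]
  by (simp add: algebra_simps)

lemma lowering_op_cmult:
  assumes "polyfun r f"
  shows "lowering_op a r (\<lambda>x. c * f x) x = c * lowering_op a r f x"
  unfolding lowering_op_def euler_op_cmult[OF assms] euler_op_cmult[OF polyfun_euler_op[OF assms]]
  by (simp add: algebra_simps)

text \<open>At x the square of the Euler operator is the second radial derivative plus the first,
  since the radial vector itself varies. So all terms consist of the three given quantities.\<close>

lemma lowering_op_eq_0: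
  assumes f: "polyfun r f"
    and z: "f x = 0" "dderiv (x - a) f x = 0" "dderiv (x - a) (dderiv (x - a) f) x = 0"
  shows "lowering_op a r f x = 0"
proof -
  let ?y = "x - a"
  obtain p where p: "\<And>s. poly p s = f (a + s *\<^sub>R ?y)" using polyfun_line[OF f] by metis
  note p1 = poly_pderiv_line[OF f p]
  note p2 = poly_pderiv_line[OF polyfun_dderiv[OF f] p1]
  \<comment> \<open>On the line through a and x the Euler operator is s d/ds.\<close>
  have "poly ([:0, 1:] * pderiv p) s = euler_op a f (a + s *\<^sub>R ?y)" for s
    by (simp add: p1 euler_op_def dderiv_scaleR[OF f])
  from poly_pderiv_line[OF polyfun_euler_op[OF f] this, of 1]
  have "euler_op a (euler_op a f) x = poly (pderiv p) 1 + poly (pderiv (pderiv p)) 1"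
    unfolding euler_op_def[of a "euler_op a f"] by (simp add: pderiv_mult pderiv_pCons)
  then show ?thesis using z by (simp add: lowering_op_def p1 p2) (simp add: euler_op_def)
qed

interpretation fp: scalar_space_pair fun_scale fun_scale
  by unfold_locales

section \<open>The lowering map on splines\<close>

context powell_sabin
begin

lemma pieces_unique:
  assumes "pieces r q P" "pieces r q Q" "j < 6"
  shows "P j = Q j"
proof -
  have "(\<lambda>x. P j x - Q j x) = (\<lambda>x. 0)"
  proof (rule polyfun_eq_0_if_interior[OF _ interior_tri[OF assms(3)]])
    show "polyfun r (\<lambda>x. P j x - Q j x)" using piecesD(1) assms by (intro polyfun_diff) auto
    show "P j x - Q j x = 0" if "x \<in> tri j" for x
      using piecesD(2)[OF assms(1,3) that] piecesD(2)[OF assms(2,3) that] by simp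
  qed
  then show ?thesis by (simp add: fun_eq_iff)
qed

lemma radial_in_tri:
  assumes "x \<in> tri j" "0 \<le> s" "s \<le> 1"
  shows "z 0 + s *\<^sub>R (x - z 0) \<in> tri j"
  using convexD_alt[OF convex_tri z0_tri assms] by (simp add: algebra_simps)

text \<open>Intersections of the triangles are star-shaped about \<open>z 0\<close>, so comparing
  powers of s shows that the homogeneous components match separately, in value and gradient. Weights
  depending only on the degree preserve this.\<close>

lemma compatible_lowering:
  assumes P: "\<And>j. j < 6 \<Longrightarrow> polyfun r (P j)" and C: "compatible P" and r: "2 \<le> r"
  shows "compatible (\<lambda>j. lowering_op (z 0) r (P j))"
    "\<And>j. j < 6 \<Longrightarrow> polyfun (r - 2) (lowering_op (z 0) r (P j))"
proof -
  have "\<exists>h. (\<forall>d. hompoly d (h d)) \<and> P j = (\<lambda>x. \<Sum>d\<le>r. h d (x - z 0))" if "j < 6" for j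
    by (rule polyfun_hompoly_sum_centered[OF P[OF that]])
  then obtain h where h: "\<And>j d. j < 6 \<Longrightarrow> hompoly d (h j d)"
    "\<And>j. j < 6 \<Longrightarrow> P j = (\<lambda>x. \<Sum>d\<le>r. h j d (x - z 0))" by metis
  have L: "lowering_op (z 0) r (P j) = (\<lambda>x. \<Sum>d\<le>r - 2. lowering_weight r d * h j d (x - z 0))" if "j < 6" for j
    unfolding h(2)[OF that] by (rule lowering_op_hompoly_sum[OF h(1)[OF that] r])
  have wh: "hompoly d (\<lambda>x. lowering_weight r d * h j d x)" if "j < 6" for j d
    by (rule hompoly_cmult[OF h(1)[OF that]])
  show "polyfun (r - 2) (lowering_op (z 0) r (P j))" if "j < 6" for j
    unfolding L[OF that] using hompoly_sum_centered_polyfun[of "r - 2" "\<lambda>d x. lowering_weight r d * h j d x" "z 0"] wh[OF that]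
    by simp
  have dL: "dderiv v (lowering_op (z 0) r (P j)) x = (\<Sum>d\<le>r - 2. lowering_weight r d * dderiv v (h j d) (x - z 0))"
    if "j < 6" for j v x
    unfolding L[OF that] using dderiv_hompoly_sum_centered[of "r - 2" "\<lambda>d x. lowering_weight r d * h j d x" v "z 0" x]
      wh[OF that] dderiv_cmult[OF hompoly_polyfun[OF h(1)[OF that]]] by simp
  show "compatible (\<lambda>j. lowering_op (z 0) r (P j))"
  proof (rule compatibleI)
    fix j k :: nat and x assume j: "j < 6" and k: "k < 6" and x: "x \<in> tri j" "x \<in> tri k"
    let ?y = "x - z 0"
    have val: "h j d ?y = h k d ?y" if "d \<le> r" for d
    proof (rule power_sum_coeffs_unique[where a = "\<lambda>d. h j d ?y" and b = "\<lambda>d. h k d ?y" and n = r, OF _ that])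
      fix s :: real assume s: "0 \<le> s" "s \<le> 1"
      have "P j (z 0 + s *\<^sub>R ?y) = P k (z 0 + s *\<^sub>R ?y)"
        using compatibleD(1)[OF C j k radial_in_tri[OF x(1) s] radial_in_tri[OF x(2) s]] .
      then show "(\<Sum>d\<le>r. s ^ d * h j d ?y) = (\<Sum>d\<le>r. s ^ d * h k d ?y)"
        by (simp add: h(2)[OF j] h(2)[OF k] hompoly_scaleR[OF h(1)[OF j]] hompoly_scaleR[OF h(1)[OF k]])
    qed
    then show "lowering_op (z 0) r (P j) x = lowering_op (z 0) r (P k) x"
      using r by (simp add: L[OF j] L[OF k])
    fix v
    \<comment> \<open>Gradients of components scale with s^(d - 1); the constant component is split
      off so that the powers of s can be indexed from 0.\<close>
    have d0: "dderiv v (h j 0) = (\<lambda>x. 0)" if "j < 6" for j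
      using polyfun_0_const[OF hompoly_polyfun[OF h(1)[OF that, of 0]]] by auto
    have hs: "dderiv v (h j (Suc d)) (s *\<^sub>R ?y) = s ^ d * dderiv v (h j (Suc d)) ?y" if "j < 6" for j d s
      using hompoly_scaleR[OF hompoly_dderiv[OF h(1)[OF that, of "Suc d"], of v]] by simp
    have r': "r = Suc (r - 1)" using r by simp
    have der: "dderiv v (P j) (z 0 + s *\<^sub>R ?y) = (\<Sum>d\<le>r - 1. s ^ d * dderiv v (h j (Suc d)) ?y)" if "j < 6" for j s
    proof -
      have "dderiv v (P j) (z 0 + s *\<^sub>R ?y) = (\<Sum>d\<le>r. dderiv v (h j d) (s *\<^sub>R ?y))"
        unfolding h(2)[OF that] by (subst dderiv_hompoly_sum_centered) (simp_all add: h(1)[OF that])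
      also have "\<dots> = (\<Sum>d\<le>r - 1. dderiv v (h j (Suc d)) (s *\<^sub>R ?y))"
        by (subst r', subst sum.atMost_Suc_shift) (simp add: d0[OF that])
      finally show ?thesis by (simp add: hs[OF that])
    qed
    have "dderiv v (h j (Suc d)) ?y = dderiv v (h k (Suc d)) ?y" if "d \<le> r - 1" for d
    proof (rule power_sum_coeffs_unique[where a = "\<lambda>d. dderiv v (h j (Suc d)) ?y" and b = "\<lambda>d. dderiv v (h k (Suc d)) ?y" and n = "r - 1", OF _ that])
      fix s :: real assume s: "0 \<le> s" "s \<le> 1"
      show "(\<Sum>d\<le>r - 1. s ^ d * dderiv v (h j (Suc d)) ?y) = (\<Sum>d\<le>r - 1. s ^ d * dderiv v (h k (Suc d)) ?y)"
        using compatibleD(2)[OF C j k radial_in_tri[OF x(1) s] radial_in_tri[OF x(2) s], of v]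
        unfolding der[OF j] der[OF k] .
    qed
    then have "dderiv v (h j d) ?y = dderiv v (h k d) ?y" if "d \<le> r - 2" for d
      using that d0[OF j] d0[OF k] by (cases d) auto
    then show "dderiv v (lowering_op (z 0) r (P j)) x = dderiv v (lowering_op (z 0) r (P k)) x"
      by (simp add: dL[OF j] dL[OF k])
  qed
qed

text \<open>Neither choice matters on splines: the pieces are unique, and the lowered pieces agree
  wherever triangles meet.\<close>

definition lowering :: "nat \<Rightarrow> (real^2 \<Rightarrow> real) \<Rightarrow> real^2 \<Rightarrow> real" where
  "lowering r q x = (if x \<in> T then lowering_op (z 0) r ((SOME P. pieces r q P) (LEAST j. j < 6 \<and> x \<in> tri j)) x else 0)"

lemma lowering_pieces:
  assumes P: "pieces r q P" and r: "2 \<le> r" and j: "j < 6" "x \<in> tri j"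
  shows "lowering r q x = lowering_op (z 0) r (P j) x"
proof -
  define Q where "Q = (SOME P. pieces r q P)"
  have Q: "pieces r q Q" unfolding Q_def by (rule someI[of "pieces r q", OF P])
  define i where "i = (LEAST j. j < 6 \<and> x \<in> tri j)"
  have i: "i < 6 \<and> x \<in> tri i" unfolding i_def by (rule LeastI) (use j in blast)
  have "lowering r q x = lowering_op (z 0) r (P i) x"
    using j tri_subset_T[OF j(1)] pieces_unique[OF Q P, of i] i unfolding lowering_def Q_def[symmetric] i_def[symmetric] by auto
  also have "\<dots> = lowering_op (z 0) r (P j) x"
    using compatibleD(1)[OF compatible_lowering(1)[OF piecesD(1)[OF P] pieces_compatible[OF P] r]] i j by blast
  finally show ?thesis .
qed

lemma lowering_mem:
  assumes q: "q \<in> splines r" and r: "2 \<le> r"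
  shows "lowering r q \<in> splines (r - 2)"
proof -
  obtain P where P: "pieces r q P" using ps_S_pieces q by blast
  note L = compatible_lowering[OF piecesD(1)[OF P] pieces_compatible[OF P] r]
  have "lowering r q \<in> splines (r - 2) \<and> pieces (r - 2) (lowering r q) (\<lambda>j. lowering_op (z 0) r (P j))"
  proof (rule glue)
    show "lowering r q x = 0" if "x \<notin> T" for x using that by (simp add: lowering_def)
    show "lowering r q x = lowering_op (z 0) r (P j) x" if "j < 6" "x \<in> tri j" for j x
      by (rule lowering_pieces[OF P r that])
  qed (use L in auto)
  then show ?thesis by blast
qed

lemma lowering_add:
  assumes q: "q1 \<in> splines r" "q2 \<in> splines r" and r: "2 \<le> r"
  shows "lowering r (q1 + q2) = lowering r q1 + lowering r q2"
proof
  fix x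
  obtain P1 P2 where P: "pieces r q1 P1" "pieces r q2 P2" using ps_S_pieces q by blast
  have P12: "pieces r (q1 + q2) (\<lambda>j x. P1 j x + P2 j x)" using pieces_add[OF q(1) P(1) q(2) P(2)] by blast
  show "lowering r (q1 + q2) x = (lowering r q1 + lowering r q2) x"
  proof (cases "x \<in> T")
    case True
    then obtain j where j: "j < 6" "x \<in> tri j" using mem_T_tri by blast
    show ?thesis
      using lowering_pieces[OF P12 r j] lowering_pieces[OF P(1) r j] lowering_pieces[OF P(2) r j]
        lowering_op_add[OF piecesD(1)[OF P(1) j(1)] piecesD(1)[OF P(2) j(1)]] by simp
  qed (simp add: lowering_def)
qed

lemma lowering_scale:
  assumes q: "q \<in> splines r" and r: "2 \<le> r"
  shows "lowering r (fun_scale c q) = fun_scale c (lowering r q)"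
proof
  fix x
  obtain P where P: "pieces r q P" using ps_S_pieces q by blast
  have P': "pieces r (fun_scale c q) (\<lambda>j x. c * P j x)" using pieces_scale[OF q P] by blast
  show "lowering r (fun_scale c q) x = fun_scale c (lowering r q) x"
  proof (cases "x \<in> T")
    case True
    then obtain j where j: "j < 6" "x \<in> tri j" using mem_T_tri by blast
    show ?thesis
      using lowering_pieces[OF P' r j] lowering_pieces[OF P r j] lowering_op_cmult[OF piecesD(1)[OF P j(1)]]
      by (simp add: fun_scale_def)
  qed (simp add: lowering_def fun_scale_def)
qed

lemma ps_S0_edge:
  assumes "q \<in> splines0 r" "pieces r q P" "j < 6" "x \<in> edge j"
  shows "P j x = 0" "dderiv v (P j) x = 0"
proof -
  have "x \<in> frontier T" using assms(3,4) unfolding frontier_T by blast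
  then have 0: "q x = 0" "grad q x \<bullet> v = 0" using assms(1) unfolding mem_ps_S0' by blast+
  have "x \<in> tri j" using assms(4) edge_subset_tri by blast
  then show "P j x = 0" "dderiv v (P j) x = 0" using 0 piecesD(2,3)[OF assms(2,3)] by auto
qed

text \<open>The two boundary edges at a vertex are positive multiples of the sides of the triangle
  there. The index 2s + 5 modulo 6 is that of the preceding node, 2s - 1.\<close>

lemma corner_cross:
  assumes "s < 3"
  shows "cross2 (node (2 * s + 1) - node (2 * s)) (node ((2 * s + 5) mod 6) - node (2 * s)) \<noteq> 0"
proof -
  have "cross2 (M - A) (N - A) > 0"
    if M: "M \<in> open_segment A B" and N: "N \<in> open_segment C A" and "cross2 (B - A) (C - A) > 0" for A B C M N
  proof -
    obtain m n where m: "M = (1 - m) *\<^sub>R A + m *\<^sub>R B" "0 < m" "N = (1 - n) *\<^sub>R C + n *\<^sub>R A" "n < 1"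
      using M N unfolding in_segment by blast
    have "cross2 (M - A) (N - A) = m * (1 - n) * cross2 (B - A) (C - A)"
      unfolding m(1,3) cross2_def by (simp add: algebra_simps)
    then show ?thesis using m that(3) by simp
  qed
  from this[OF midpoints(3,2) cross_T] this[OF midpoints(1,3) cross_T_rotated(1)]
    this[OF midpoints(2,1) cross_T_rotated(2)]
  show ?thesis using assms by (elim less_3_cases) (simp_all add: node_def del: cross2_linear)
qed

text \<open>The two triangles that meet at a vertex have boundary edges in independent directions,
  so \<open>corner_second_derivative\<close> with p = \<open>z 0\<close> supplies the radial second
  derivative; value and gradient vanish by assumption.\<close>

lemma lowering_vertex:
  assumes q: "q \<in> splines0 r" and r: "2 \<le> r" and s: "s < 3"
  shows "lowering r q (node (2 * s)) = 0"
proof -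
  obtain P where P: "pieces r q P" using ps_S_pieces q unfolding mem_ps_S0 by blast
  define j where "j = 2 * s"
  define k where "k = (2 * s + 5) mod 6"
  define c where "c = node (2 * s)"
  have j: "j < 6" and k: "k < 6" using s by (auto simp: j_def k_def)
  have nk: "node (Suc k) = c" using s unfolding k_def c_def by (elim less_3_cases) (simp_all add: node_def)
  have c: "node j = c" "node (Suc j) = node (2 * s + 1)" by (simp_all add: j_def c_def)
  have "dderiv (z 0 - c) (dderiv (z 0 - c) (P j)) c = 0"
  proof (rule corner_second_derivative[OF piecesD(1)[OF P j] piecesD(1)[OF P k]])
    show "dderiv v (P j) x = dderiv v (P k) x" if "x \<in> closed_segment (z 0) c" for x v
      using compatibleD(2)[OF pieces_compatible[OF P] j k] that
        left_ray_subset_tri[of j] right_ray_subset_tri[of k] c nk by auto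
    show "dderiv v (P j) x = 0" if "x \<in> closed_segment c (node (2 * s + 1))" for x v
      using ps_S0_edge(2)[OF q P j] that c by simp
    show "dderiv v (P k) x = 0" if "x \<in> closed_segment c (node k)" for x v
      using ps_S0_edge(2)[OF q P k] that nk by (simp add: closed_segment_commute)
    show "cross2 (node (2 * s + 1) - c) (node k - c) \<noteq> 0"
      using corner_cross[OF s] unfolding c_def k_def .
  qed
  \<comment> \<open>The lowering operator uses the outward radial vector; a second derivative is
    quadratic in the direction, so the sign drops out.\<close>
  then have "dderiv (c - z 0) (dderiv (c - z 0) (P j)) c = 0"
  proof -
    have c1: "c - z 0 = (-1) *\<^sub>R (z 0 - c)" by simp
    have "dderiv (c - z 0) (P j) = (\<lambda>x. (-1) * dderiv (z 0 - c) (P j) x)"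
      unfolding c1 by (rule dderiv_scaleR[OF piecesD(1)[OF P j]])
    then have "dderiv (c - z 0) (dderiv (c - z 0) (P j)) c = (-1) * dderiv (c - z 0) (dderiv (z 0 - c) (P j)) c"
      using dderiv_cmult[OF polyfun_dderiv[OF piecesD(1)[OF P j]]] by metis
    also have "dderiv (c - z 0) (dderiv (z 0 - c) (P j)) c = (-1) * dderiv (z 0 - c) (dderiv (z 0 - c) (P j)) c"
      unfolding c1 using dderiv_scaleR[OF polyfun_dderiv[OF piecesD(1)[OF P j]]] by metis
    finally show ?thesis using \<open>dderiv (z 0 - c) (dderiv (z 0 - c) (P j)) c = 0\<close> by simp
  qed
  moreover have "P j c = 0" "dderiv (c - z 0) (P j) c = 0"
    using ps_S0_edge[OF q P j] c by auto
  ultimately have "lowering_op (z 0) r (P j) c = 0"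
    by (intro lowering_op_eq_0[OF piecesD(1)[OF P j]])
  then show ?thesis using lowering_pieces[OF P r j, of c] node_tri[of j] c by (simp add: c_def)
qed

text \<open>Along the ray to a boundary point e, a vanishing image removes the components up to
  degree r - 2, where the weights are nonzero. Value and radial derivative at e are left to
  determine the remaining two.\<close>

lemma lowering_injective:
  assumes q: "q \<in> splines0 r" and r: "2 \<le> r" and 0: "lowering r q = 0"
  shows "q = 0"
proof
  fix x
  have qS: "q \<in> splines r" using q by (simp add: mem_ps_S0)
  obtain P where P: "pieces r q P" using ps_S_pieces qS by blast
  show "q x = 0 x"
  proof (cases "x \<in> T")
    case True
    then obtain j where j: "j < 6" "x \<in> tri j" using mem_T_tri by blast
    obtain e s where e: "e \<in> edge j" "0 \<le> s" "s \<le> 1" "x = z 0 + s *\<^sub>R (e - z 0)"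
      using tri_radial[OF j(2)] by blast
    have et: "e \<in> tri j" using e(1) edge_subset_tri by blast
    obtain h where h: "\<And>d. hompoly d (h d)" "P j = (\<lambda>x. \<Sum>d\<le>r. h d (x - z 0))"
      using polyfun_hompoly_sum_centered[OF piecesD(1)[OF P j(1)]] by blast
    let ?y = "e - z 0"
    have low: "h d ?y = 0" if d: "d \<le> r - 2" for d
    proof -
      have "lowering_weight r d * h d ?y = 0"
      proof (rule power_sum_coeffs_unique[where a = "\<lambda>d. lowering_weight r d * h d ?y" and b = "\<lambda>d. 0" and n = "r - 2", OF _ d])
        fix t :: real assume t: "0 \<le> t" "t \<le> 1"
        have "lowering_op (z 0) r (P j) (z 0 + t *\<^sub>R ?y) = 0"
          using lowering_pieces[OF P r j(1) radial_in_tri[OF et t]] 0 by simp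
        then show "(\<Sum>d\<le>r - 2. t ^ d * (lowering_weight r d * h d ?y)) = (\<Sum>d\<le>r - 2. t ^ d * 0)"
          unfolding h(2) lowering_op_hompoly_sum[OF h(1) r]
          by (simp add: hompoly_scaleR[OF h(1)] mult.left_commute)
      qed
      then show ?thesis using lowering_weight_nonzero[of d r] d r by simp
    qed
    obtain k where k: "r = Suc (Suc k)" using r by (metis add_2_eq_Suc le_Suc_ex)
    have "P j e = 0" "dderiv ?y (P j) e = 0" using ps_S0_edge[OF q P j(1) e(1)] by auto
    then have "(\<Sum>d\<le>r. h d ?y) = 0" "(\<Sum>d\<le>r. real d * h d ?y) = 0"
      unfolding h(2) by (simp_all add: dderiv_hompoly_sum_centered h(1) hompoly_euler[OF h(1)])
    moreover have "(\<Sum>d\<le>k. h d ?y) = 0" "(\<Sum>d\<le>k. real d * h d ?y) = 0"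
      using low k by (auto intro!: sum.neutral)
    \<comment> \<open>A linear system for the two highest components, with determinant (2 + k) - (1
      + k) = 1.\<close>
    ultimately have e2: "h (Suc k) ?y + h (Suc (Suc k)) ?y = 0"
      "(1 + real k) * h (Suc k) ?y + (2 + real k) * h (Suc (Suc k)) ?y = 0"
      unfolding k by simp_all
    then have "h (Suc (Suc k)) ?y = 0" by (simp add: algebra_simps add_eq_0_iff)
    then have "h (Suc k) ?y = 0" using e2(1) by simp
    have all: "h d ?y = 0" if "d \<le> r" for d
    proof -
      have "d \<le> r - 2 \<or> d = Suc k \<or> d = Suc (Suc k)" using that k by auto
      then show ?thesis using low \<open>h (Suc k) ?y = 0\<close> \<open>h (Suc (Suc k)) ?y = 0\<close> by auto
    qed
    have "P j x = 0" unfolding h(2) e(4) using all by (simp add: hompoly_scaleR[OF h(1)])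
    then show ?thesis using piecesD(2)[OF P j] by simp
  next
    case False
    then show ?thesis using ps_S_zero_outside[OF qS] by simp
  qed
qed

section \<open>Upper bounds by induction on the degree\<close>

definition vertex_zero :: "nat \<Rightarrow> (real^2 \<Rightarrow> real) set" where
  "vertex_zero k = {q \<in> splines k. q (z 1) = 0 \<and> q (z 2) = 0 \<and> q (z 3) = 0}"

lemma dim_ps_S0_le:
  assumes "2 \<le> r" "fs.dim_upto (vertex_zero (r - 2)) d"
  shows "fs.dim_upto (splines0 r) d"
proof (rule fp.dim_upto_injective[OF subspace_ps_S0, where T = "lowering r"])
  have S: "splines0 r \<subseteq> splines r" by (rule ps_S0_subset)
  show "lowering r (x + y) = lowering r x + lowering r y" if "x \<in> splines0 r" "y \<in> splines0 r" for x y
    using that S assms(1) by (intro lowering_add) auto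
  show "lowering r (fun_scale c x) = fun_scale c (lowering r x)" if "x \<in> splines0 r" for c x
    using that S assms(1) by (intro lowering_scale) auto
  show "x = 0" if "x \<in> splines0 r" "lowering r x = 0" for x
    by (rule lowering_injective[OF that(1) assms(1) that(2)])
  show "lowering r ` splines0 r \<subseteq> vertex_zero (r - 2)"
  proof safe
    fix q assume q: "q \<in> splines0 r"
    then have "lowering r q \<in> splines (r - 2)" using S assms(1) by (intro lowering_mem) auto
    moreover have "lowering r q (node (2 * 0)) = 0" "lowering r q (node (2 * 1)) = 0" "lowering r q (node (2 * 2)) = 0"
      by (rule lowering_vertex[OF q assms(1)]; simp)+
    ultimately show "lowering r q \<in> vertex_zero (r - 2)" by (simp add: vertex_zero_def)
  qed
qed (rule assms)

text \<open>The barycentric coordinates are splines of degree k \<ge> 1 and are dual to the three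
  vertex evaluations. Each evaluation is thus nonzero on the kernel of the earlier ones and lowers
  the dimension by one.\<close>

lemma dim_vertex_zero_le:
  assumes k: "1 \<le> k" and d: "fs.dim_upto (splines k) (d + 3)"
  shows "fs.dim_upto (vertex_zero k) d"
proof -
  have aff: "(\<lambda>x. if x \<in> T then c + v \<bullet> x else 0) \<in> splines k" for c v
  proof (rule global_polyfun_mem_ps_S)
    show "polyfun k (\<lambda>x. c + v \<bullet> x)" using polyfun_affine[of "k - 1" c v] k by simp
  qed
  note cr = cross_T[THEN less_imp_neq, symmetric] cross_T_rotated[THEN less_imp_neq, symmetric]
  have dual: "\<exists>u\<in>splines k. u A = 1 \<and> u B = 0 \<and> u C = 0"
    if c: "cross2 (B - A) (C - A) \<noteq> 0" and t: "A \<in> T" "B \<in> T" "C \<in> T" for A B C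
  proof -
    obtain k0 v where "k0 + v \<bullet> A = 1" "k0 + v \<bullet> B = 0" "k0 + v \<bullet> C = 0" using affine_dual[OF c] by blast
    then show ?thesis using t by (intro bexI[OF _ aff[of k0 v]]) simp
  qed
  obtain u1 where u1: "u1 \<in> splines k" "u1 (z 1) = 1" using dual[OF cr(1)] z_in_T by blast
  obtain u2 where u2: "u2 \<in> splines k" "u2 (z 2) = 1" "u2 (z 1) = 0" using dual[OF cr(2)] z_in_T by blast
  obtain u3 where u3: "u3 \<in> splines k" "u3 (z 3) = 1" "u3 (z 1) = 0" "u3 (z 2) = 0"
    using dual[OF cr(3)] z_in_T by blast
  note S = subspace_ps_S[of k]
  let ?U1 = "{q \<in> splines k. q (z 1) = 0}"
  let ?U2 = "{q \<in> ?U1. q (z 2) = 0}"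
  have s1: "fs.subspace ?U1" by (rule fs.subspace_kernel_on[OF S linear_fun_eval])
  have s2: "fs.subspace ?U2" by (rule fs.subspace_kernel_on[OF s1 linear_fun_eval])
  have "fs.dim_upto ?U1 (d + 2)"
    by (rule fs.dim_upto_proper_kernel[OF S linear_fun_eval u1(1)]) (use u1 d in \<open>simp_all add: eval_nat_numeral\<close>)
  then have "fs.dim_upto ?U2 (d + 1)"
    by (intro fs.dim_upto_proper_kernel[OF s1 linear_fun_eval, of u2]) (use u2 in simp_all)
  then have "fs.dim_upto {q \<in> ?U2. q (z 3) = 0} d"
    by (intro fs.dim_upto_proper_kernel[OF s2 linear_fun_eval, of u3]) (use u3 in simp_all)
  then show ?thesis by (rule fs.dim_upto_mono) (auto simp: vertex_zero_def)
qed

text \<open>The base of the induction: affine pieces with common value and gradient at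
  \<open>z 0\<close> coincide, and an affine function that vanishes at the vertices vanishes on
  their convex hull.\<close>

lemma vertex_zero_linear:
  assumes q: "q \<in> vertex_zero k" and k: "k \<le> 1"
  shows "q = 0"
proof
  fix x
  have qS: "q \<in> splines k" using q by (simp add: vertex_zero_def)
  obtain P where P: "pieces k q P" using ps_S_pieces qS by blast
  have aff: "\<exists>c v. P j = (\<lambda>x. c + v \<bullet> x)" if "j < 6" for j
    using polyfun_1_affine[OF piecesD(1)[OF P that] k] .
  have same: "P j = P 0" if j: "j < 6" for j
  proof -
    obtain c v where 1: "P j = (\<lambda>x. c + v \<bullet> x)" using aff[OF j] by blast
    obtain c' v' where 2: "P 0 = (\<lambda>x. c' + v' \<bullet> x)" using aff[of 0] by auto
    have D: "dderiv w (\<lambda>x. a + u \<bullet> x) y = u \<bullet> w" for w u y :: "real^2" and a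
      by (rule dderiv_eq) (auto intro!: derivative_eq_intros)
    note C = compatibleD[OF pieces_compatible[OF P] j, of 0 "z 0"]
    have "v \<bullet> w = v' \<bullet> w" for w using C(2)[of w] z0_tri unfolding 1 2 D by simp
    then have "v = v'" by (meson vector_eq_rdot)
    moreover have "c + v \<bullet> z 0 = c' + v' \<bullet> z 0" using C(1) z0_tri unfolding 1 2 by simp
    ultimately show ?thesis unfolding 1 2 by simp
  qed
  obtain c v where cv: "P 0 = (\<lambda>x. c + v \<bullet> x)" using aff[of 0] by auto
  have qT: "q y = c + v \<bullet> y" if y: "y \<in> T" for y
  proof -
    obtain j where j: "j < 6" "y \<in> tri j" using mem_T_tri y by blast
    show ?thesis using piecesD(2)[OF P j] same[OF j(1)] cv by simp
  qed
  have vz: "c + v \<bullet> z 1 = 0" "c + v \<bullet> z 2 = 0" "c + v \<bullet> z 3 = 0"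
    using q qT z_in_T unfolding vertex_zero_def by auto
  show "q x = 0 x"
  proof (cases "x \<in> T")
    case True
    then obtain a b d where x: "a + b + d = 1" "x = a *\<^sub>R z 1 + b *\<^sub>R z 2 + d *\<^sub>R z 3"
      unfolding ps_T_def mem_triangle by blast
    have "c + v \<bullet> x = (a + b + d) * c + a * (v \<bullet> z 1) + b * (v \<bullet> z 2) + d * (v \<bullet> z 3)"
      unfolding x(1) x(2) by (simp add: inner_add_right)
    also have "\<dots> = a * (c + v \<bullet> z 1) + b * (c + v \<bullet> z 2) + d * (c + v \<bullet> z 3)"
      by (simp add: algebra_simps)
    finally show ?thesis using vz qT[OF True] by simp
  next
    case False
    then show ?thesis using ps_S_zero_outside[OF qS] by simp
  qed
qed

text \<open>The bound for \<open>vertex_zero\<close> is the one carried through the induction: at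
  degree k - 2 it bounds \<open>splines0 k\<close>, then \<open>splines k\<close>, and subtracting 3
  restores it at degree k. For k \<le> 1 its value is 0.\<close>

lemma dim_bounds:
  "fs.dim_upto (vertex_zero k) (3 * k * (k - 1)) \<and>
   (2 \<le> k \<longrightarrow> fs.dim_upto (splines0 k) (3 * (k - 2) * (k - 3)) \<and>
      fs.dim_upto (splines k) (3 * k * (k - 1) + 3))"
proof (induction k rule: less_induct)
  case (less k)
  show ?case
  proof (cases "k \<le> 1")
    case True
    then have "fs.dim_upto (vertex_zero k) 0"
      using vertex_zero_linear by (intro fs.dim_upto_zero) auto
    then show ?thesis using True by (auto intro: fs.dim_upto_mono)
  next
    case False
    then have k: "2 \<le> k" by simp
    then have "fs.dim_upto (vertex_zero (k - 2)) (3 * (k - 2) * (k - 2 - 1))"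
      using less.IH[of "k - 2"] by simp
    then have S0: "fs.dim_upto (splines0 k) (3 * (k - 2) * (k - 3))"
      using dim_ps_S0_le[OF k] by (simp add: diff_diff_left eval_nat_numeral)
    \<comment> \<open>At k = 2 the truncated k - 3 and the absent split-point functionals compensate
      each other, so the closed form is the same.\<close>
    have "3 * (k - 2) * (k - 3) + (9 + (if 3 \<le> k then 6 else 0) + 6 * (k - 2) + 6 * (k - 3)) = 3 * k * (k - 1) + 3"
    proof (cases "k = 2")
      case False
      then have "3 \<le> k" using k by simp
      then obtain m where "k = 3 + m" using le_Suc_ex by blast
      then have m: "k = m + 3" by simp
      then show ?thesis by (simp add: algebra_simps)
    qed simp
    then have S: "fs.dim_upto (splines k) (3 * k * (k - 1) + 3)"
      using dim_ps_S_le[OF k S0] by (simp only:)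
    then have "fs.dim_upto (vertex_zero k) (3 * k * (k - 1))"
      using k by (intro dim_vertex_zero_le) auto
    then show ?thesis using S0 S by blast
  qed
qed

end

section \<open>Counting the smoothness conditions\<close>

text \<open>Coefficient vectors of six unrelated pieces: the index (j, d, i) stands for triangle j,
  degree d and exponent i of the first coordinate.\<close>

interpretation cs: scalar_space "\<lambda>(a::real) (f::nat \<times> nat \<times> nat \<Rightarrow> real) p. a * f p"
  by unfold_locales (auto simp: fun_eq_iff algebra_simps)

interpretation cfp: scalar_space_pair "\<lambda>(a::real) (f::nat \<times> nat \<times> nat \<Rightarrow> real) p. a * f p" fun_scale
  by unfold_locales

lemma sum_fun_apply: "(\<Sum>i\<in>I. f i) x = (\<Sum>i\<in>I. f i x)"
  by (induction I rule: infinite_finite_induct) auto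

definition supported :: "(nat \<times> nat \<times> nat) set \<Rightarrow> (nat \<times> nat \<times> nat \<Rightarrow> real) set" where
  "supported I = {c. \<forall>p. p \<notin> I \<longrightarrow> c p = 0}"

lemma subspace_supported: "cs.subspace (supported I)"
  unfolding cs.subspace_def supported_def by auto

lemma card_le_dim_supported:
  assumes "finite I" "cs.dim_upto (supported I) n"
  shows "card I \<le> n"
proof (rule cs.card_le_dim_upto[OF assms(2,1), of "\<lambda>p k. if k = p then 1 else 0"])
  show "(\<lambda>p k. if k = p then 1 else 0) ` I \<subseteq> supported I" by (auto simp: supported_def)
  fix c assume "(\<Sum>i\<in>I. (\<lambda>p. c i * (if p = i then 1 else 0))) = (0 :: nat \<times> nat \<times> nat \<Rightarrow> real)"
  then have "(\<Sum>i\<in>I. c i * (if p = i then 1 else 0)) = 0" for p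
    by (metis (no_types, lifting) sum_fun_apply sum.cong zero_fun_apply)
  moreover have "(\<Sum>i\<in>I. c i * (if p = i then 1 else 0)) = c p" if "p \<in> I" for p
  proof -
    have "(\<Sum>i\<in>I. c i * (if p = i then 1 else 0)) = (\<Sum>i\<in>I. if i = p then c i else 0)"
      by (intro sum.cong) auto
    then show ?thesis using that assms(1) by (simp add: sum.delta)
  qed
  ultimately show "\<forall>i\<in>I. c i = 0" by metis
qed

definition hpart :: "(nat \<times> nat \<times> nat \<Rightarrow> real) \<Rightarrow> nat \<Rightarrow> nat \<Rightarrow> real^2 \<Rightarrow> real" where
  "hpart c j d y = (\<Sum>i\<le>d. c (j, d, i) * ((y $ 1) ^ i * (y $ 2) ^ (d - i)))"

lemma hompoly_hpart: "hompoly d (hpart c j d)"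
proof -
  have "hompoly d (\<lambda>y::real^2. \<Sum>i\<le>d. c (j, d, i) * ((y $ 1) ^ i * (y $ 2) ^ (d - i)))"
  proof (intro hompoly_sum hompoly_cmult)
    fix i assume "i \<in> {..d}"
    then show "hompoly d (\<lambda>y::real^2. (y $ 1) ^ i * (y $ 2) ^ (d - i))" using hompoly_monomial[of i "d - i"] by simp
  qed
  then show ?thesis unfolding hpart_def[abs_def] .
qed

lemma hpart_add: "hpart (c + c') j d y = hpart c j d y + hpart c' j d y"
  by (simp add: hpart_def distrib_right sum.distrib)

lemma hpart_scale: "hpart (\<lambda>p. a * c p) j d y = a * hpart c j d y"
  by (simp add: hpart_def sum_distrib_left mult.assoc)

text \<open>Setting the second coordinate to 1 leaves a univariate polynomial with the same
  coefficients.\<close>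

lemma hpart_eq_0:
  assumes "hpart c j d = (\<lambda>y. 0)" "i \<le> d"
  shows "c (j, d, i) = 0"
proof (rule power_sum_coeffs_unique[where b = "\<lambda>_. 0", OF _ assms(2)])
  fix s :: real
  have "hpart c j d (vector [s, 1]) = 0" using assms(1) by simp
  then show "(\<Sum>i\<le>d. s ^ i * c (j, d, i)) = (\<Sum>i\<le>d. s ^ i * 0)"
    by (simp add: hpart_def vector_2 mult.commute)
qed

context powell_sabin
begin

definition coeff_piece :: "nat \<Rightarrow> (nat \<times> nat \<times> nat \<Rightarrow> real) \<Rightarrow> nat \<Rightarrow> real^2 \<Rightarrow> real" where
  "coeff_piece r c j x = (\<Sum>d\<le>r. hpart c j d (x - z 0))"

definition coeff_spline :: "nat \<Rightarrow> (nat \<times> nat \<times> nat \<Rightarrow> real) \<Rightarrow> real^2 \<Rightarrow> real" where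
  "coeff_spline r c x = (if x \<in> T then coeff_piece r c (LEAST j. j < 6 \<and> x \<in> tri j) x else 0)"

definition coeff_index :: "nat \<Rightarrow> (nat \<times> nat \<times> nat) set" where
  "coeff_index r = {..<6} \<times> (SIGMA d:{..r}. {..d})"

text \<open>The \<open>C\<^sup>1\<close> conditions across the rays through the nodes, sorted by degree. For homogeneous
  polynomials of degree at most \<open>1\<close> one of the six rays is redundant; for higher degrees equality
  of gradients implies equality of values by Euler's identity.\<close>

definition coeff_conditions :: "nat \<Rightarrow> ((nat \<times> nat \<times> nat \<Rightarrow> real) \<Rightarrow> real) set" where
  "coeff_conditions r =
     (\<lambda>(j, d, i) c. c (j, d, i) - c (Suc j, d, i)) ` ({..<5} \<times> {(0, 0), (1, 0), (1, 1)}) \<union>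
     (\<lambda>(j, d, v) c. dderiv v (hpart c j d) (node (Suc j) - z 0)
        - dderiv v (hpart c (Suc j mod 6) d) (node (Suc j) - z 0))
       ` ({..<6} \<times> {2..r} \<times> {axis 1 1, axis 2 1})"

lemma card_coeff_index: "card (coeff_index r) = 3 * (r + 1) * (r + 2)"
proof -
  have "(\<Sum>d\<le>r. Suc d) * 2 = (r + 1) * (r + 2)"
    by (induction r) auto
  moreover have "card (coeff_index r) = 6 * (\<Sum>d\<le>r. Suc d)"
    unfolding coeff_index_def by (simp add: card_cartesian_product)
  ultimately show ?thesis by linarith
qed

lemma finite_coeff_conditions: "finite (coeff_conditions r)"
  unfolding coeff_conditions_def by simp

text \<open>There are 15 = 5 * 3 conditions in degrees 0 and 1, and at most 12 (r - 1) from two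
  partial derivatives on six rays in each degree from 2 to r.\<close>

lemma card_coeff_conditions:
  assumes "2 \<le> r"
  shows "card (coeff_conditions r) \<le> 12 * r + 3"
proof -
  let ?A = "{..<5::nat} \<times> {(0, 0), (1, 0), (1, 1::nat) :: nat \<times> nat}"
  let ?B = "{..<6::nat} \<times> {2..r} \<times> {axis 1 1, axis 2 1 :: real^2}"
  have "card {(0, 0), (1, 0), (1, 1::nat) :: nat \<times> nat} \<le> 3" by (simp add: card_insert_if)
  then have A: "card (f ` ?A) \<le> 15" for f :: "_ \<Rightarrow> (nat \<times> nat \<times> nat \<Rightarrow> real) \<Rightarrow> real"
    by (intro order_trans[OF card_image_le]) (simp_all add: card_cartesian_product)
  have "card {axis 1 1, axis 2 1 :: real^2} \<le> 2" by (simp add: card_insert_if)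
  then have "(r - 1) * card {axis 1 1, axis 2 1 :: real^2} \<le> (r - 1) * 2" by (rule mult_le_mono2)
  moreover have "card ?B = 6 * ((r - 1) * card {axis 1 1, axis 2 1 :: real^2})"
    using assms by (simp add: card_cartesian_product)
  ultimately have "card ?B \<le> 6 * ((r - 1) * 2)" by linarith
  then have B: "card (f ` ?B) \<le> 6 * ((r - 1) * 2)" for f :: "_ \<Rightarrow> (nat \<times> nat \<times> nat \<Rightarrow> real) \<Rightarrow> real"
    by (intro order_trans[OF card_image_le]) simp_all
  have "card (coeff_conditions r) \<le> 15 + 6 * ((r - 1) * 2)"
    unfolding coeff_conditions_def by (rule order_trans[OF card_Un_le add_mono[OF A B]])
  also have "\<dots> = 12 * r + 3" using assms by simp
  finally show ?thesis .
qed

lemma dderiv_hpart_add: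
  "dderiv v (hpart (c + c') j d) = (\<lambda>y. dderiv v (hpart c j d) y + dderiv v (hpart c' j d) y)"
proof -
  have "hpart (c + c') j d = (\<lambda>y. hpart c j d y + hpart c' j d y)"
    by (simp add: fun_eq_iff hpart_add)
  then show ?thesis
    using dderiv_add[OF hompoly_polyfun[OF hompoly_hpart] hompoly_polyfun[OF hompoly_hpart]] by simp
qed

lemma dderiv_hpart_scale:
  "dderiv v (hpart (\<lambda>p. a * c p) j d) = (\<lambda>y. a * dderiv v (hpart c j d) y)"
proof -
  have "hpart (\<lambda>p. a * c p) j d = (\<lambda>y. a * hpart c j d y)"
    by (simp add: fun_eq_iff hpart_scale)
  then show ?thesis using dderiv_cmult[OF hompoly_polyfun[OF hompoly_hpart]] by simp
qed

lemma linear_coeff_conditions: "f \<in> coeff_conditions r \<Longrightarrow> cs.linear_fun_on U f"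
  unfolding coeff_conditions_def cs.linear_fun_on_def
  by (auto simp: dderiv_hpart_add dderiv_hpart_scale algebra_simps)

lemma polyfun_coeff_piece: "polyfun r (coeff_piece r c j)"
  unfolding coeff_piece_def[abs_def] by (rule hompoly_sum_centered_polyfun) (rule hompoly_hpart)

lemma dderiv_coeff_piece:
  "dderiv v (coeff_piece r c j) x = (\<Sum>d\<le>r. dderiv v (hpart c j d) (x - z 0))"
  unfolding coeff_piece_def[abs_def] by (rule dderiv_hompoly_sum_centered) (rule hompoly_hpart)

lemma node_mod: "j < 6 \<Longrightarrow> node (Suc j mod 6) = node (Suc j)"
  by (elim less_6_cases) (simp_all add: node_def)

lemma chain_eq:
  assumes "\<And>i. i < 5 \<Longrightarrow> f i = f (Suc i)" "j < (6::nat)"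
  shows "f j = f 0"
  using assms(2) by (induction j) (use assms(1) in force)+

text \<open>Homogeneity spreads agreement at a node along the whole ray from \<open>z 0\<close>, and
  by \<open>tri_inter\<close> two different triangles meet only in such a ray or in
  \<open>z 0\<close>.\<close>

lemma coeff_conditions_imp_C1:
  assumes c: "\<forall>f\<in>coeff_conditions r. f c = 0"
  shows "compatible (coeff_piece r c)"
proof -
  have low: "c (j, d, i) = c (0, d, i)" if "(d, i) \<in> {(0, 0), (1, 0), (1, 1)}" "j < 6" for j d i
  proof (rule chain_eq[of "\<lambda>j. c (j, d, i)", OF _ that(2)])
    fix k :: nat assume "k < 5"
    then have "c (k, d, i) - c (Suc k, d, i) = 0"
      using that(1) by (intro c[rule_format, of "\<lambda>c. c (k, d, i) - c (Suc k, d, i)"])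
        (auto simp: coeff_conditions_def intro!: image_eqI[of _ _ "(k, d, i)"])
    then show "c (k, d, i) = c (Suc k, d, i)" by simp
  qed
  have lowH: "hpart c j d = hpart c 0 d" if "d \<le> 1" "j < 6" for j d
  proof -
    have "d = 0 \<or> d = 1" using that(1) by linarith
    then show ?thesis
      by (elim disjE) (use low[OF _ that(2)] in \<open>simp_all add: hpart_def fun_eq_iff\<close>)
  qed
  have grad: "dderiv v (hpart c j d) (node (Suc j) - z 0) = dderiv v (hpart c (Suc j mod 6) d) (node (Suc j) - z 0)"
    if d: "d \<le> r" and j: "j < 6" for j d v
  proof (cases "d \<le> 1")
    case True
    then show ?thesis using lowH[OF True j] lowH[OF True, of "Suc j mod 6"] by simp
  next
    case False
    let ?w = "node (Suc j) - z 0"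
    have e: "dderiv e (hpart c j d) ?w = dderiv e (hpart c (Suc j mod 6) d) ?w"
      if "e \<in> {axis 1 1, axis 2 1}" for e
    proof -
      have "dderiv e (hpart c j d) ?w - dderiv e (hpart c (Suc j mod 6) d) ?w = 0"
        using False d j that
        by (intro c[rule_format, of "\<lambda>c. dderiv e (hpart c j d) ?w - dderiv e (hpart c (Suc j mod 6) d) ?w"])
          (auto simp: coeff_conditions_def intro!: image_eqI[of _ _ "(j, d, e)"])
      then show ?thesis by simp
    qed
    show ?thesis
      by (subst (1 2) vector2_expand)
        (simp add: dderiv_linear[OF hompoly_polyfun[OF hompoly_hpart]] e)
  qed
  have val: "hpart c j d (node (Suc j) - z 0) = hpart c (Suc j mod 6) d (node (Suc j) - z 0)"
    if d: "d \<le> r" and j: "j < 6" for j d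
  \<comment> \<open>Euler's identity carries no information in degree 0.\<close>
  proof (cases "d = 0")
    case True
    then show ?thesis using lowH[of d j] lowH[of d "Suc j mod 6"] j by simp
  next
    case False
    have "real d * hpart c j d (node (Suc j) - z 0) = real d * hpart c (Suc j mod 6) d (node (Suc j) - z 0)"
      using grad[OF d j, of "node (Suc j) - z 0"] by (simp add: hompoly_euler[OF hompoly_hpart])
    then show ?thesis using False by simp
  qed
  have ray: "coeff_piece r c j x = coeff_piece r c (Suc j mod 6) x \<and>
      dderiv v (coeff_piece r c j) x = dderiv v (coeff_piece r c (Suc j mod 6)) x"
    if j: "j < 6" and x: "x \<in> closed_segment (z 0) (node (Suc j))" for j x v
  proof -
    obtain s where "x = (1 - s) *\<^sub>R z 0 + s *\<^sub>R node (Suc j)" using x unfolding in_segment by blast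
    then have x: "x - z 0 = s *\<^sub>R (node (Suc j) - z 0)" by (simp add: algebra_simps)
    show ?thesis
      unfolding dderiv_coeff_piece coeff_piece_def x hompoly_scaleR[OF hompoly_hpart]
        hompoly_scaleR[OF hompoly_dderiv[OF hompoly_hpart]]
      using val[OF _ j] grad[OF _ j] by simp
  qed
  \<comment> \<open>Triangles that are not neighbours share only \<open>z 0\<close>; agreement there
    is passed on from neighbour to neighbour.\<close>
  have centre: "coeff_piece r c j (z 0) = coeff_piece r c 0 (z 0) \<and>
      dderiv v (coeff_piece r c j) (z 0) = dderiv v (coeff_piece r c 0) (z 0)" if "j < 6" for j v
  proof -
    have "(coeff_piece r c j (z 0), dderiv v (coeff_piece r c j) (z 0)) =
        (coeff_piece r c 0 (z 0), dderiv v (coeff_piece r c 0) (z 0))"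
    proof (rule chain_eq[of "\<lambda>j. (coeff_piece r c j (z 0), dderiv v (coeff_piece r c j) (z 0))", OF _ that])
      fix i :: nat assume "i < 5"
      then show "(coeff_piece r c i (z 0), dderiv v (coeff_piece r c i) (z 0)) =
          (coeff_piece r c (Suc i) (z 0), dderiv v (coeff_piece r c (Suc i)) (z 0))"
        using ray[of i "z 0" v] by simp
    qed
    then show ?thesis by simp
  qed
  have both: "coeff_piece r c j x = coeff_piece r c k x \<and> dderiv v (coeff_piece r c j) x = dderiv v (coeff_piece r c k) x"
    if jk: "j < 6" "k < 6" and x: "x \<in> tri j" "x \<in> tri k" for j k x v
  proof (cases "j = k")
    case False
    from tri_inter[OF jk False x] consider "x = z 0"
      | "k = Suc j mod 6" "x \<in> closed_segment (z 0) (node k)"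
      | "j = Suc k mod 6" "x \<in> closed_segment (z 0) (node j)" by blast
    then show ?thesis
    proof cases
      case 1
      then show ?thesis using centre[OF jk(1), of v] centre[OF jk(2), of v] by simp
    next
      case 2
      then show ?thesis using ray[OF jk(1), of x v] node_mod[OF jk(1)] by simp
    next
      case 3
      then show ?thesis using ray[OF jk(2), of x v] node_mod[OF jk(2)] by simp
    qed
  qed simp
  show ?thesis
    by (rule compatibleI) (use both in blast)+
qed

lemma coeff_spline_mem:
  assumes "\<forall>f\<in>coeff_conditions r. f c = 0"
  shows "coeff_spline r c \<in> splines r"
    and "j < 6 \<Longrightarrow> x \<in> tri j \<Longrightarrow> coeff_spline r c x = coeff_piece r c j x"
proof -
  have C: "compatible (coeff_piece r c)" by (rule coeff_conditions_imp_C1[OF assms])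
  have eq: "coeff_spline r c x = coeff_piece r c j x" if j: "j < 6" "x \<in> tri j" for j x
  proof -
    define i where "i = (LEAST j. j < 6 \<and> x \<in> tri j)"
    have i: "i < 6 \<and> x \<in> tri i" unfolding i_def by (rule LeastI) (use j in blast)
    have "x \<in> T" using j tri_subset_T by blast
    then have "coeff_spline r c x = coeff_piece r c i x" unfolding coeff_spline_def i_def by simp
    then show ?thesis using compatibleD(1)[OF C, of i j x] i j by simp
  qed
  have "coeff_spline r c \<in> splines r \<and> pieces r (coeff_spline r c) (coeff_piece r c)"
    by (rule glue[OF polyfun_coeff_piece C]) (simp_all add: eq, simp add: coeff_spline_def)
  then show "coeff_spline r c \<in> splines r" by blast
  show "j < 6 \<Longrightarrow> x \<in> tri j \<Longrightarrow> coeff_spline r c x = coeff_piece r c j x" by (rule eq)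
qed

text \<open>A zero spline has zero pieces, since each triangle has interior points; scaling about
  \<open>z 0\<close> then separates the degrees, and \<open>hpart_eq_0\<close> the
  coefficients.\<close>

lemma coeff_spline_injective:
  assumes c: "\<forall>f\<in>coeff_conditions r. f c = 0" and sup: "c \<in> supported (coeff_index r)"
    and 0: "coeff_spline r c = 0"
  shows "c = 0"
proof
  fix p :: "nat \<times> nat \<times> nat"
  obtain j d i where p: "p = (j, d, i)" by (cases p) auto
  show "c p = 0 p"
  proof (cases "p \<in> coeff_index r")
    case True
    then have j: "j < 6" and d: "d \<le> r" and i: "i \<le> d" by (auto simp: p coeff_index_def)
    have piece0: "coeff_piece r c j = (\<lambda>x. 0)"
      by (rule polyfun_eq_0_if_interior[OF polyfun_coeff_piece interior_tri[OF j]])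
        (use coeff_spline_mem(2)[OF c j] 0 in \<open>simp add: fun_eq_iff\<close>)
    have "hpart c j d = (\<lambda>y. 0)"
    proof
      fix y
      show "hpart c j d y = 0"
      proof (rule power_sum_coeffs_unique[where b = "\<lambda>_. 0", OF _ d])
        fix s :: real
        have "coeff_piece r c j (z 0 + s *\<^sub>R y) = 0" by (simp add: piece0)
        then show "(\<Sum>d\<le>r. s ^ d * hpart c j d y) = (\<Sum>d\<le>r. s ^ d * 0)"
          by (simp add: coeff_piece_def hompoly_scaleR[OF hompoly_hpart])
      qed
    qed
    then show ?thesis using hpart_eq_0 i p by simp
  next
    case False
    then have "c p = 0" using sup unfolding supported_def by blast
    then show ?thesis by simp
  qed
qed

text \<open>Coefficients satisfying all conditions embed into the splines, so the number of
  coefficients minus the number of conditions is at most n. The bound is stated for every admissible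
  n, which lets it be combined with upper bounds of other origin.\<close>

lemma dim_ps_S_ge:
  assumes r: "2 \<le> r" and n: "fs.dim_upto (splines r) n"
  shows "3 * r * (r - 1) + 3 \<le> n"
proof -
  let ?V = "supported (coeff_index r)"
  let ?K = "{c \<in> ?V. \<forall>f\<in>coeff_conditions r. f c = 0}"
  have lin: "coeff_piece r (c + c') j x = coeff_piece r c j x + coeff_piece r c' j x"
    "coeff_piece r (\<lambda>p. a * c p) j x = a * coeff_piece r c j x" for c c' a j x
    by (simp_all add: coeff_piece_def hpart_add hpart_scale sum.distrib sum_distrib_left)
  have "cs.dim_upto ?K n"
  proof (rule cfp.dim_upto_injective[where T = "coeff_spline r", OF _ _ _ _ _ n])
    have l: "f (c + c') = f c + f c'" "f (\<lambda>p. a * c p) = a * f c" if "f \<in> coeff_conditions r" for f c c' a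
      using linear_coeff_conditions[OF that, of UNIV] unfolding cs.linear_fun_on_def by auto
    have l0: "f 0 = 0" if "f \<in> coeff_conditions r" for f
      using l(2)[OF that, of 0 0] by (simp add: func_zero)
    show "cs.subspace ?K"
    proof (rule cs.subspaceI)
      show "0 \<in> ?K" using cs.subspace_0[OF subspace_supported] l0 by simp
      fix x y a assume x: "x \<in> ?K"
      have "f (\<lambda>p. a * x p) = 0" if "f \<in> coeff_conditions r" for f
        using l(2)[OF that, of a x] x that by simp
      then show "(\<lambda>p. a * x p) \<in> ?K" using x cs.subspace_scale[OF subspace_supported] by simp
      assume y: "y \<in> ?K"
      have "f (x + y) = 0" if "f \<in> coeff_conditions r" for f
      proof -
        have "f x = 0" "f y = 0" using x y that by blast+
        then show ?thesis using l(1)[OF that, of x y] by simp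
      qed
      then show "x + y \<in> ?K" using x y cs.subspace_add[OF subspace_supported] by simp
    qed
    show "coeff_spline r (c + c') = coeff_spline r c + coeff_spline r c'" for c c'
      by (simp add: fun_eq_iff coeff_spline_def lin)
    show "coeff_spline r (\<lambda>p. a * c p) = fun_scale a (coeff_spline r c)" for a c
      by (simp add: fun_eq_iff coeff_spline_def lin fun_scale_def)
    show "c = 0" if "c \<in> ?K" "coeff_spline r c = 0" for c
      by (rule coeff_spline_injective) (use that in auto)
    show "coeff_spline r ` ?K \<subseteq> splines r"
      using coeff_spline_mem(1) by auto
  qed
  then have "cs.dim_upto ?V (n + card (coeff_conditions r))"
    using cs.dim_upto_kernel_family[OF finite_coeff_conditions[of r] subspace_supported[of "coeff_index r"],
        where f = "\<lambda>f. f" and n = n]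
      linear_coeff_conditions by blast
  then have "card (coeff_index r) \<le> n + card (coeff_conditions r)"
    by (intro card_le_dim_supported) (simp add: coeff_index_def)
  then have "3 * (r + 1) * (r + 2) \<le> n + (12 * r + 3)"
    unfolding card_coeff_index by (rule order_trans) (use card_coeff_conditions[OF r] in simp)
  moreover obtain k where "r = k + 2" using r by (metis add.commute le_Suc_ex)
  ultimately show ?thesis by (simp add: algebra_simps)
qed

section \<open>Exact dimensions\<close>

lemma dim_ps_S:
  assumes "2 \<le> r"
  shows "fun_dim (splines r) = 3 * r * (r - 1) + 3"
proof -
  have u: "fs.dim_upto (splines r) (3 * r * (r - 1) + 3)" using dim_bounds[of r] assms by blast
  then have "fs.dim (splines r) \<le> 3 * r * (r - 1) + 3" by (rule fs.dim_upto_imp_dim_le)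
  moreover have "3 * r * (r - 1) + 3 \<le> fs.dim (splines r)"
    by (rule dim_ps_S_ge[OF assms fs.dim_upto_dim[OF u]])
  ultimately show ?thesis unfolding fun_dim_eq by linarith
qed

lemma dim_ps_S0:
  assumes "2 \<le> r"
  shows "fun_dim (splines0 r) = 3 * (r - 2) * (r - 3)"
proof -
  have u: "fs.dim_upto (splines0 r) (3 * (r - 2) * (r - 3))" using dim_bounds[of r] assms by blast
  then have le: "fs.dim (splines0 r) \<le> 3 * (r - 2) * (r - 3)" by (rule fs.dim_upto_imp_dim_le)
  \<comment> \<open>The inequality that served as an upper bound for the large space now bounds the
    small one from below. For r = 2 the upper bound 0 is already final.\<close>
  have "fs.dim_upto (splines r) (fs.dim (splines0 r) + (9 + (if 3 \<le> r then 6 else 0) + 6 * (r - 2) + 6 * (r - 3)))"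
    by (rule dim_ps_S_le[OF assms fs.dim_upto_dim[OF u]])
  then have ge: "3 * r * (r - 1) + 3 \<le> fs.dim (splines0 r) + (9 + (if 3 \<le> r then 6 else 0) + 6 * (r - 2) + 6 * (r - 3))"
    by (rule dim_ps_S_ge[OF assms])
  show ?thesis
  proof (cases "r = 2")
    case True
    then show ?thesis using le unfolding fun_dim_eq by simp
  next
    case False
    then have "3 \<le> r" using assms by simp
    then obtain m where "r = 3 + m" using le_Suc_ex by blast
    then have m: "r = m + 3" by simp
    show ?thesis using le ge unfolding fun_dim_eq m by (simp add: algebra_simps)
  qed
qed

end

section \<open>Unisolvence\<close>

text \<open>The inverse of the parametrization by the unit interval, extended to an affine function
  on the plane so that its powers are admissible test polynomials.\<close>

definition segment_param :: "real^2 \<Rightarrow> real^2 \<Rightarrow> real^2 \<Rightarrow> real" where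
  "segment_param a b x = ((x - a) \<bullet> (b - a)) / ((b - a) \<bullet> (b - a))"

definition segment_power :: "real^2 \<Rightarrow> real^2 \<Rightarrow> nat \<Rightarrow> real^2 \<Rightarrow> real" where
  "segment_power a b k x = (if x \<in> closed_segment a b then segment_param a b x ^ k else 0)"

lemma segment_param_line: "a \<noteq> b \<Longrightarrow> segment_param a b (a + s *\<^sub>R (b - a)) = s"
  by (simp add: segment_param_def)

lemma in_closed_segment_line:
  "x \<in> closed_segment a b \<longleftrightarrow> (\<exists>s. 0 \<le> s \<and> s \<le> 1 \<and> x = a + s *\<^sub>R (b - a))" for a b :: "real^2"
  unfolding in_segment by (simp add: algebra_simps)

lemma segment_power_line:
  "a \<noteq> b \<Longrightarrow> 0 \<le> s \<Longrightarrow> s \<le> 1 \<Longrightarrow> segment_power a b k (a + s *\<^sub>R (b - a)) = s ^ k"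
  unfolding segment_power_def using in_closed_segment_line[of _ a b] segment_param_line[of a b s] by auto

lemma segment_power_mem:
  assumes "k \<le> n"
  shows "segment_power a b k \<in> poly_space (int n) (closed_segment a b)"
proof -
  define v where "v = (1 / ((b - a) \<bullet> (b - a))) *\<^sub>R (b - a)"
  have "segment_param a b x = - (v \<bullet> a) + v \<bullet> x" for x
    unfolding segment_param_def inner_commute[of "x - a"]
    by (simp add: v_def inner_diff_right diff_divide_distrib)
  moreover have "polyfun n (\<lambda>x. (- (v \<bullet> a) + v \<bullet> x) ^ k)"
    using polyfun_mono[OF polyfun_affine_power assms] .
  ultimately have "polyfun n (\<lambda>x. segment_param a b x ^ k)" by simp
  then show ?thesis unfolding mem_poly_space segment_power_def by auto
qed

text \<open>Restriction to the segment makes bivariate polynomials univariate in the parameter, so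
  the n + 1 powers of the parameter form a basis.\<close>

lemma dim_poly_space_segment:
  assumes ab: "a \<noteq> b"
  shows "fun_dim (poly_space (int n) (closed_segment a b)) = Suc n"
proof -
  let ?P = "poly_space (int n) (closed_segment a b)"
  let ?B = "segment_power a b ` {..n}"
  have "?P \<subseteq> fs.span ?B"
  proof
    fix p assume "p \<in> ?P"
    then obtain f where p: "\<And>x. x \<notin> closed_segment a b \<Longrightarrow> p x = 0" and f: "polyfun n f" "\<And>x. x \<in> closed_segment a b \<Longrightarrow> p x = f x"
      unfolding mem_poly_space by blast
    obtain u where u: "degree u \<le> n" "\<And>s. poly u s = f (a + s *\<^sub>R (b - a))" using polyfun_line[OF f(1)] by metis
    have "p = (\<Sum>i\<le>n. fun_scale (coeff u i) (segment_power a b i))"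
    proof
      fix x
      show "p x = (\<Sum>i\<le>n. fun_scale (coeff u i) (segment_power a b i)) x"
      proof (cases "x \<in> closed_segment a b")
        case True
        then obtain s where s: "0 \<le> s" "s \<le> 1" "x = a + s *\<^sub>R (b - a)" unfolding in_closed_segment_line by blast
        have "p x = poly u s" using f(2)[OF True] u(2) s(3) by simp
        also have "\<dots> = (\<Sum>i\<le>n. coeff u i * s ^ i)"
          unfolding poly_altdef using u(1) by (intro sum.mono_neutral_left) (auto simp: coeff_eq_0)
        finally show ?thesis
          unfolding s(3) using segment_power_line[OF ab s(1,2)] by (simp add: sum_fun_apply fun_scale_def)
      next
        case False
        then show ?thesis using p by (simp add: sum_fun_apply fun_scale_def segment_power_def)
      qed
    qed
    also have "\<dots> \<in> fs.span ?B"
      by (intro fs.span_sum fs.span_scale fs.span_base) auto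
    finally show "p \<in> fs.span ?B" .
  qed
  moreover have "card ?B \<le> Suc n" using card_image_le[of "{..n}" "segment_power a b"] by simp
  ultimately have u: "fs.dim_upto ?P (Suc n)" unfolding fs.dim_upto_def by (intro exI[of _ ?B]) simp
  have "card {..n} \<le> fs.dim ?P"
  proof (rule fs.card_le_dim_upto[OF fs.dim_upto_dim[OF u]])
    show "?B \<subseteq> ?P" using segment_power_mem by auto
    fix c assume c: "(\<Sum>i\<le>n. fun_scale (c i) (segment_power a b i)) = 0"
    have "c i = 0" if "i \<le> n" for i
    proof (rule power_sum_coeffs_unique[where a = c and b = "\<lambda>_. 0", OF _ that])
      fix s :: real assume s: "0 \<le> s" "s \<le> 1"
      from fun_cong[OF c, of "a + s *\<^sub>R (b - a)"]
      show "(\<Sum>i\<le>n. s ^ i * c i) = (\<Sum>i\<le>n. s ^ i * 0)"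
        using segment_power_line[OF ab s] by (simp add: sum_fun_apply fun_scale_def mult.commute)
    qed
    then show "\<forall>i\<in>{..n}. c i = 0" by simp
  qed simp
  then show ?thesis using fs.dim_upto_imp_dim_le[OF u] unfolding fun_dim_eq by simp
qed

lemma dim_poly_space_neg: "k < 0 \<Longrightarrow> fun_dim (poly_space k S) = 0"
  using fs.dim_upto_imp_dim_le[OF fs.dim_upto_zero[of "poly_space k S"]]
  by (simp add: poly_space_neg fun_dim_eq func_zero)

text \<open>With c = 3 and c = 4 this covers both edge test spaces; truncated subtraction gives 0
  exactly when the degree r - c is negative.\<close>

lemma dim_poly_space_segment_diff:
  assumes "a \<noteq> b"
  shows "fun_dim (poly_space (int r - int c) (closed_segment a b)) = Suc r - c"
proof (cases "c \<le> r")
  case True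
  then have "int r - int c = int (r - c)" by simp
  then show ?thesis using dim_poly_space_segment[OF assms, of "r - c"] True by (simp add: Suc_diff_le)
next
  case False
  then show ?thesis by (simp add: dim_poly_space_neg)
qed

lemma edge_integral_segment_power:
  assumes "a \<noteq> b"
  shows "edge_integral a b (\<lambda>x. f x * segment_power a b k x) = dist a b * moment k a b f"
proof -
  have "integral {0..1} (\<lambda>s. f (linepath a b s) * segment_power a b k (linepath a b s)) =
      integral {0..1} (\<lambda>s. f (linepath a b s) * s ^ k)"
    by (rule integral_cong) (use segment_power_line[OF assms] in \<open>simp add: linepath_eq\<close>)
  then show ?thesis unfolding edge_integral_def moment_def by simp
qed

lemma moment_eq_0_if_edge_integrals:
  assumes "a \<noteq> b" "k + c \<le> r"
    and "\<forall>p\<in>poly_space (int r - int c) (closed_segment a b). edge_integral a b (\<lambda>x. f x * p x) = 0"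
  shows "moment k a b f = 0"
proof -
  have "int r - int c = int (r - c)" using assms(2) by simp
  then have "segment_power a b k \<in> poly_space (int r - int c) (closed_segment a b)"
    using segment_power_mem[of k "r - c" a b] assms(2) by simp
  then show ?thesis using assms(1,3) edge_integral_segment_power[OF assms(1), of f k] by simp
qed

text \<open>Lagrange's identity: the squares of cross and inner product add up to the product of the
  squared norms.\<close>

lemma perpendicular_cross2:
  assumes "norm v = 1" "v \<bullet> u = 0" "u \<noteq> 0"
  shows "cross2 u v \<noteq> 0"
proof -
  have "(cross2 u v)\<^sup>2 + (v \<bullet> u)\<^sup>2 = (u \<bullet> u) * (v \<bullet> v)"
    by (simp add: cross2_def inner_vec_def sum_2 power2_eq_square algebra_simps)
  moreover have "v \<bullet> v = 1" using assms(1) by (simp add: norm_eq_1)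
  ultimately have "(cross2 u v)\<^sup>2 = u \<bullet> u" using assms(2) by simp
  then show ?thesis using assms(3) by auto
qed

text \<open>The integrand is nonnegative, so a closed box around x inside \<open>S\<close> inherits
  the vanishing integral; there continuity makes the integrand zero.\<close>

lemma zero_if_integral_zero:
  fixes h :: "real^2 \<Rightarrow> real"
  assumes "compact S" "continuous_on S h" "\<And>x. x \<in> S \<Longrightarrow> 0 \<le> h x" "integral S h = 0" "x \<in> interior S"
  shows "h x = 0"
proof -
  have "integrable lborel (\<lambda>x. indicator S x *\<^sub>R h x)"
    by (rule borel_integrable_compact[OF assms(1,2)])
  then have "set_integrable lborel S h" unfolding set_integrable_def .
  then have iS: "h integrable_on S" by (rule set_borel_integral_eq_integral(1))
  obtain a b where ab: "cbox a b \<subseteq> interior S" "x \<in> box a b"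
    by (rule open_contains_cbox[OF open_interior assms(5)])
  have sub: "cbox a b \<subseteq> S" using ab(1) interior_subset by blast
  have c: "continuous_on (cbox a b) h" using continuous_on_subset[OF assms(2) sub] .
  then have i: "h integrable_on cbox a b" by (rule integrable_continuous)
  have "integral (cbox a b) h \<le> integral S h"
    by (rule integral_subset_le[OF sub i iS]) (use assms(3) in auto)
  moreover have "integral (cbox a b) h \<ge> 0"
    by (rule integral_nonneg[OF i]) (use assms(3) sub in auto)
  ultimately have "(h has_integral 0) (cbox a b)"
    using integrable_integral[OF i] assms(4) by simp
  moreover have "0 \<le> h y" if "y \<in> box a b" for y
    using assms(3) sub that box_subset_cbox by blast
  moreover have "x \<in> cbox a b" "box a b \<noteq> {}" using ab(2) box_subset_cbox by blast+
  ultimately show "h x = 0" using has_integral_0_cbox_imp_0[OF c] by blast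
qed

section \<open>Energy argument and translation of the degrees of freedom\<close>

context powell_sabin
begin

lemma ps_S0_energy_zero:
  assumes q: "q \<in> splines0 r" and 0: "integral T (\<lambda>x. rot_on T q x \<bullet> rot_on T q x) = 0"
    and x: "x \<in> T"
  shows "q x = 0"
proof -
  have qS: "q \<in> splines r" using q by (simp add: mem_ps_S0)
  obtain P where P: "pieces r q P" using ps_S_pieces qS by blast
  have "continuous_on T (rot_on T q)" using qS unfolding ps_S_def by blast
  then have c: "continuous_on T (\<lambda>x. rot_on T q x \<bullet> rot_on T q x)" by (intro continuous_intros)
  have g0: "grad q y = 0" if y: "y \<in> interior T" for y
  proof -
    have "rot_on T q y \<bullet> rot_on T q y = 0"
      by (rule zero_if_integral_zero[OF compact_T c _ 0 y]) simp
    then show ?thesis by (simp add: rot_on_inner)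
  qed
  obtain j where j: "j < 6" "x \<in> tri j" using mem_T_tri x by blast
  have d0: "dderiv v (P j) = (\<lambda>x. 0)" for v
  proof (rule polyfun_eq_0_if_interior[OF polyfun_dderiv[OF piecesD(1)[OF P j(1)]]])
    show "interior (interior (tri j)) \<noteq> {}" using interior_tri[OF j(1)] by simp
    fix y assume y: "y \<in> interior (tri j)"
    then have "y \<in> interior T" using interior_mono[OF tri_subset_T[OF j(1)]] by blast
    moreover have "y \<in> tri j" using y interior_subset by blast
    ultimately show "dderiv v (P j) y = 0" using piecesD(3)[OF P j(1), of y v] g0 by simp
  qed
  \<comment> \<open>The piece has zero gradient, and the segment starts at a boundary node, where it
    is zero.\<close>
  obtain p where p: "\<And>s. poly p s = P j (node j + s *\<^sub>R (x - node j))"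
    using polyfun_line[OF piecesD(1)[OF P j(1)]] by metis
  have "poly (pderiv p) s = 0" for s
    using poly_pderiv_line[OF piecesD(1)[OF P j(1)] p] d0 by simp
  then have "pderiv p = 0" by (intro poly_eq_0_on_unit_interval) simp
  moreover have "poly p 0 = 0" using ps_S0_edge(1)[OF q P j(1), of "node j"] by (simp add: p)
  ultimately have "p = 0" by (rule pderiv_eq_0_imp_zero)
  then show ?thesis using p[of 1] piecesD(2)[OF P j] by simp
qed

lemma sum_half_edges:
  fixes f :: "real^2 \<Rightarrow> real^2 \<Rightarrow> nat"
  assumes "\<And>j. j < 6 \<Longrightarrow> f (node j) (node (Suc j)) = m"
  shows "(\<Sum>i\<in>{1..3}. \<Sum>(a, b)\<in>half_edges z i. f a b) = 6 * m"
proof -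
  have n: "node (Suc 2) = node 3" "node (Suc 3) = node 4" "node (Suc 4) = node 5" "node (Suc 5) = node 6"
    "node (Suc 0) = node 1" "node (Suc 1) = node 2"
    by (simp_all add: eval_nat_numeral)
  have neq: "node 2 \<noteq> node 3" "node 4 \<noteq> node 5" "node 0 \<noteq> node 1"
    using node_neq[of 2] node_neq[of 4] node_neq[of 0] n by simp_all
  have f: "f (node 0) (node 1) = m" "f (node 1) (node 2) = m" "f (node 2) (node 3) = m"
    "f (node 3) (node 4) = m" "f (node 4) (node 5) = m" "f (node 5) (node 6) = m"
    using assms[of 0] assms[of 1] assms[of 2] assms[of 3] assms[of 4] assms[of 5] unfolding n by simp_all
  have "(\<Sum>(a, b)\<in>half_edges z 1. f a b) = 2 * m" "(\<Sum>(a, b)\<in>half_edges z 2. f a b) = 2 * m"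
    "(\<Sum>(a, b)\<in>half_edges z 3. f a b) = 2 * m"
    unfolding half_edges_simps using neq f by (simp_all del: node_simps)
  then show ?thesis unfolding atLeastAtMost_1_3 by simp
qed

text \<open>Edges 2s and 2s + 1 lie on the side opposite \<open>z s\<close> for s = 1, 2; the side
  with s = 0 is opposite \<open>z 3\<close>.\<close>

lemma half_edges_iff:
  "(\<forall>i\<in>{1..3}. \<forall>(a, b)\<in>half_edges z i. Q i a b) \<longleftrightarrow>
   (\<forall>j<6. Q (if j div 2 = 0 then 3 else j div 2) (node j) (node (Suc j)))"
proof -
  have n: "node (Suc 2) = node 3" "node (Suc 3) = node 4" "node (Suc 4) = node 5" "node (Suc 5) = node 6"
    "node (Suc 0) = node 1" "node (Suc 1) = node 2"
    by (simp_all add: eval_nat_numeral)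
  have all6: "(\<forall>j<6. R j) \<longleftrightarrow> R 0 \<and> R 1 \<and> R 2 \<and> R 3 \<and> R 4 \<and> R (5::nat)" for R
    by (auto elim: less_6_cases)
  show ?thesis unfolding atLeastAtMost_1_3 all6 n
    by (simp only: ball_simps half_edges_simps) (simp add: conj_ac del: node_simps)
qed

lemma unisolvent:
  assumes r: "2 \<le> r" and n: "edge_normals z n" and t: "edge_tangents z t" and q: "q \<in> splines r"
    and a: "dof_a_zero z q" and b: "dof_b_zero z t r q" and c: "dof_c_zero z n r q" and d: "dof_d_zero z r q"
    and e: "dof_e_zero z r q" and x: "x \<in> T"
  shows "q x = 0"
proof -
  define side_index where "side_index s = (if s = 0 then 3 else s)" for s :: nat
  have si: "side_index s \<in> {1..3}" if "s < 3" for s using that by (auto simp: side_index_def)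
  have zs: "z (nxt3 (side_index s + 1)) = node (2 * s)" "z (nxt3 (side_index s + 2)) = node (2 * s + 2)"
    "z (3 + side_index s) = node (2 * s + 1)" if "s < 3" for s
    using that by (elim less_3_cases; simp add: side_index_def nxt3_def node_def eval_nat_numeral)+
  have vert: "\<exists>i\<in>{1..3}. node (2 * s) = z i" if "s < 3" for s
    using that by (elim less_3_cases) (auto simp: node_def)
  have dir: "side_vec s \<noteq> 0" if "s < 3" for s
    using side(2)[OF that] by (auto simp: cross2_def)
  have C: "(\<forall>j<6. \<forall>p\<in>poly_space (int r - 3) (edge j).
      edge_integral (node j) (node (Suc j)) (\<lambda>x. (grad q x \<bullet> n (side_index (j div 2))) * p x) = 0)"
    using c unfolding dof_c_zero_def side_index_def
    by (subst (asm) half_edges_iff[of "\<lambda>i a b. \<forall>p\<in>poly_space (int r - 3) (closed_segment a b).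
        edge_integral a b (\<lambda>x. (grad q x \<bullet> n i) * p x) = 0"]) blast
  have D: "(\<forall>j<6. \<forall>p\<in>poly_space (int r - 4) (edge j).
      edge_integral (node j) (node (Suc j)) (\<lambda>x. q x * p x) = 0)"
    using d unfolding dof_d_zero_def
    by (subst (asm) half_edges_iff[of "\<lambda>i a b. \<forall>p\<in>poly_space (int r - 4) (closed_segment a b).
        edge_integral a b (\<lambda>x. q x * p x) = 0"]) blast
  have "\<forall>f\<in>boundary_dofs (\<lambda>s. n (side_index s)) r. f q = 0"
    unfolding boundary_dofs_zero_iff
  proof (intro conjI allI impI)
    fix s :: nat assume "s < 3"
    then obtain i where "i \<in> {1..3}" "node (2 * s) = z i" using vert by blast
    then have "q (node (2 * s)) = 0" "grad q (node (2 * s)) = 0" using a unfolding dof_a_zero_def by auto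
    then show "q (node (2 * s)) = 0" "grad q (node (2 * s)) \<bullet> axis 1 1 = 0"
      "grad q (node (2 * s)) \<bullet> axis 2 1 = 0" by simp_all
  next
    fix s :: nat assume s: "s < 3" and r3: "3 \<le> r"
    have z: "q (node (2 * s + 1)) = 0" "grad q (node (2 * s + 1)) \<bullet> t (side_index s) = 0"
      using b r3 si[OF s] unfolding dof_b_zero_def zs(3)[OF s, symmetric] by auto
    obtain k where k: "norm (t (side_index s)) = 1" "t (side_index s) = k *\<^sub>R (side_vec s)"
      using t si[OF s] unfolding edge_tangents_def zs(1,2)[OF s, symmetric] by blast
    \<comment> \<open>The tangent may point either way along the side; having norm 1, it is a
      nonzero multiple of the side vector.\<close>
    then have "k \<noteq> 0" by auto
    then show "q (node (2 * s + 1)) = 0" "grad q (node (2 * s + 1)) \<bullet> (side_vec s) = 0"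
      using z k(2) by simp_all
  next
    fix j k :: nat assume j: "j < 6" and k: "k < r - 2"
    then show "edge_moment k j (\<lambda>x. grad q x \<bullet> n (side_index (j div 2))) = 0"
      using C by (intro moment_eq_0_if_edge_integrals[OF node_neq[OF j], of k 3 r]) auto
  next
    fix j k :: nat assume j: "j < 6" and k: "k < r - 3"
    then show "edge_moment k j q = 0"
      using D by (intro moment_eq_0_if_edge_integrals[OF node_neq[OF j], of k 4 r]) auto
  qed
  moreover have "cross2 (side_vec s) (n (side_index s)) \<noteq> 0" if s: "s < 3" for s
    using n si[OF s] dir[OF s] unfolding edge_normals_def zs(1,2)[OF s, symmetric]
    by (intro perpendicular_cross2) auto
  ultimately have q0: "q \<in> splines0 r"
    by (intro boundary_dofs_imp_ps_S0[OF q r])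
  then have "integral T (\<lambda>x. rot_on T q x \<bullet> rot_on T q x) = 0" using e unfolding dof_e_zero_def by blast
  then show ?thesis by (rule ps_S0_energy_zero[OF q0 _ x])
qed

end

theorem lemma4p4:
  fixes z n t :: "nat \<Rightarrow> real^2" and r :: nat
  assumes "ps_points z" and "edge_normals z n" and "edge_tangents z t" and "r \<ge> 2"
  shows "int (fun_dim (ps_S (int r) z)) = 3 * int r ^ 2 - 3 * int r + 3
     \<and> ndof_a = 9
     \<and> ndof_b r = (if r \<ge> 3 then 6 else 0)
     \<and> ndof_c z r = 6 * (r - 2)
     \<and> ndof_d z r = (if r \<ge> 3 then 6 * (r - 3) else 0)
     \<and> int (ndof_e z r) = 3 * (int r - 2) * (int r - 3)
     \<and> ndof_a + ndof_b r + ndof_c z r + ndof_d z r + ndof_e z r = fun_dim (ps_S (int r) z)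
     \<and> (\<forall>q\<in>ps_S (int r) z.
          dof_a_zero z q \<and> dof_b_zero z t r q \<and> dof_c_zero z n r q \<and>
          dof_d_zero z r q \<and> dof_e_zero z r q \<longrightarrow> (\<forall>x\<in>ps_T z. q x = 0))"
proof -
  interpret powell_sabin z by unfold_locales (rule assms(1))
  have S: "fun_dim (ps_S (int r) z) = 3 * r * (r - 1) + 3" by (rule dim_ps_S[OF assms(4)])
  have a: "ndof_a = 9" by (simp add: ndof_a_def)
  have b: "ndof_b r = (if r \<ge> 3 then 6 else 0)" by (simp add: ndof_b_def)
  have c: "ndof_c z r = 6 * (r - 2)"
    unfolding ndof_c_def using dim_poly_space_segment_diff[OF node_neq, of _ r 3] by (intro sum_half_edges) simp
  have d: "ndof_d z r = 6 * (r - 3)"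
    unfolding ndof_d_def using dim_poly_space_segment_diff[OF node_neq, of _ r 4] by (intro sum_half_edges) simp
  have e: "ndof_e z r = 3 * (r - 2) * (r - 3)"
    unfolding ndof_e_def by (rule dim_ps_S0[OF assms(4)])
  have "int (fun_dim (ps_S (int r) z)) = 3 * int r ^ 2 - 3 * int r + 3"
  proof -
    \<comment> \<open>The substitution removes the truncated subtraction before the passage to
      integers.\<close>
    obtain m where "r = 2 + m" using le_Suc_ex[OF assms(4)] by blast
    then have m: "r = m + 2" by simp
    show ?thesis unfolding S unfolding m by (simp add: power2_eq_square algebra_simps)
  qed
  moreover have "int (ndof_e z r) = 3 * (int r - 2) * (int r - 3)"
    using assms(4) unfolding e by (cases "r = 2") (simp_all add: of_nat_diff)
  moreover have "ndof_a + ndof_b r + ndof_c z r + ndof_d z r + ndof_e z r = fun_dim (ps_S (int r) z)"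
  proof (cases "r = 2")
    case True
    then show ?thesis unfolding a b c d e S by simp
  next
    case False
    then have "3 \<le> r" using assms(4) by simp
    then obtain m where "r = 3 + m" using le_Suc_ex by blast
    then have m: "r = m + 3" by simp
    show ?thesis unfolding a b c d e S unfolding m by (simp add: algebra_simps)
  qed
  moreover have "\<forall>q\<in>ps_S (int r) z.
      dof_a_zero z q \<and> dof_b_zero z t r q \<and> dof_c_zero z n r q \<and>
      dof_d_zero z r q \<and> dof_e_zero z r q \<longrightarrow> (\<forall>x\<in>ps_T z. q x = 0)"
    using unisolvent[OF assms(4,2,3)] by blast
  moreover have "ndof_d z r = (if r \<ge> 3 then 6 * (r - 3) else 0)" using d by simp
  ultimately show ?thesis using a b c by blast
qed

end
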